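(* Let $m$ and $m'$ be (the Maurer--Cartan elements of) two minimal $C_\infty$-algebra enhancements of a finite-dimensional graded commutative algebra $H^*$ over a field of characteristic zero, and assume that $m\sim_{k-1}m'$, where $k\ge4$. Then: (1) The elements $\widetilde\kappa_k(p;m,m')$ defining $\mathcal K_k(m,m')$ are Harrison cocycles of bidegree $(k,2-k)$; more precisely, they lie in $C_{\mathrm{Harr}}^{k,2-k}(H^*,H^* )$. The obstruction set $\mathcal K_k(m,m')$ depends only on the truncations of $m$ and $m'$ modulo $\mathcal F^k$; equivalently, it depends only on their operations through arity $k$. (2) One has $0\in\mathcal K_k(m,m')$ if and only if $m\sim_km'$. (3) The sets $\mathcal K_k(m,m)$ and $\mathcal K_k(m',m')$ are equal additive subgroups of $\operatorname{Harr}^{k,2-k}(H^*,H^* )$. (4) The obstruction set $\mathcal K_k(m,m')$ is a torsor under this common subgroup.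
   Context: $C_{\mathrm{Harr}}^{n,j}(H^*,H^* )$ is the space of Harrison cochains: linear maps $(H^* )^{\otimes n}\to H^*$ of internal degree $j$ vanishing on all signed shuffle products of two nonempty tensors (signs with respect to the shifted degrees on $sH$, $(sH)^i=H^{i+1}$). $\mathfrak g=\mathfrak g_{H^*}=\prod_{n\ge2}C_{\mathrm{Harr}}^{n,*}(H^*,H^* )$ is the DGLA in which $f\in C_{\mathrm{Harr}}^{n,j}$ has degree $n+j-1$, with Gerstenhaber bracket $[f,g]=f\circ g-(-1)^{|f||g|}g\circ f$ (after suspension, the commutator of coderivations of $T^c(sH)$) and differential $\delta=[m_2,-]$, $m_2$ the multiplication; it is complete for the filtration $\mathcal F^p\mathfrak g=\prod_{n\ge p+1}C_{\mathrm{Harr}}^{n,*}$. $\operatorname{Harr}^{n,j}(H^*,H^* )$ is the cohomology of $\delta$ at $C_{\mathrm{Harr}}^{n,j}$. A minimal $C_\infty$-algebra enhancement $(H^*,0,m_2,m_3,\dots)$ corresponds to $m=m_3+m_4+\cdots\in\mathcal F^2\mathfrak g^1$, $m_n\in C_{\mathrm{Harr}}^{n,2-n}$, with $\delta m+\frac12[m,m]=0$. The gauge action of $p\in\mathcal F^1\mathfrak g^0$ is $e^{\operatorname{ad}_p}*m=e^{\operatorname{ad}_p}(m)-\sum_{j\ge0}\frac{(\operatorname{ad}_p)^j}{(j+1)!}(\delta p)$. $m\sim_km'$ (isotopic modulo $k$) means that some $C_\infty$-isotopy (a $C_\infty$-morphism with linear part $\mathrm{Id}$) transports the first structure to one agreeing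 with the second in all arities $\le k$; equivalently $e^{\operatorname{ad}_p}*m\equiv m'\pmod{\mathcal F^k\mathfrak g}$ for some $p\in\mathcal F^1\mathfrak g^0$. Put $\mathcal P_{k-1}(m,m')=\{p\in\mathcal F^1\mathfrak g^0: e^{\operatorname{ad}_p}*m-m'\in\mathcal F^{k-1}\mathfrak g\}$. For $p\in\mathcal P_{k-1}(m,m')$ let $\widetilde\kappa_k(p;m,m')$ be the image of $e^{\operatorname{ad}_p}*m-m'$ in $\mathcal F^{k-1}\mathfrak g^1/\mathcal F^k\mathfrak g^1\cong C_{\mathrm{Harr}}^{k,2-k}(H^*,H^* )$, i.e. its arity-$k$ component. The $k$-th obstruction set is $\mathcal K_k(m,m')=\{[\widetilde\kappa_k(p;m,m')]:p\in\mathcal P_{k-1}(m,m')\}\subseteq\operatorname{Harr}^{k,2-k}(H^*,H^* )$; $\mathcal K_k(m,m)$ and $\mathcal K_k(m',m')$ are defined by the same formula. "Torsor" here means a coset of the subgroup. *)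

theory Defs
  imports Complex_Main "HOL-Algebra.Coset" "HOL-Library.Function_Algebras"
begin

section \<open>Finite-dimensional graded commutative algebras\<close>

record ('k, 'v) graded_algebra =
  scal :: "'k \<Rightarrow> 'v \<Rightarrow> 'v"
  grade :: "int \<Rightarrow> 'v set"
  prd :: "'v \<Rightarrow> 'v \<Rightarrow> 'v"

text \<open>\<open>ksgn d x\<close> is \<open>(-1)\<^sup>d x\<close>.\<close>

definition ksgn :: "int \<Rightarrow> 'v::ab_group_add \<Rightarrow> 'v" where
  "ksgn d x = (if even d then x else - x)"

definition is_decomp :: "('k, 'v::ab_group_add) graded_algebra \<Rightarrow> 'v \<Rightarrow> (int \<Rightarrow> 'v) \<Rightarrow> bool" where
  "is_decomp A x c \<longleftrightarrow>
     (\<forall>i. c i \<in> grade A i) \<and> finite {i. c i \<noteq> 0} \<and> x = (\<Sum>i | c i \<noteq> 0. c i)"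

text \<open>The underlying space is the whole type \<open>'v\<close>, with an internal grading over the integers.
  A unit is not required.\<close>

locale fd_graded_comm_algebra =
  fixes A :: "('k::field_char_0, 'v::ab_group_add) graded_algebra"
  assumes vector_space: "vector_space (scal A)"
    and finite_dim: "\<exists>B. finite B \<and> module.span (scal A) B = UNIV"
    and grade_subspace: "module.subspace (scal A) (grade A i)"
    and grade_direct_sum: "\<exists>!c. is_decomp A x c"
    and prd_linear_left: "Vector_Spaces.linear (scal A) (scal A) (\<lambda>x. prd A x y)"
    and prd_linear_right: "Vector_Spaces.linear (scal A) (scal A) (\<lambda>y. prd A x y)"
    and prd_grade: "x \<in> grade A i \<Longrightarrow> y \<in> grade A j \<Longrightarrow> prd A x y \<in> grade A (i + j)"
    and prd_assoc: "prd A (prd A x y) z = prd A x (prd A y z)"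
    and prd_graded_comm:
      "x \<in> grade A i \<Longrightarrow> y \<in> grade A j \<Longrightarrow> prd A y x = ksgn (i * j) (prd A x y)"

section \<open>Harrison cochains\<close>

text \<open>A cochain of arity \<open>n\<close> is a multilinear function of lists of length \<open>n\<close>, extended by \<open>0\<close>
  to all other lists. A function on lists of all lengths then represents the family (product) of
  its components of the various arities.\<close>

definition arity_part :: "nat \<Rightarrow> ('v list \<Rightarrow> 'v::ab_group_add) \<Rightarrow> 'v list \<Rightarrow> 'v" where
  "arity_part n f = (\<lambda>xs. if length xs = n then f xs else 0)"

definition cochains ::
  "('k::field_char_0, 'v::ab_group_add) graded_algebra \<Rightarrow> nat \<Rightarrow> int \<Rightarrow> ('v list \<Rightarrow> 'v) set" where
  "cochains A n j = {f.
     (\<forall>xs. length xs \<noteq> n \<longrightarrow> f xs = 0) \<and>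
     (\<forall>xs i. length xs = n \<longrightarrow> i < n \<longrightarrow>
        Vector_Spaces.linear (scal A) (scal A) (\<lambda>x. f (xs[i := x]))) \<and>
     (\<forall>xs ds. length xs = n \<longrightarrow> list_all2 (\<lambda>x d. x \<in> grade A d) xs ds \<longrightarrow>
        f xs \<in> grade A (sum_list ds + j))}"

text \<open>The suspension \<open>sH\<close>, with \<open>(sH)\<^sup>i = H\<^sup>i\<^sup>+\<^sup>1\<close>, is identified with \<open>H\<close> as a vector space, so
  \<open>x \<in> grade A i\<close> has shifted degree \<open>i - 1\<close>. The linear map \<open>shift_sign A\<close> is the operator
  \<open>x \<mapsto> (-1)\<^sup>i\<^sup>-\<^sup>1 x\<close> on \<open>grade A i\<close>; signs that depend on the degrees of the arguments are obtained
  by applying it to these arguments.\<close>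

definition shift_sign :: "('k, 'v::ab_group_add) graded_algebra \<Rightarrow> 'v \<Rightarrow> 'v" where
  "shift_sign A x = (let c = (THE c. is_decomp A x c) in \<Sum>i | c i \<noteq> 0. ksgn (i - 1) (c i))"

definition pass_sign :: "('k, 'v::ab_group_add) graded_algebra \<Rightarrow> int \<Rightarrow> 'v \<Rightarrow> 'v" where
  "pass_sign A e x = (if even e then x else shift_sign A x)"

text \<open>\<open>susp A f\<close> is \<open>s \<circ> f \<circ> (s\<^sup>-\<^sup>1 \<otimes> \<dots> \<otimes> s\<^sup>-\<^sup>1)\<close>: by the Koszul rule, moving the copies of \<open>s\<^sup>-\<^sup>1\<close>
  (of degree 1) to their places gives the sign \<open>(-1)\<close> to the power \<open>\<Sum>\<^sub>i (n - i) \<bar>s x\<^sub>i\<bar>\<close>, \<open>1 \<le> i \<le> n\<close>.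
  In arity \<open>n\<close> and internal degree \<open>j\<close> it has degree \<open>n + j - 1\<close> on \<open>sH\<close>. Since the signs square to 1,
  \<open>susp A\<close> is also the inverse operation.\<close>

definition susp ::
  "('k, 'v::ab_group_add) graded_algebra \<Rightarrow> ('v list \<Rightarrow> 'v) \<Rightarrow> 'v list \<Rightarrow> 'v" where
  "susp A f xs =
     f (map (\<lambda>i. pass_sign A (int (length xs - 1 - i)) (xs ! i)) [0..<length xs])"

text \<open>\<open>shuffle_sum F as bs\<close> is the value of \<open>F\<close> on the signed shuffle product of two tensors of
  homogeneous elements, each listed together with the degree used for the Koszul signs.\<close>

fun shuffle_sum ::
  "('v list \<Rightarrow> 'v::ab_group_add) \<Rightarrow> (int \<times> 'v) list \<Rightarrow> (int \<times> 'v) list \<Rightarrow> 'v" where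
  "shuffle_sum F [] bs = F (map snd bs)"
| "shuffle_sum F as [] = F (map snd as)"
| "shuffle_sum F ((d, a) # as) ((e, b) # bs) =
     shuffle_sum (\<lambda>w. F (a # w)) as ((e, b) # bs) +
     ksgn (e * (d + sum_list (map fst as))) (shuffle_sum (\<lambda>w. F (b # w)) ((d, a) # as) bs)"

definition vanishes_on_shuffles ::
  "('k, 'v::ab_group_add) graded_algebra \<Rightarrow> ('v list \<Rightarrow> 'v) \<Rightarrow> bool" where
  "vanishes_on_shuffles A F \<longleftrightarrow>
     (\<forall>as bs. as \<noteq> [] \<longrightarrow> bs \<noteq> [] \<longrightarrow>
        (\<forall>(d, a) \<in> set as \<union> set bs. a \<in> grade A (d + 1)) \<longrightarrow> shuffle_sum F as bs = 0)"

definition harr_cochains ::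
  "('k::field_char_0, 'v::ab_group_add) graded_algebra \<Rightarrow> nat \<Rightarrow> int \<Rightarrow> ('v list \<Rightarrow> 'v) set" where
  "harr_cochains A n j = {f \<in> cochains A n j. vanishes_on_shuffles A (susp A f)}"

section \<open>The differential graded Lie algebra\<close>

text \<open>\<open>gla A d\<close> is the degree \<open>d\<close> part of \<open>\<Prod>\<^sub>n\<^sub>\<ge>\<^sub>2 C\<^sup>n\<^sup>,\<^sup>*\<close>: the arity \<open>n\<close> component of an element has
  internal degree \<open>j\<close> with \<open>n + j - 1 = d\<close>.\<close>

definition gla ::
  "('k::field_char_0, 'v::ab_group_add) graded_algebra \<Rightarrow> int \<Rightarrow> ('v list \<Rightarrow> 'v) set" where
  "gla A d = {f. (\<forall>xs. length xs < 2 \<longrightarrow> f xs = 0) \<and>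
                 (\<forall>n\<ge>2. arity_part n f \<in> harr_cochains A n (d + 1 - int n))}"

text \<open>\<open>gla_filt A p d\<close> is \<open>F\<^sup>p\<close> in degree \<open>d\<close>, i.e. the elements with components in arities \<open>\<ge> p + 1\<close>.\<close>

definition gla_filt ::
  "('k::field_char_0, 'v::ab_group_add) graded_algebra \<Rightarrow> nat \<Rightarrow> int \<Rightarrow> ('v list \<Rightarrow> 'v) set" where
  "gla_filt A p d = {f \<in> gla A d. \<forall>xs. length xs \<le> p \<longrightarrow> f xs = 0}"

text \<open>\<open>insertion A e F G\<close>, for \<open>G\<close> of degree \<open>e\<close> on \<open>sH\<close>, is the composite of \<open>F\<close> with the
  coderivation of the tensor coalgebra of \<open>sH\<close> induced by \<open>G\<close>: the sum over all terms
  \<open>F (x\<^sub>1, \<dots>, x\<^sub>i, G (x\<^sub>i\<^sub>+\<^sub>1, \<dots>, x\<^sub>i\<^sub>+\<^sub>l), \<dots>)\<close>, with sign \<open>(-1)\<close> to the power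
  \<open>e (\<bar>s x\<^sub>1\<bar> + \<dots> + \<bar>s x\<^sub>i\<bar>)\<close>.\<close>

definition insertion ::
  "('k, 'v::ab_group_add) graded_algebra \<Rightarrow> int \<Rightarrow> ('v list \<Rightarrow> 'v) \<Rightarrow> ('v list \<Rightarrow> 'v) \<Rightarrow>
    'v list \<Rightarrow> 'v" where
  "insertion A e F G xs =
     (\<Sum>(i, l) | i + l \<le> length xs.
        F (map (pass_sign A e) (take i xs) @ G (take l (drop i xs)) # drop (i + l) xs))"

definition circ ::
  "('k, 'v::ab_group_add) graded_algebra \<Rightarrow> int \<Rightarrow> ('v list \<Rightarrow> 'v) \<Rightarrow> ('v list \<Rightarrow> 'v) \<Rightarrow>
    'v list \<Rightarrow> 'v" where
  "circ A e f g = susp A (insertion A e (susp A f) (susp A g))"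

text \<open>The bracket of \<open>f\<close> of degree \<open>d\<close> with \<open>g\<close> of degree \<open>e\<close>.\<close>

definition bracket ::
  "('k, 'v::ab_group_add) graded_algebra \<Rightarrow> int \<Rightarrow> int \<Rightarrow> ('v list \<Rightarrow> 'v) \<Rightarrow> ('v list \<Rightarrow> 'v) \<Rightarrow>
    'v list \<Rightarrow> 'v" where
  "bracket A d e f g = circ A e f g - ksgn (d * e) (circ A d g f)"

definition m2 :: "('k, 'v::ab_group_add) graded_algebra \<Rightarrow> 'v list \<Rightarrow> 'v" where
  "m2 A xs = (if length xs = 2 then prd A (xs ! 0) (xs ! 1) else 0)"

text \<open>The differential on elements of degree \<open>d\<close>.\<close>

definition delta ::
  "('k, 'v::ab_group_add) graded_algebra \<Rightarrow> int \<Rightarrow> ('v list \<Rightarrow> 'v) \<Rightarrow> 'v list \<Rightarrow> 'v" where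
  "delta A d f = bracket A 1 d (m2 A) f"

section \<open>Harrison cohomology\<close>

definition harr_cocycles ::
  "('k::field_char_0, 'v::ab_group_add) graded_algebra \<Rightarrow> nat \<Rightarrow> int \<Rightarrow> ('v list \<Rightarrow> 'v) set" where
  "harr_cocycles A n j = {f \<in> harr_cochains A n j. delta A (int n + j - 1) f = 0}"

definition harr_coboundaries ::
  "('k::field_char_0, 'v::ab_group_add) graded_algebra \<Rightarrow> nat \<Rightarrow> int \<Rightarrow> ('v list \<Rightarrow> 'v) set" where
  "harr_coboundaries A n j = delta A (int n + j - 2) ` harr_cochains A (n - 1) j"

definition cocycle_group ::
  "('k::field_char_0, 'v::ab_group_add) graded_algebra \<Rightarrow> nat \<Rightarrow> int \<Rightarrow> ('v list \<Rightarrow> 'v) monoid" where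
  "cocycle_group A n j = \<lparr>carrier = harr_cocycles A n j, monoid.mult = (+), one = 0\<rparr>"

text \<open>The additive group underlying Harrison cohomology (written multiplicatively, as all groups
  here); its zero is the set of coboundaries. Meant for \<open>n \<ge> 2\<close>.\<close>

definition Harr ::
  "('k::field_char_0, 'v::ab_group_add) graded_algebra \<Rightarrow> nat \<Rightarrow> int \<Rightarrow> ('v list \<Rightarrow> 'v) set monoid"
  where "Harr A n j = cocycle_group A n j Mod harr_coboundaries A n j"

definition harr_class ::
  "('k::field_char_0, 'v::ab_group_add) graded_algebra \<Rightarrow> nat \<Rightarrow> int \<Rightarrow> ('v list \<Rightarrow> 'v) \<Rightarrow>
    ('v list \<Rightarrow> 'v) set" where
  "harr_class A n j f = harr_coboundaries A n j #>\<^bsub>cocycle_group A n j\<^esub> f"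

section \<open>Minimal enhancements, gauge action and isotopies\<close>

definition minimal_cinf ::
  "('k::field_char_0, 'v::ab_group_add) graded_algebra \<Rightarrow> ('v list \<Rightarrow> 'v) \<Rightarrow> bool" where
  "minimal_cinf A m \<longleftrightarrow> m \<in> gla_filt A 2 1 \<and>
     (\<forall>xs. delta A 1 m xs + scal A (1 / 2) (bracket A 1 1 m m xs) = 0)"

text \<open>The series are truncated: for \<open>p \<in> F\<^sup>1\<close> the operator \<open>ad p\<close> raises arity by at least 1, so the
  terms with \<open>j > length xs\<close> vanish on \<open>xs\<close>. Both \<open>m\<close> and \<open>\<delta> p\<close> have degree 1.\<close>

definition gauge ::
  "('k::field_char_0, 'v::ab_group_add) graded_algebra \<Rightarrow> ('v list \<Rightarrow> 'v) \<Rightarrow> ('v list \<Rightarrow> 'v) \<Rightarrow>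
    'v list \<Rightarrow> 'v" where
  "gauge A p m xs =
     (\<Sum>j\<le>length xs. scal A (1 / fact j) ((bracket A 0 1 p ^^ j) m xs)) -
     (\<Sum>j\<le>length xs. scal A (1 / fact (j + 1)) ((bracket A 0 1 p ^^ j) (delta A 0 p) xs))"

text \<open>The finitely many ways to cut a list into consecutive nonempty blocks.\<close>

definition blocks :: "'a list \<Rightarrow> 'a list list set" where
  "blocks xs = {bs. concat bs = xs \<and> [] \<notin> set bs}"

text \<open>\<open>cinf_isotopy A \<phi> m m'\<close>: the components \<open>\<phi>\<^sub>n\<close> (\<open>\<phi>\<^sub>1 = Id\<close>) form a morphism from
  \<open>(H, 0, m\<^sub>2, m\<^sub>3, \<dots>)\<close> to \<open>(H, 0, m\<^sub>2, m'\<^sub>3, \<dots>)\<close>. After suspension all components of \<open>\<phi>\<close> have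
  degree 0 and all operations degree 1, so that signs occur only on the right-hand side.\<close>

definition cinf_isotopy ::
  "('k::field_char_0, 'v::ab_group_add) graded_algebra \<Rightarrow> ('v list \<Rightarrow> 'v) \<Rightarrow> ('v list \<Rightarrow> 'v) \<Rightarrow>
    ('v list \<Rightarrow> 'v) \<Rightarrow> bool" where
  "cinf_isotopy A \<phi> m m' \<longleftrightarrow>
     \<phi> [] = 0 \<and> (\<forall>x. \<phi> [x] = x) \<and>
     (\<forall>n\<ge>2. arity_part n \<phi> \<in> harr_cochains A n (1 - int n)) \<and>
     (\<forall>xs. (\<Sum>bs\<in>blocks xs. susp A (m2 A + m') (map (susp A \<phi>) bs)) =
           insertion A 1 (susp A \<phi>) (susp A (m2 A + m)) xs)"

definition isotopic_mod ::
  "('k::field_char_0, 'v::ab_group_add) graded_algebra \<Rightarrow> nat \<Rightarrow> ('v list \<Rightarrow> 'v) \<Rightarrow>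
    ('v list \<Rightarrow> 'v) \<Rightarrow> bool" where
  "isotopic_mod A k m m' \<longleftrightarrow>
     (\<exists>\<phi> m''. minimal_cinf A m'' \<and> cinf_isotopy A \<phi> m m'' \<and>
        (\<forall>xs. length xs \<le> k \<longrightarrow> m'' xs = m' xs))"

section \<open>Obstruction sets\<close>

definition gauge_set ::
  "('k::field_char_0, 'v::ab_group_add) graded_algebra \<Rightarrow> nat \<Rightarrow> ('v list \<Rightarrow> 'v) \<Rightarrow>
    ('v list \<Rightarrow> 'v) \<Rightarrow> ('v list \<Rightarrow> 'v) set" where
  "gauge_set A q m m' = {p \<in> gla_filt A 1 0. gauge A p m - m' \<in> gla_filt A q 1}"

definition obs_cochain ::
  "('k::field_char_0, 'v::ab_group_add) graded_algebra \<Rightarrow> nat \<Rightarrow> ('v list \<Rightarrow> 'v) \<Rightarrow>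
    ('v list \<Rightarrow> 'v) \<Rightarrow> ('v list \<Rightarrow> 'v) \<Rightarrow> 'v list \<Rightarrow> 'v" where
  "obs_cochain A k p m m' = arity_part k (gauge A p m - m')"

definition obs_set ::
  "('k::field_char_0, 'v::ab_group_add) graded_algebra \<Rightarrow> nat \<Rightarrow> ('v list \<Rightarrow> 'v) \<Rightarrow>
    ('v list \<Rightarrow> 'v) \<Rightarrow> ('v list \<Rightarrow> 'v) set set" where
  "obs_set A k m m' =
     (\<lambda>p. harr_class A k (2 - int k) (obs_cochain A k p m m')) ` gauge_set A (k - 1) m m'"

end

theory Submission
  imports Defs
begin

text \<open>The argument rests on a groupoid. For Maurer--Cartan elements \<open>x\<close>, \<open>y\<close> let \<open>obs_cochains x y\<close>
  be the set of arity \<open>k\<close> components of \<open>e\<^sup>p * x - y\<close>, for the gauge parameters \<open>p\<close> that make this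
  difference start in arity \<open>k\<close>. Three facts are decisive. The gauge action is the action of a group.
  It is local: since \<open>ad\<^sub>p\<close> raises the arity, \<open>e\<^sup>p * x - e\<^sup>p * y\<close> has the same leading term as
  \<open>x - y\<close>. And the leading term of a difference of two Maurer--Cartan elements is a cocycle, by
  comparing the lowest arity in which their equations differ. Locality makes leading terms additive
  under composition, \<open>obs_cochains x y + obs_cochains y z \<subseteq> obs_cochains x z\<close>, and odd under
  inversion. So \<open>obs_cochains m m\<close> is a group of cocycles, it equals \<open>obs_cochains m' m'\<close> because
  cochains form an abelian group, and \<open>obs_cochains m m'\<close> is a coset of it; passing to cohomology
  gives the corresponding statements for obstruction sets. A gauge parameter \<open>h\<close> concentrated in arity
  \<open>k - 1\<close> changes the leading term exactly by \<open>- \<delta> h\<close>, so that the vanishing of an obstruction class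
  allows one to improve the agreement by one arity.

  The group law of gauge parameters and the comparison with isotopies are obtained on the tensor
  coalgebra of \<open>sH\<close>. A family \<open>G\<close> of multilinear maps induces a coderivation \<open>D\<^sub>G\<close>, and
  all identities are tested against functionals \<open>F\<close>, that is, one studies the operators
  \<open>F \<mapsto> F \<circ> D\<^sub>G\<close>. Four properties of them carry the proof.

  \<^item> The graded commutator of two coderivations is the coderivation of the bracket
    (\<open>commutator_is_insertion\<close>); this replaces the Jacobi identity.

  \<^item> If \<open>G\<close> vanishes on shuffles, then \<open>D\<^sub>G\<close> is a derivation of the shuffle product
    (\<open>label_shuffle_label_ins\<close>); hence Harrison cochains are closed under composition with
    coderivations.

  \<^item> The exponential of \<open>D\<^sub>P\<close> is a coalgebra automorphism, so it is determined by its
    projection to \<open>sH\<close> and can be written as a sum over blocks (\<open>expd_is_hom\<close>). Conversely each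
    Harrison family with linear part the identity is such a projection, as is seen by solving
    for \<open>P\<close> arity by arity (\<open>exists_log\<close>). Together these facts replace the
    Baker--Campbell--Hausdorff formula (\<open>expd_comp\<close>) and identify isotopies with exponentials.

  \<^item> The gauge action is conjugation: if \<open>M\<close> and \<open>N\<close> are the suspensions of \<open>m\<^sub>2 + m\<close> and
    \<open>m\<^sub>2 + e\<^sup>p * m\<close>, then \<open>D\<^sub>N\<close> is the conjugate of \<open>D\<^sub>M\<close> by the exponential of \<open>D\<^sub>P\<close>
    (\<open>expd_coder_conj_act\<close>, \<open>susp_gauge\<close>).

  In the formal text \<open>coder e G F\<close> is \<open>F \<circ> D\<^sub>G\<close> for \<open>G\<close> of degree \<open>e\<close>,
  \<open>der P F\<close> is the case of degree 0, and \<open>expd P F\<close> is \<open>F \<circ> exp D\<^sub>P\<close>.\<close>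

section \<open>Deconcatenation and coderivations\<close>

text \<open>The deconcatenation coproduct, tested against a functional \<open>K\<close> of two words. Recursion on the
  word makes coassociativity and the Leibniz rules below provable by list induction.\<close>

fun cuts :: "('a list \<Rightarrow> 'a list \<Rightarrow> 'b::ab_group_add) \<Rightarrow> 'a list \<Rightarrow> 'b" where
  "cuts K [] = K [] []"
| "cuts K (x # w) = K [] (x # w) + cuts (\<lambda>u v. K (x # u) v) w"

text \<open>Composition of a functional with the coderivation induced by \<open>G\<close>, organised by the first letter:
  either this letter belongs to the block that is replaced, or it is passed, with the sign
  operator \<open>s\<close>. Only nonempty blocks are replaced, so the recursion follows the letters
  of the word.\<close>

fun ins :: "('v \<Rightarrow> 'v) \<Rightarrow> ('v list \<Rightarrow> 'b::ab_group_add) \<Rightarrow> ('v list \<Rightarrow> 'v) \<Rightarrow> 'v list \<Rightarrow> 'b" where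
  "ins s F G [] = 0"
| "ins s F G (x # w) = cuts (\<lambda>u v. F (G (x # u) # v)) w + ins s (\<lambda>w. F (s x # w)) G w"

text \<open>Linearity in each slot splits into additivity, which needs no scalars, and compatibility with
  scalar multiplication; the sign calculus uses additivity alone.\<close>

definition madditive :: "('v::ab_group_add list \<Rightarrow> 'b::ab_group_add) \<Rightarrow> bool" where
  "madditive F \<longleftrightarrow> (\<forall>us vs. additive (\<lambda>x. F (us @ x # vs)))"

lemma cuts_eq_sum: "cuts K w = (\<Sum>l\<le>length w. K (take l w) (drop l w))"
proof (induction w arbitrary: K)
  case (Cons x w)
  show ?case by (simp add: Cons.IH sum.atMost_Suc_shift del: sum.atMost_Suc)
qed simp

lemma cuts_cong:
  assumes "\<And>u v. u @ v = w \<Longrightarrow> K u v = K' u v"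
  shows "cuts K w = cuts K' w"
  unfolding cuts_eq_sum by (rule sum.cong) (auto intro: assms)

lemma additive_cuts:
  assumes "additive h"
  shows "h (cuts K w) = cuts (\<lambda>u v. h (K u v)) w"
  unfolding cuts_eq_sum by (rule additive.sum[OF assms])

lemma cuts_add: "cuts (\<lambda>u v. K u v + K' u v) w = cuts K w + cuts K' w"
  by (simp add: cuts_eq_sum sum.distrib)

lemma cuts_diff: "cuts (\<lambda>u v. K u v - K' u v) w = cuts K w - cuts K' w"
  by (simp add: cuts_eq_sum sum_subtractf)

lemma cuts_zero [simp]: "cuts (\<lambda>u v. 0) w = 0"
  by (simp add: cuts_eq_sum)

lemma cuts_sum: "cuts (\<lambda>u v. \<Sum>i\<in>I. K i u v) w = (\<Sum>i\<in>I. cuts (K i) w)"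
  by (simp add: cuts_eq_sum sum.swap[of _ _ I])

lemma cuts_coassoc:
  "cuts (\<lambda>u v. cuts (\<lambda>u1 u2. K u1 u2 v) u) w = cuts (\<lambda>u1 r. cuts (\<lambda>u2 v. K u1 u2 v) r) w"
proof (induction w arbitrary: K)
  case (Cons x w)
  show ?case by (simp add: Cons.IH cuts_add algebra_simps)
qed simp

lemma additive_ins:
  assumes "additive h"
  shows "h (ins s F G w) = ins s (\<lambda>w. h (F w)) G w"
proof (induction w arbitrary: F)
  case Nil
  show ?case by (simp add: additive.zero[OF assms])
next
  case (Cons x w)
  show ?case by (simp add: additive.add[OF assms] Cons.IH additive_cuts[OF assms])
qed

lemma ins_add: "ins s (\<lambda>w. F w + F' w) G w = ins s F G w + ins s F' G w"
  by (induction w arbitrary: F F') (simp_all add: cuts_add algebra_simps)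

lemma ins_zero [simp]: "ins s (\<lambda>w. 0) G w = 0"
  by (induction w) simp_all

lemma ins_cuts_gen: "ins s (\<lambda>w. cuts (\<lambda>u v. F u v w) xs) G w = cuts (\<lambda>u v. ins s (F u v) G w) xs"
proof (induction xs arbitrary: F)
  case Nil
  then show ?case by simp
next
  case (Cons a xs)
  show ?case using Cons.IH[of "\<lambda>u. F (a # u)"] by (simp add: ins_add)
qed

lemma ins_cong:
  assumes "\<And>v. v \<noteq> [] \<Longrightarrow> length v \<le> length w \<Longrightarrow> F v = F' v"
    and "\<And>u. u \<noteq> [] \<Longrightarrow> length u \<le> length w \<Longrightarrow> G u = G' u"
  shows "ins s F G w = ins s F' G' w"
  using assms
proof (induction w arbitrary: F F')
  case (Cons x w)
  have "cuts (\<lambda>u v. F (G (x # u) # v)) w = cuts (\<lambda>u v. F' (G' (x # u) # v)) w"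
    by (rule cuts_cong) (auto simp: Cons.prems)
  moreover have "ins s (\<lambda>w. F (s x # w)) G w = ins s (\<lambda>w. F' (s x # w)) G' w"
    by (rule Cons.IH) (auto simp: Cons.prems)
  ultimately show ?case by simp
qed simp

text \<open>The co-Leibniz rule \<open>\<Delta> D = (D \<otimes> 1 + 1 \<otimes> D) \<Delta>\<close> of a coderivation: the replaced block lies on
  one side of the cut.\<close>

lemma ins_cuts:
  "ins s (cuts K) G w = cuts (\<lambda>u v. ins s (\<lambda>u. K u v) G u) w
     + cuts (\<lambda>u v. ins s (K (map s u)) G v) w"
proof (induction w arbitrary: K)
  case (Cons x w)
  have "ins s (cuts K) G (x # w) =
      cuts (\<lambda>u v. K [] (G (x # u) # v)) w
    + cuts (\<lambda>u v. cuts (\<lambda>u' v'. K (G (x # u) # u') v') v) w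
    + ins s (\<lambda>w. K [] (s x # w)) G w + ins s (cuts (\<lambda>u v. K (s x # u) v)) G w"
    by (simp add: cuts_add ins_add algebra_simps)
  then show ?case
    by (simp add: Cons.IH cuts_add algebra_simps cuts_coassoc[of "\<lambda>u1 u2 v. K (G (x # u1) # u2) v", symmetric])
qed simp

lemma madditiveD: "madditive F \<Longrightarrow> additive (\<lambda>x. F (us @ x # vs))"
  by (simp add: madditive_def)

lemma madditive_Cons: "madditive F \<Longrightarrow> madditive (\<lambda>w. F (x # w))"
  using madditiveD[of F "x # us" vs for us vs] by (simp add: madditive_def)

lemma madditive_zero: "madditive F \<Longrightarrow> F (us @ 0 # vs) = 0"
  using additive.zero[OF madditiveD] by fast

lemma madditive_hd: "madditive F \<Longrightarrow> additive (\<lambda>x. F (x # vs))"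
  using madditiveD[of F "[]"] by simp

lemma ksgn_0 [simp]: "ksgn 0 x = x" and ksgn_zero [simp]: "ksgn c 0 = 0"
  by (simp_all add: ksgn_def)

lemma additive_ksgn: "additive (ksgn c)"
  by (auto simp: additive_def ksgn_def)

lemma additive_commutes_ksgn: "additive h \<Longrightarrow> h (ksgn c x) = ksgn c (h x)"
  by (auto simp: ksgn_def additive.minus)

lemma ksgn_ksgn: "ksgn c (ksgn d x) = ksgn (c + d) x"
  by (auto simp: ksgn_def)

text \<open>The graded commutator of two coderivations is again a coderivation. In \<open>F \<circ> D\<^sub>H \<circ> D\<^sub>G\<close> the two
  blocks are either nested, which gives the insertion of \<open>G\<close> into \<open>H\<close>, or disjoint, and the
  disjoint terms cancel against those of \<open>F \<circ> D\<^sub>G \<circ> D\<^sub>H\<close>. The hypotheses on \<open>H\<close> and \<open>G\<close> express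
  that they are homogeneous, with \<open>(-1)\<^sup>c\<close> the sign of exchanging them.\<close>

lemma commutator_is_insertion:
  assumes F: "madditive F"
    and st: "\<And>x. s (t x) = t (s x)"
    and H: "\<And>xs. H (map s xs) = ksgn c (s (H xs))"
    and G: "\<And>xs. G (map t xs) = ksgn c (t (G xs))"
  shows "ins s (ins t F H) G w - ksgn c (ins t (ins s F G) H w) =
    ins (\<lambda>x. s (t x)) F (\<lambda>xs. ins s H G xs - ksgn c (ins t G H xs)) w"
  using F
proof (induction w arbitrary: F)
  case Nil
  show ?case by (simp add: ksgn_def)
next
  case (Cons x w)
  note F = Cons.prems
  have Fh: "additive (\<lambda>x. F (x # v))" for v by (rule madditive_hd[OF F])
  let ?hd = "\<lambda>G. cuts (\<lambda>u v. F (G (x # u) # v)) w"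
  \<comment> \<open>The four terms: nested blocks at the front, \<open>H\<close> at the front, \<open>G\<close> at the front, neither at the front.\<close>
  have main: "ins s (ins t F H) G (x # w) =
      cuts (\<lambda>u v. F (ins s H G (x # u) # v)) w
    + ksgn c (cuts (\<lambda>u v. ins s (\<lambda>v. F (s (H (x # u)) # v)) G v) w)
    + cuts (\<lambda>u v. ins t (\<lambda>v. F (t (G (x # u)) # v)) H v) w
    + ins s (ins t (\<lambda>w. F (t (s x) # w)) H) G w"
    if st: "\<And>x. s (t x) = t (s x)" and H: "\<And>xs. H (map s xs) = ksgn c (s (H xs))"
    for s t :: "'a \<Rightarrow> 'a" and H G
  proof -
    \<comment> \<open>Blocks of \<open>H\<close> at the front are a cut functional, so the co-Leibniz rule applies to them.\<close>
    define K where "K = (\<lambda>u v. case u of [] \<Rightarrow> 0 | _ \<Rightarrow> F (H u # v))" for u v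
    have K: "cuts K (y # v) = cuts (\<lambda>u v. F (H (y # u) # v)) v" for y v
      by (simp add: K_def)
    have tH: "ins t F H v = cuts K v + (case v of [] \<Rightarrow> 0 | y # v \<Rightarrow> ins t (\<lambda>w. F (t y # w)) H v)" for v
      by (cases v) (simp_all add: K_def)
    have e1: "ins s (ins t F H) G (x # w) = ins s (cuts K) G (x # w) +
       (cuts (\<lambda>u v. ins t (\<lambda>w. F (t (G (x # u)) # w)) H v) w + ins s (\<lambda>v. ins t (\<lambda>w. F (t (s x) # w)) H v) G w)"
      by (simp add: tH[abs_def] ins_add cuts_add)
    have e2: "ins s (cuts K) G (x # w) =
      cuts (\<lambda>u v. ins s (\<lambda>u. K u v) G (x # u)) w + cuts (\<lambda>u v. ins s (K (map s (x # u))) G v) w"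
      unfolding ins_cuts by (simp add: K_def)
    have e3: "ins s (\<lambda>u. K u v) G (x # u) = F (ins s H G (x # u) # v)" for u v
    proof -
      have "ins s (\<lambda>u. K u v) G (x # u) = ins s (\<lambda>u. F (H u # v)) G (x # u)"
        by (rule ins_cong) (auto simp: K_def split: list.splits)
      also have "\<dots> = F (ins s H G (x # u) # v)"
        using additive_ins[OF Fh] by metis
      finally show ?thesis .
    qed
    have e4: "ins s (K (map s (x # u))) G v = ksgn c (ins s (\<lambda>v. F (s (H (x # u)) # v)) G v)" for u v
    proof -
      have "K (map s (x # u)) v = ksgn c (F (s (H (x # u)) # v))" for v
      proof -
        have "K (map s (x # u)) v = F (H (map s (x # u)) # v)" by (simp add: K_def)
        also have "\<dots> = ksgn c (F (s (H (x # u)) # v))"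
          unfolding H by (rule additive_commutes_ksgn[OF Fh])
        finally show ?thesis .
      qed
      then have "K (map s (x # u)) = (\<lambda>v. ksgn c (F (s (H (x # u)) # v)))" ..
      then show ?thesis by (simp only: additive_ins[OF additive_ksgn])
    qed
    show ?thesis
      by (simp only: e1 e2 e3 e4 additive_cuts[OF additive_ksgn] add.assoc)
  qed
  have IH: "ins s (ins t (\<lambda>w. F (t (s x) # w)) H) G w = 
      ksgn c (ins t (ins s (\<lambda>w. F (t (s x) # w)) G) H w) +
    ins (\<lambda>x. s (t x)) (\<lambda>w. F (t (s x) # w)) (\<lambda>xs. ins s H G xs - ksgn c (ins t G H xs)) w"
    using Cons.IH[OF madditive_Cons[OF F]] by (simp add: algebra_simps)
  have alg: "a + ksgn c b + d + (ksgn c y + z) - ksgn c (a' + ksgn c d + b + y) = a - ksgn c a' + z"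
    for a b d y z a' :: 'b by (simp add: ksgn_def)
  have "F ((a - ksgn c b) # v) = F (a # v) - ksgn c (F (b # v))" for a b v
    by (simp add: additive.diff[OF Fh] additive_commutes_ksgn[OF Fh])
  then have rhs: "ins (\<lambda>x. s (t x)) F (\<lambda>xs. ins s H G xs - ksgn c (ins t G H xs)) (x # w) =
      cuts (\<lambda>u v. F (ins s H G (x # u) # v)) w - ksgn c (cuts (\<lambda>u v. F (ins t G H (x # u) # v)) w)
      + ins (\<lambda>x. s (t x)) (\<lambda>w. F (t (s x) # w)) (\<lambda>xs. ins s H G xs - ksgn c (ins t G H xs)) w"
    by (simp only: ins.simps(2) cuts_diff additive_cuts[OF additive_ksgn] st)
  show ?case
    unfolding main[of s t H G, OF st H] main[of t s G H, OF st[symmetric] G, unfolded st] rhs IH[unfolded st]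
    by (simp only: st alg)
qed

section \<open>Coderivations and signed shuffles\<close>

lemma insertion_eq_ins:
  assumes "madditive F" and G: "G [] = 0"
  shows "insertion A e F G xs = ins (pass_sign A e) F G xs"
proof -
  let ?s = "pass_sign A e"
  have sum: "insertion A e F G xs = (\<Sum>i\<le>length xs. \<Sum>l\<le>length xs - i.
      F (map ?s (take i xs) @ G (take l (drop i xs)) # drop (i + l) xs))"
    for F :: "'a list \<Rightarrow> 'a" and xs
  proof -
    have "{(i, l). i + l \<le> length xs} = Sigma {..length xs} (\<lambda>i. {..length xs - i})" by auto
    then show ?thesis by (simp add: insertion_def sum.Sigma)
  qed
  show ?thesis using assms(1)
  proof (induction xs arbitrary: F)
    case Nil
    then show ?case using madditive_zero[of F "[]" "[]"] by (simp add: sum G)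
  next
    case (Cons x w)
    have 0: "F (0 # v) = 0" for v using madditive_zero[OF Cons.prems, of "[]"] by simp
    have "insertion A e F G (x # w) =
        (\<Sum>l\<le>Suc (length w). F (G (take l (x # w)) # drop l (x # w))) + insertion A e (\<lambda>w. F (?s x # w)) G w"
      unfolding sum by (simp add: sum.atMost_Suc_shift del: sum.atMost_Suc)
    also have "(\<Sum>l\<le>Suc (length w). F (G (take l (x # w)) # drop l (x # w))) =
        cuts (\<lambda>u v. F (G (x # u) # v)) w"
      by (subst sum.atMost_Suc_shift) (simp add: G 0 cuts_eq_sum)
    also have "insertion A e (\<lambda>w. F (?s x # w)) G w = ins ?s (\<lambda>w. F (?s x # w)) G w"
      by (rule Cons.IH[OF madditive_Cons[OF Cons.prems]])
    finally show ?case by simp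
  qed
qed

definition total_deg :: "(int \<times> 'v) list \<Rightarrow> int" where
  "total_deg al = sum_list (map fst al)"

lemma total_deg_simps [simp]: "total_deg [] = 0" "total_deg (p # al) = fst p + total_deg al" "total_deg (al @ bl) = total_deg al + total_deg bl"
  by (simp_all add: total_deg_def)

text \<open>Shuffle products of words whose letters carry their degrees. The labels allow letters produced by
  an operation to be shuffled further, with the right Koszul signs.\<close>

fun label_shuffle :: "((int \<times> 'v) list \<Rightarrow> 'b::ab_group_add) \<Rightarrow> (int \<times> 'v) list \<Rightarrow> (int \<times> 'v) list \<Rightarrow> 'b" where
  "label_shuffle T [] bl = T bl"
| "label_shuffle T al [] = T al"
| "label_shuffle T (p # al) (q # bl) = label_shuffle (\<lambda>w. T (p # w)) al (q # bl) +
     ksgn (fst q * total_deg (p # al)) (label_shuffle (\<lambda>w. T (q # w)) (p # al) bl)"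

text \<open>The action of the coderivation of \<open>G\<close> on labelled words; the block replaced by its value
  receives the label \<open>e\<close> plus the degree of the block.\<close>

fun label_ins :: "int \<Rightarrow> ((int \<times> 'v) list \<Rightarrow> 'b::ab_group_add) \<Rightarrow> ('v list \<Rightarrow> 'v) \<Rightarrow> (int \<times> 'v) list \<Rightarrow> 'b" where
  "label_ins e T G [] = 0"
| "label_ins e T G (p # al) = cuts (\<lambda>u v. T ((e + total_deg (p # u), G (map snd (p # u))) # v)) al +
     ksgn (e * fst p) (label_ins e (\<lambda>w. T (p # w)) G al)"

lemma label_shuffle_Nil2 [simp]: "label_shuffle T al [] = T al"
  by (cases al) simp_all

lemma shuffle_sum_eq_label_shuffle: "shuffle_sum F al bl = label_shuffle (\<lambda>w. F (map snd w)) al bl"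
  by (induction F al bl rule: shuffle_sum.induct) (simp_all add: total_deg_def)

lemma additive_label_shuffle:
  assumes "additive h"
  shows "h (label_shuffle T al bl) = label_shuffle (\<lambda>w. h (T w)) al bl"
  by (induction T al bl rule: label_shuffle.induct)
     (simp_all add: additive.add[OF assms] additive_commutes_ksgn[OF assms])

lemma label_shuffle_add: "label_shuffle (\<lambda>w. T w + T' w) al bl = label_shuffle T al bl + label_shuffle T' al bl"
proof (induction T al bl arbitrary: T' rule: label_shuffle.induct)
  case (3 T p al q bl)
  show ?case by (simp add: 3 additive.add[OF additive_ksgn])
qed simp_all

lemma label_shuffle_cong:
  assumes "\<And>w. w \<in> shuffles al bl \<Longrightarrow> T w = T' w"
  shows "label_shuffle T al bl = label_shuffle T' al bl"
  using assms
proof (induction T al bl arbitrary: T' rule: label_shuffle.induct)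
  case (3 T p al q bl)
  have "label_shuffle (\<lambda>w. T (p # w)) al (q # bl) = label_shuffle (\<lambda>w. T' (p # w)) al (q # bl)"
    by (rule 3) (simp add: 3)
  moreover have "label_shuffle (\<lambda>w. T (q # w)) (p # al) bl = label_shuffle (\<lambda>w. T' (q # w)) (p # al) bl"
    by (rule 3) (simp add: 3)
  ultimately show ?case by simp
qed simp_all

lemma total_deg_shuffles: "w \<in> shuffles al bl \<Longrightarrow> total_deg w = total_deg al + total_deg bl"
  by (induction al bl arbitrary: w rule: shuffles.induct) auto

lemma label_ins_add: "label_ins e (\<lambda>w. T w + T' w) G al = label_ins e T G al + label_ins e T' G al"
  by (induction al arbitrary: T T') (simp_all add: cuts_add additive.add[OF additive_ksgn])

lemma additive_label_ins:
  assumes "additive h"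
  shows "h (label_ins e T G al) = label_ins e (\<lambda>w. h (T w)) G al"
  by (induction al arbitrary: T)
    (simp_all add: additive.add[OF assms] additive_commutes_ksgn[OF assms] additive.zero[OF assms]
       additive_cuts[OF assms])

lemma label_ins_cong:
  assumes "\<And>w. w \<noteq> [] \<Longrightarrow> total_deg w = e + total_deg al \<Longrightarrow> T w = T' w"
  shows "label_ins e T G al = label_ins e T' G al"
  using assms
proof (induction al arbitrary: T T')
  case (Cons p al)
  have "label_ins e (\<lambda>w. T (p # w)) G al = label_ins e (\<lambda>w. T' (p # w)) G al"
    by (rule Cons.IH) (simp add: Cons.prems)
  moreover have "cuts (\<lambda>u v. T ((e + total_deg (p # u), G (map snd (p # u))) # v)) al =
     cuts (\<lambda>u v. T' ((e + total_deg (p # u), G (map snd (p # u))) # v)) al"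
    by (rule cuts_cong) (auto intro!: Cons.prems)
  ultimately show ?case by simp
qed simp

text \<open>The tensor coalgebra with the shuffle product is a bialgebra: to cut a shuffle of two words, cut
  both words and shuffle the left parts and the right parts. The sign comes from moving the left part
  of the second word past the right part of the first.\<close>

lemma label_shuffle_cuts:
  "label_shuffle (cuts K) al bl = cuts (\<lambda>a1 a2. cuts (\<lambda>b1 b2.
     ksgn (total_deg b1 * total_deg a2) (label_shuffle (\<lambda>u. label_shuffle (K u) a2 b2) a1 b1)) bl) al"
proof (induction al bl arbitrary: K rule: shuffles.induct)
  case (1 bl)
  show ?case by simp
next
  case (2 al)
  show ?case by simp
next
  case (3 p al q bl)
  let ?f = "\<lambda>K a1 a2 b1 b2. ksgn (total_deg b1 * total_deg a2) (label_shuffle (\<lambda>u. label_shuffle (K u) a2 b2) a1 b1)"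
  let ?Kp = "\<lambda>u. K (p # u)" and ?Kq = "\<lambda>u. K (q # u)"
  let ?c = "fst q * (fst p + total_deg al)"
  have split: "label_shuffle (cuts K) (p # al) (q # bl) = label_shuffle (K []) (p # al) (q # bl)
      + label_shuffle (cuts ?Kp) al (q # bl) + ksgn ?c (label_shuffle (cuts ?Kq) (p # al) bl)"
    by (simp add: label_shuffle_add additive.add[OF additive_ksgn] algebra_simps)
  \<comment> \<open>If both left parts are nonempty, their first letters compete for the front of the shuffle.\<close>
  have b_cons: "?f K (p # a1) a2 (q # b1) b2 = ?f ?Kp a1 a2 (q # b1) b2 + ksgn ?c (?f ?Kq (p # a1) a2 b1 b2)"
    if "a1 @ a2 = al" for a1 a2 b1 b2
    by (simp add: that[symmetric] additive.add[OF additive_ksgn] ksgn_ksgn algebra_simps)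
  have "cuts (\<lambda>a1 a2. cuts (?f K a1 a2) (q # bl)) (p # al) =
      label_shuffle (K []) (p # al) (q # bl) + cuts (\<lambda>b1 b2. ?f K [] (p # al) (q # b1) b2) bl
      + (cuts (\<lambda>a1 a2. ?f K (p # a1) a2 [] (q # bl)) al + cuts (\<lambda>a1 a2. cuts (\<lambda>b1 b2. ?f K (p # a1) a2 (q # b1) b2) bl) al)"
    by (simp add: cuts_add del: label_shuffle.simps(3))
  also have "cuts (\<lambda>a1 a2. cuts (\<lambda>b1 b2. ?f K (p # a1) a2 (q # b1) b2) bl) al =
      cuts (\<lambda>a1 a2. cuts (\<lambda>b1 b2. ?f ?Kp a1 a2 (q # b1) b2) bl) al
      + ksgn ?c (cuts (\<lambda>a1 a2. cuts (?f ?Kq (p # a1) a2) bl) al)"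
    unfolding additive_cuts[OF additive_ksgn] cuts_add[symmetric]
    by (intro cuts_cong b_cons)
  also have "cuts (\<lambda>b1 b2. ?f K [] (p # al) (q # b1) b2) bl = ksgn ?c (cuts (?f ?Kq [] (p # al)) bl)"
    unfolding additive_cuts[OF additive_ksgn] by (simp add: ksgn_ksgn algebra_simps)
  also have "cuts (\<lambda>a1 a2. ?f K (p # a1) a2 [] (q # bl)) al = cuts (\<lambda>a1 a2. ?f ?Kp a1 a2 [] (q # bl)) al"
    by simp
  also have "label_shuffle (K []) (p # al) (q # bl) + ksgn ?c (cuts (?f ?Kq [] (p # al)) bl) +
      (cuts (\<lambda>a1 a2. ?f ?Kp a1 a2 [] (q # bl)) al +
       (cuts (\<lambda>a1 a2. cuts (\<lambda>b1 b2. ?f ?Kp a1 a2 (q # b1) b2) bl) al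
        + ksgn ?c (cuts (\<lambda>a1 a2. cuts (?f ?Kq (p # a1) a2) bl) al))) =
      label_shuffle (K []) (p # al) (q # bl) + cuts (\<lambda>a1 a2. cuts (?f ?Kp a1 a2) (q # bl)) al
      + ksgn ?c (cuts (\<lambda>a1 a2. cuts (?f ?Kq a1 a2) bl) (p # al))"
    by (simp only: cuts.simps cuts_add additive.add[OF additive_ksgn] ac_simps)
  finally show ?case
    unfolding split 3 by (rule sym)
qed

definition ladditive :: "((int \<times> 'v::ab_group_add) list \<Rightarrow> 'b::ab_group_add) \<Rightarrow> bool" where
  "ladditive T \<longleftrightarrow> (\<forall>us d vs. additive (\<lambda>x. T (us @ (d, x) # vs)))"

lemma ladditive_der: "ladditive T \<Longrightarrow> additive (\<lambda>x. T (us @ (d, x) # vs))"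
  by (simp add: ladditive_def)

lemma ladditive_Cons: "ladditive T \<Longrightarrow> ladditive (\<lambda>w. T (p # w))"
  using ladditive_der[of T "p # us" d vs for us d vs] by (simp add: ladditive_def)

lemma ladditive_hd: "ladditive T \<Longrightarrow> additive (\<lambda>x. T ((d, x) # vs))"
  using ladditive_der[of T "[]"] by simp

lemma ladditive_map_snd: "madditive F \<Longrightarrow> ladditive (\<lambda>w. F (map snd w))"
  by (simp add: madditive_def ladditive_def)

definition homogeneous :: "('k, 'v::ab_group_add) graded_algebra \<Rightarrow> (int \<times> 'v) list \<Rightarrow> bool" where
  "homogeneous A al \<longleftrightarrow> (\<forall>(d, a) \<in> set al. a \<in> grade A (d + 1))"

lemma homogeneous_simps [simp]: "homogeneous A []" "homogeneous A (p # al) \<longleftrightarrow> snd p \<in> grade A (fst p + 1) \<and> homogeneous A al"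
  "homogeneous A (al @ bl) \<longleftrightarrow> homogeneous A al \<and> homogeneous A bl"
  by (auto simp: homogeneous_def)

text \<open>A coderivation whose corestriction vanishes on shuffles is a derivation of the shuffle product. By
  the bialgebra property, a leading block of a shuffle is a shuffle of leading blocks of the two words;
  \<open>G\<close> kills it unless one of these is empty, so the block lies in one of the two words.\<close>

lemma label_shuffle_label_ins:
  fixes T :: "(int \<times> 'v::ab_group_add) list \<Rightarrow> 'b::ab_group_add"
  assumes G: "vanishes_on_shuffles A G"
  shows "ladditive T \<Longrightarrow> homogeneous A al \<Longrightarrow> homogeneous A bl \<Longrightarrow>
    label_shuffle (label_ins e T G) al bl = label_ins e (\<lambda>w. label_shuffle T w bl) G al + ksgn (e * total_deg al) (label_ins e (label_shuffle T al) G bl)"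
proof (induction al bl arbitrary: T rule: shuffles.induct)
  case (1 bl)
  show ?case by simp
next
  case (2 al)
  show ?case by simp
next
  case (3 p al q bl)
  define g where "g w = (e + total_deg w, G (map snd w))" for w
  define K where "K = (\<lambda>u v. if u = [] then 0 else T (g u # v))"
  let ?Tp = "\<lambda>w. T (p # w)" and ?Tq = "\<lambda>w. T (q # w)"
  let ?da = "fst p + total_deg al"
  note ksgn_add = additive.add[OF additive_ksgn]
  have label_ins_Cons: "label_ins e T G (r # w) = cuts K (r # w) + ksgn (e * fst r) (label_ins e (\<lambda>w. T (r # w)) G w)" for r w
    by (simp add: K_def g_def)
  have ih1: "label_shuffle (label_ins e ?Tp G) al (q # bl) = label_ins e (\<lambda>w. label_shuffle ?Tp w (q # bl)) G al
      + ksgn (e * total_deg al) (label_ins e (label_shuffle ?Tp al) G (q # bl))"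
    using 3 by (simp add: ladditive_Cons)
  have ih2: "label_shuffle (label_ins e ?Tq G) (p # al) bl = label_ins e (\<lambda>w. label_shuffle ?Tq w bl) G (p # al)
      + ksgn (e * ?da) (label_ins e (label_shuffle ?Tq (p # al)) G bl)"
    using 3 by (simp add: ladditive_Cons)
  \<comment> \<open>The terms in which \<open>G\<close> acts on a leading block of the shuffle.\<close>
  have head: "label_shuffle (cuts K) (p # al) (q # bl) =
      cuts (\<lambda>u v. label_shuffle (\<lambda>w. T (g (p # u) # w)) v (q # bl)) al
      + cuts (\<lambda>u v. ksgn (total_deg (q # u) * ?da) (label_shuffle (\<lambda>w. T (g (q # u) # w)) (p # al) v)) bl"
  proof -
    \<comment> \<open>A leading block that meets both words is a proper shuffle, on which \<open>G\<close> vanishes.\<close>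
    have both: "label_shuffle (\<lambda>u. label_shuffle (K u) a2 b2) (p # a1) (q # b1) = 0"
      if "al = a1 @ a2" "bl = b1 @ b2" for a1 a2 b1 b2
    proof -
      let ?h = "\<lambda>y. label_shuffle (\<lambda>v. T ((e + (total_deg (p # a1) + total_deg (q # b1)), y) # v)) a2 b2"
      have "additive (\<lambda>y. T ((d, y) # v))" for d v
        using \<open>ladditive T\<close> by (rule ladditive_hd)
      then have h: "additive ?h"
        by (simp add: additive_def label_shuffle_add)
      have "label_shuffle (\<lambda>u. label_shuffle (K u) a2 b2) (p # a1) (q # b1) = label_shuffle (\<lambda>u. ?h (G (map snd u))) (p # a1) (q # b1)"
      proof (rule label_shuffle_cong)
        fix w assume w: "w \<in> shuffles (p # a1) (q # b1)"
        then have "w \<noteq> []" by auto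
        with total_deg_shuffles[OF w] show "label_shuffle (K w) a2 b2 = ?h (G (map snd w))"
          by (simp add: K_def g_def)
      qed
      also have "\<dots> = ?h (label_shuffle (\<lambda>u. G (map snd u)) (p # a1) (q # b1))"
        by (rule additive_label_shuffle[OF h, symmetric])
      also have "label_shuffle (\<lambda>u. G (map snd u)) (p # a1) (q # b1) = 0"
      proof -
        have "homogeneous A (p # a1)" "homogeneous A (q # b1)" using 3 that by auto
        then have "\<forall>(d, a) \<in> set (p # a1) \<union> set (q # b1). a \<in> grade A (d + 1)"
          unfolding homogeneous_def by blast
        then show ?thesis
          using G unfolding vanishes_on_shuffles_def shuffle_sum_eq_label_shuffle by blast
      qed
      finally show ?thesis by (simp only: additive.zero[OF h])
    qed
    have "label_shuffle (cuts K) (p # al) (q # bl) = 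
      cuts (\<lambda>b1 b2. ksgn (total_deg (q # b1) * ?da) (label_shuffle (K (q # b1)) (p # al) b2)) bl
      + cuts (\<lambda>a1 a2. label_shuffle (K (p # a1)) a2 (q # bl)) al
      + cuts (\<lambda>a1 a2. cuts (\<lambda>b1 b2. ksgn (total_deg (q # b1) * total_deg a2) (label_shuffle (\<lambda>u. label_shuffle (K u) a2 b2) (p # a1) (q # b1))) bl) al"
    proof -
      have K0: "K [] = (\<lambda>v. 0)" by (simp add: K_def)
      have shl0: "label_shuffle (\<lambda>v. 0) w w' = 0" for w w'
        using additive_label_shuffle[of "\<lambda>_. 0" "\<lambda>_. 0" w w'] by (simp add: additive_def)
      show ?thesis
        unfolding label_shuffle_cuts by (simp add: cuts_add K0 shl0 del: label_shuffle.simps(3))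
    qed
    also have "cuts (\<lambda>a1 a2. cuts (\<lambda>b1 b2. ksgn (total_deg (q # b1) * total_deg a2) (label_shuffle (\<lambda>u. label_shuffle (K u) a2 b2) (p # a1) (q # b1))) bl) al
      = cuts (\<lambda>a1 a2. cuts (\<lambda>b1 b2. 0) bl) al"
      by (intro cuts_cong) (simp only: both ksgn_def, simp)
    finally show ?thesis by (simp add: K_def add.commute)
  qed
  \<comment> \<open>Acting first and shuffling afterwards changes the degree of the first word by \<open>e\<close>, hence the sign.\<close>
  have a1: "label_ins e (\<lambda>w. label_shuffle T w (q # bl)) G (p # al) =
      cuts (\<lambda>u v. label_shuffle (\<lambda>w. T (g (p # u) # w)) v (q # bl)) al
      + ksgn (e * fst p) (label_ins e (\<lambda>w. label_shuffle ?Tp w (q # bl)) G al)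
      + ksgn (fst q * (?da + e)) (label_ins e (\<lambda>w. label_shuffle ?Tq w bl) G (p # al))"
  proof -
    have "cuts (\<lambda>u v. label_shuffle T (g (p # u) # v) (q # bl)) al = 
       cuts (\<lambda>u v. label_shuffle (\<lambda>w. T (g (p # u) # w)) v (q # bl) + ksgn (fst q * (?da + e)) (label_shuffle ?Tq (g (p # u) # v) bl)) al"
      by (rule cuts_cong) (auto simp: g_def algebra_simps)
    moreover have "label_ins e (\<lambda>w. label_shuffle T (p # w) (q # bl)) G al =
      label_ins e (\<lambda>w. label_shuffle ?Tp w (q # bl) + ksgn (fst q * (?da + e)) (label_shuffle ?Tq (p # w) bl)) G al"
      by (rule label_ins_cong) (simp add: algebra_simps)
    ultimately show ?thesis
      by (simp add: g_def[symmetric] label_ins_add cuts_add ksgn_add additive_cuts[OF additive_ksgn, symmetric]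
        additive_label_ins[OF additive_ksgn, symmetric] ksgn_ksgn algebra_simps del: label_shuffle.simps(3))
        (simp add: g_def algebra_simps)
  qed
  have a2: "label_ins e (label_shuffle T (p # al)) G (q # bl) =
      label_ins e (label_shuffle ?Tp al) G (q # bl)
      + cuts (\<lambda>u v. ksgn ((e + total_deg (q # u)) * ?da) (label_shuffle (\<lambda>w. T (g (q # u) # w)) (p # al) v)) bl
      + ksgn (e * fst q + fst q * ?da) (label_ins e (label_shuffle ?Tq (p # al)) G bl)"
    by (simp add: g_def label_ins_add cuts_add ksgn_add additive_label_ins[OF additive_ksgn, symmetric] ksgn_ksgn algebra_simps)
  have split: "label_shuffle (label_ins e T G) (p # al) (q # bl) = label_shuffle (cuts K) (p # al) (q # bl)
      + ksgn (e * fst p) (label_shuffle (label_ins e ?Tp G) al (q # bl))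
      + ksgn (fst q * ?da + e * fst q) (label_shuffle (label_ins e ?Tq G) (p # al) bl)"
  proof -
    have "label_shuffle (label_ins e T G) (p # al) (q # bl) =
       label_shuffle (\<lambda>w. cuts K (p # w) + ksgn (e * fst p) (label_ins e ?Tp G w)) al (q # bl)
       + ksgn (fst q * ?da) (label_shuffle (\<lambda>w. cuts K (q # w) + ksgn (e * fst q) (label_ins e ?Tq G w)) (p # al) bl)"
      by (simp only: label_shuffle.simps(3) label_ins_Cons total_deg_simps)
    also have "\<dots> = label_shuffle (\<lambda>w. cuts K (p # w)) al (q # bl) + ksgn (e * fst p) (label_shuffle (label_ins e ?Tp G) al (q # bl))
       + (ksgn (fst q * ?da) (label_shuffle (\<lambda>w. cuts K (q # w)) (p # al) bl)
         + ksgn (fst q * ?da + e * fst q) (label_shuffle (label_ins e ?Tq G) (p # al) bl))"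
      by (simp only: label_shuffle_add additive_label_shuffle[OF additive_ksgn, symmetric] ksgn_add ksgn_ksgn)
    finally show ?thesis by (simp only: label_shuffle.simps(3) total_deg_simps ac_simps)
  qed
  have alg: "h1 + h2 + ksgn (e * fst p) (X1 + ksgn (e * total_deg al) X2)
      + ksgn (fst q * ?da + e * fst q) (Y1 + ksgn (e * ?da) Y2) =
    h1 + ksgn (e * fst p) X1 + ksgn (fst q * (?da + e)) Y1 +
    ksgn (e * ?da) (X2 + h3 + ksgn (e * fst q + fst q * ?da) Y2)"
    if "h2 = ksgn (e * ?da) h3" for h1 h2 h3 X1 X2 Y1 Y2 :: 'b
    unfolding that by (simp add: ksgn_add ksgn_ksgn algebra_simps)
  show ?case
    unfolding split head ih1 ih2 a1 total_deg_simps a2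
    by (rule alg) (simp only: additive_cuts[OF additive_ksgn] ksgn_ksgn,
        intro cuts_cong, simp add: ksgn_def, blast)
qed

section \<open>Signs on a graded vector space\<close>

context fd_graded_comm_algebra
begin

sublocale vs: vector_space "scal A" by (rule vector_space)

abbreviation sc :: "'k \<Rightarrow> 'v \<Rightarrow> 'v" where "sc \<equiv> scal A"

lemma grade_0: "0 \<in> grade A i"
  using grade_subspace by (rule vs.subspace_0)
lemma grade_add: "x \<in> grade A i \<Longrightarrow> y \<in> grade A i \<Longrightarrow> x + y \<in> grade A i"
  using grade_subspace by (rule vs.subspace_add)
lemma grade_sc: "x \<in> grade A i \<Longrightarrow> sc c x \<in> grade A i"
  using grade_subspace by (rule vs.subspace_scale)
lemma grade_neg: "x \<in> grade A i \<Longrightarrow> - x \<in> grade A i"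
  using grade_subspace by (rule vs.subspace_neg)
lemma grade_ksgn: "x \<in> grade A i \<Longrightarrow> ksgn c x \<in> grade A i"
  by (simp add: ksgn_def grade_neg)

text \<open>The shifted parity operator is defined by the homogeneous components; linearity follows from
  their uniqueness.\<close>

definition comps :: "'v \<Rightarrow> int \<Rightarrow> 'v" where
  "comps x = (THE c. is_decomp A x c)"

lemma is_decomp_comps: "is_decomp A x (comps x)"
  unfolding comps_def by (rule theI'[OF grade_direct_sum])

lemma comps_eqI: "is_decomp A x c \<Longrightarrow> comps x = c"
  using grade_direct_sum is_decomp_comps by blast

lemma is_decompI:
  assumes "finite I" "\<And>i. c i \<in> grade A i" "\<And>i. i \<notin> I \<Longrightarrow> c i = 0" "x = (\<Sum>i\<in>I. c i)"
  shows "is_decomp A x c"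
proof -
  have sub: "{i. c i \<noteq> 0} \<subseteq> I" using assms(3) by auto
  have "(\<Sum>i\<in>I. c i) = (\<Sum>i | c i \<noteq> 0. c i)"
    by (rule sum.mono_neutral_right[OF assms(1) sub]) auto
  then show ?thesis
    unfolding is_decomp_def using assms finite_subset[OF sub] by auto
qed

lemma comps_grade: "comps x i \<in> grade A i"
  and finite_comps: "finite {i. comps x i \<noteq> 0}"
  and sum_comps: "(\<Sum>i | comps x i \<noteq> 0. comps x i) = x"
  using is_decomp_comps[of x] by (auto simp: is_decomp_def)

lemma sum_comps_superset:
  assumes "finite I" "{i. comps x i \<noteq> 0} \<subseteq> I" "\<And>i. f i 0 = (0::'v)"
  shows "(\<Sum>i | comps x i \<noteq> 0. f i (comps x i)) = (\<Sum>i\<in>I. f i (comps x i))"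
  by (rule sum.mono_neutral_left) (use assms in auto)

lemma comps_add: "comps (x + y) = (\<lambda>i. comps x i + comps y i)"
proof (rule comps_eqI, rule is_decompI[of "{i. comps x i \<noteq> 0} \<union> {i. comps y i \<noteq> 0}"])
  let ?I = "{i. comps x i \<noteq> 0} \<union> {i. comps y i \<noteq> 0}"
  show "x + y = (\<Sum>i\<in>?I. comps x i + comps y i)"
    unfolding sum.distrib
    using sum_comps_superset[of ?I x "\<lambda>i z. z"] sum_comps_superset[of ?I y "\<lambda>i z. z"]
    by (simp add: finite_comps sum_comps)
qed (auto simp: finite_comps comps_grade grade_add)

lemma comps_sc: "comps (sc c x) = (\<lambda>i. sc c (comps x i))"
  by (rule comps_eqI, rule is_decompI[of "{i. comps x i \<noteq> 0}"])
     (auto simp: finite_comps comps_grade grade_sc sum_comps vs.scale_sum_right[symmetric])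

lemma comps_homogeneous: "x \<in> grade A i \<Longrightarrow> comps x = (\<lambda>j. if j = i then x else 0)"
  by (rule comps_eqI, rule is_decompI[of "{i}"]) (auto simp: grade_0)

lemma shift_sign_eq: 
  assumes "finite I" "{i. comps x i \<noteq> 0} \<subseteq> I"
  shows "shift_sign A x = (\<Sum>i\<in>I. ksgn (i - 1) (comps x i))"
  unfolding shift_sign_def comps_def[symmetric] Let_def
  by (rule sum_comps_superset) (use assms in auto)

lemma additive_shift_sign: "additive (shift_sign A)"
proof
  fix x y
  let ?I = "{i. comps x i \<noteq> 0} \<union> {i. comps y i \<noteq> 0}"
  have I: "finite ?I" "{i. comps x i \<noteq> 0} \<subseteq> ?I" "{i. comps y i \<noteq> 0} \<subseteq> ?I"
    "{i. comps (x + y) i \<noteq> 0} \<subseteq> ?I" by (auto simp: finite_comps comps_add)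
  show "shift_sign A (x + y) = shift_sign A x + shift_sign A y"
    unfolding shift_sign_eq[OF I(1,2)] shift_sign_eq[OF I(1,3)] shift_sign_eq[OF I(1,4)]
    by (simp add: comps_add additive.add[OF additive_ksgn] sum.distrib)
qed

lemma ksgn_sc: "ksgn d (sc c x) = sc c (ksgn d x)"
  by (simp add: ksgn_def)

lemma shift_sign_sc: "shift_sign A (sc c x) = sc c (shift_sign A x)"
proof -
  have I: "{i. comps (sc c x) i \<noteq> 0} \<subseteq> {i. comps x i \<noteq> 0}" by (auto simp: comps_sc)
  show ?thesis
    unfolding shift_sign_eq[OF finite_comps I] shift_sign_eq[OF finite_comps[of x] order_refl]
    by (simp only: comps_sc ksgn_sc vs.scale_sum_right)
qed

lemma shift_sign_homogeneous: "x \<in> grade A i \<Longrightarrow> shift_sign A x = ksgn (i - 1) x"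
  by (subst shift_sign_eq[of "{i}"]) (auto simp: comps_homogeneous)

lemma shift_sign_shift_sign [simp]: "shift_sign A (shift_sign A x) = x"
proof -
  have "shift_sign A (shift_sign A x) = (\<Sum>i | comps x i \<noteq> 0. shift_sign A (ksgn (i - 1) (comps x i)))"
    by (subst (2) shift_sign_eq[OF finite_comps order_refl]) (rule additive.sum[OF additive_shift_sign])
  also have "\<dots> = (\<Sum>i | comps x i \<noteq> 0. comps x i)"
    by (rule sum.cong[OF refl], subst shift_sign_homogeneous[OF grade_ksgn[OF comps_grade]])
       (simp add: ksgn_def)
  finally show ?thesis by (simp add: sum_comps)
qed

definition lin :: "('v \<Rightarrow> 'v) \<Rightarrow> bool" where
  "lin h \<longleftrightarrow> additive h \<and> (\<forall>c x. h (sc c x) = sc c (h x))"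

lemma linear_iff_lin: "Vector_Spaces.linear sc sc h \<longleftrightarrow> lin h"
  unfolding Vector_Spaces.linear_iff lin_def additive_def using vector_space by blast

lemma lin_additive: "lin h \<Longrightarrow> additive h"
  by (simp add: lin_def)

lemma pass_sign_lin: "lin (pass_sign A e)"
  using additive_shift_sign shift_sign_sc
  by (cases "even e") (auto simp: lin_def pass_sign_def additive_def)

lemma pass_sign_pass_sign: "pass_sign A d (pass_sign A e x) = pass_sign A (d + e) x"
  by (simp add: pass_sign_def)

lemma pass_sign_homogeneous: "x \<in> grade A (d + 1) \<Longrightarrow> pass_sign A e x = ksgn (e * d) x"
  by (simp add: pass_sign_def shift_sign_homogeneous ksgn_def)

lemma pass_sign_0 [simp]: "pass_sign A 0 x = x"
  by (simp add: pass_sign_def)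

end

section \<open>Suspended Harrison cochains\<close>

lemma label_shuffle_zero [simp]: "label_shuffle (\<lambda>w. 0) al bl = (0 :: 'b::ab_group_add)"
  using additive_label_shuffle[of "\<lambda>_::'b. 0 :: 'b" "\<lambda>_. 0" al bl] by (simp add: additive_def)

context fd_graded_comm_algebra
begin

abbreviation ps :: "int \<Rightarrow> 'v \<Rightarrow> 'v" where "ps \<equiv> pass_sign A"

definition mlin :: "('v list \<Rightarrow> 'v) \<Rightarrow> bool" where
  "mlin F \<longleftrightarrow> (\<forall>us vs. lin (\<lambda>x. F (us @ x # vs)))"

lemma mlinD: "mlin F \<Longrightarrow> lin (\<lambda>x. F (us @ x # vs))"
  by (simp add: mlin_def)

lemma mlin_hd: "mlin F \<Longrightarrow> lin (\<lambda>x. F (x # vs))"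
  using mlinD[of F "[]"] by simp

lemma mlin_madditive: "mlin F \<Longrightarrow> madditive F"
  by (simp add: mlin_def madditive_def lin_def)

lemma mlin_Cons: "mlin F \<Longrightarrow> mlin (\<lambda>w. F (x # w))"
  using mlinD[of F "x # us" vs for us vs] by (simp add: mlin_def)

lemma lin_zero: "lin (\<lambda>x. 0)"
  by (simp add: lin_def additive_def)
lemma lin_add: "lin f \<Longrightarrow> lin g \<Longrightarrow> lin (\<lambda>x. f x + g x)"
  by (auto simp: lin_def additive_def vs.scale_right_distrib algebra_simps)
lemma lin_sc: "lin f \<Longrightarrow> lin (\<lambda>x. sc c (f x))"
  by (auto simp: lin_def additive_def vs.scale_right_distrib vs.scale_left_commute)
lemma lin_comp: "lin f \<Longrightarrow> lin g \<Longrightarrow> lin (\<lambda>x. f (g x))"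
  by (auto simp: lin_def additive_def)
lemma lin_sum: "(\<And>i. i \<in> I \<Longrightarrow> lin (f i)) \<Longrightarrow> lin (\<lambda>x. \<Sum>i\<in>I. f i x)"
  by (induction I rule: infinite_finite_induct) (auto intro: lin_add lin_zero)

lemma lin_cuts: "(\<And>u v. lin (\<lambda>x. K x u v)) \<Longrightarrow> lin (\<lambda>x. cuts (K x) w)"
  unfolding cuts_eq_sum by (rule lin_sum) blast

lemma lin_cuts_arg:
  assumes "\<And>u1 u2 v. lin (\<lambda>x. K (u1 @ x # u2) v)" "\<And>u v1 v2. lin (\<lambda>x. K u (v1 @ x # v2))"
  shows "lin (\<lambda>x. cuts K (us @ x # vs))"
  using assms
proof (induction us arbitrary: K)
  case Nil
  have "lin (\<lambda>x. K [] (x # vs))" using Nil(2)[of "[]" "[]"] by simp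
  moreover have "lin (\<lambda>x. cuts (\<lambda>u v. K (x # u) v) vs)" 
    by (rule lin_cuts) (use Nil(1)[of "[]"] in simp)
  ultimately show ?case by (simp add: lin_add)
next
  case (Cons a us)
  have "lin (\<lambda>x. K [] (a # us @ x # vs))" using Cons(3)[of "[]" "a # us" vs] by simp
  moreover have "lin (\<lambda>x. cuts (\<lambda>u v. K (a # u) v) (us @ x # vs))" 
    by (rule Cons.IH) (use Cons(2)[of "a # u" for u] Cons(3) in simp_all)
  ultimately show ?case by (simp add: lin_add)
qed

lemma lin_ins_param:
  assumes "\<And>w. lin (\<lambda>x. T x w)"
  shows "lin (\<lambda>x. ins s (T x) G w)"
  using assms by (induction w arbitrary: T) (auto intro!: lin_add lin_zero lin_cuts)

lemma mlin_ins:
  assumes "mlin F" "mlin G" and s: "lin s"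
  shows "mlin (ins s F G)"
  unfolding mlin_def
proof (intro allI)
  fix us vs
  show "lin (\<lambda>x. ins s F G (us @ x # vs))"
    using assms(1)
  proof (induction us arbitrary: F)
    case Nil
    have "lin (\<lambda>x. cuts (\<lambda>u v. F (G (x # u) # v)) vs)"
      by (rule lin_cuts, rule lin_comp[OF mlin_hd[OF Nil] mlin_hd[OF assms(2)]])
    moreover have "lin (\<lambda>x. ins s (\<lambda>w. F (s x # w)) G vs)"
      by (rule lin_ins_param, rule lin_comp[OF mlin_hd[OF Nil] s])
    ultimately show ?case by (simp add: lin_add)
  next
    case (Cons a us)
    have "lin (\<lambda>x. cuts (\<lambda>u v. F (G (a # u) # v)) (us @ x # vs))"
    proof (rule lin_cuts_arg)
      fix u1 u2 v
      have "lin (\<lambda>x. G (a # u1 @ x # u2))" using mlinD[OF assms(2), of "a # u1" u2] by simp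
      then show "lin (\<lambda>x. F (G (a # u1 @ x # u2) # v))" by (rule lin_comp[OF mlin_hd[OF Cons.prems]])
    next
      fix u v1 v2
      show "lin (\<lambda>x. F (G (a # u) # v1 @ x # v2))" using mlinD[OF Cons.prems, of "_ # v1" v2] by simp
    qed
    moreover have "lin (\<lambda>x. ins s (\<lambda>w. F (s a # w)) G (us @ x # vs))"
      by (rule Cons.IH[OF mlin_Cons[OF Cons.prems]])
    ultimately show ?case by (simp add: lin_add)
  qed
qed

text \<open>Every element is a sum of homogeneous ones, and the slots can be expanded one after the other.\<close>

lemma madditive_eq_zero_if_homogeneous:
  fixes F :: "'v list \<Rightarrow> 'v"
  assumes "madditive F" "\<And>al. homogeneous A al \<Longrightarrow> F (map snd al) = 0"
  shows "F xs = 0"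
  using assms
proof (induction xs arbitrary: F)
  case Nil
  show ?case using Nil(2)[of "[]"] by simp
next
  case (Cons x xs)
  have hom: "F (y # xs) = 0" if "y \<in> grade A i" for y i
  proof (rule Cons.IH[OF madditive_Cons[OF Cons.prems(1)]])
    fix al assume "homogeneous A al"
    then show "F (y # map snd al) = 0" using Cons.prems(2)[of "(i - 1, y) # al"] that by simp
  qed
  have "F (x # xs) = F ((\<Sum>i | comps x i \<noteq> 0. comps x i) # xs)" by (simp add: sum_comps)
  also have "\<dots> = (\<Sum>i | comps x i \<noteq> 0. F (comps x i # xs))"
    by (rule additive.sum[OF madditive_hd[OF Cons.prems(1)]])
  also have "\<dots> = 0" using hom[OF comps_grade] by simp
  finally show ?case .
qed

definition hdeg :: "int \<Rightarrow> ('v list \<Rightarrow> 'v) \<Rightarrow> bool" where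
  "hdeg d F \<longleftrightarrow> (\<forall>al. homogeneous A al \<longrightarrow> F (map snd al) \<in> grade A (total_deg al + d + 1))"

text \<open>Products over all arities of suspended Harrison cochains of degree \<open>d\<close>. A component of arity 1
  is permitted, so that the identity and isotopies are included. Because suspension absorbs the
  signs, the degree on \<open>sH\<close> is the only index.\<close>

definition sharr :: "int \<Rightarrow> ('v list \<Rightarrow> 'v) set" where
  "sharr d = {F. F [] = 0 \<and> mlin F \<and> hdeg d F \<and> vanishes_on_shuffles A F}"

lemma sharrD: assumes "F \<in> sharr d"
  shows "F [] = 0" "mlin F" "hdeg d F" "vanishes_on_shuffles A F" "madditive F"
  using assms by (auto simp: sharr_def mlin_madditive)

lemma vanishes_iff: "vanishes_on_shuffles A F \<longleftrightarrow>
  (\<forall>al bl. al \<noteq> [] \<longrightarrow> bl \<noteq> [] \<longrightarrow> homogeneous A al \<longrightarrow> homogeneous A bl \<longrightarrow> label_shuffle (\<lambda>w. F (map snd w)) al bl = 0)"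
  unfolding vanishes_on_shuffles_def shuffle_sum_eq_label_shuffle homogeneous_def ball_Un by blast

lemma map_ps_homogeneous:
  assumes "madditive F" "homogeneous A al"
  shows "F (map (ps e) (map snd al)) = ksgn (e * total_deg al) (F (map snd al))"
  using assms
proof (induction al arbitrary: F)
  case (Cons p al)
  have "F (map (ps e) (map snd (p # al))) = F (ps e (snd p) # map (ps e) (map snd al))" by simp
  also have "\<dots> = ksgn (e * total_deg al) (F (ps e (snd p) # map snd al))"
    using Cons.IH[OF madditive_Cons[OF Cons.prems(1)]] Cons.prems(2) by simp
  also have "F (ps e (snd p) # map snd al) = ksgn (e * fst p) (F (snd p # map snd al))"
    using Cons.prems(2) additive_commutes_ksgn[OF madditive_hd[OF Cons.prems(1)]]
    by (simp add: pass_sign_homogeneous[of "snd p" "fst p" e])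
  finally show ?case by (simp add: ksgn_ksgn algebra_simps)
qed simp

text \<open>The sign rule for homogeneous maps in the element-free form that
  \<open>commutator_is_insertion\<close> needs; it extends from homogeneous words by additivity.\<close>

lemma parity:
  assumes F: "F \<in> sharr d"
  shows "F (map (ps e) xs) = ksgn (d * e) (ps e (F xs))"
proof -
  note ps = pass_sign_lin[of e, THEN lin_additive]
  let ?der = "\<lambda>xs. F (map (ps e) xs) - ksgn (d * e) (ps e (F xs))"
  have "?der xs = 0"
  proof (rule madditive_eq_zero_if_homogeneous)
    show "madditive ?der"
      unfolding madditive_def
    proof (intro allI)
      fix us vs
      have 1: "additive (\<lambda>x. F (map (ps e) us @ x # map (ps e) vs))" and 2: "additive (\<lambda>x. F (us @ x # vs))"
        using madditiveD[OF sharrD(5)[OF F]] by blast+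
      show "additive (\<lambda>x. ?der (us @ x # vs))"
        using additive.add[OF 1] additive.add[OF 2]
        by (simp add: additive_def additive.add[OF ps] additive.add[OF additive_ksgn])
    qed
  next
    fix al assume al: "homogeneous A al"
    then have "F (map snd al) \<in> grade A (total_deg al + d + 1)" using sharrD(3)[OF F] by (simp add: hdeg_def)
    then have "ps e (F (map snd al)) = ksgn (e * (total_deg al + d)) (F (map snd al))"
      by (rule pass_sign_homogeneous)
    then show "?der (map snd al) = 0"
      unfolding map_ps_homogeneous[OF sharrD(5)[OF F] al] by (auto simp: ksgn_def)
  qed
  then show ?thesis by simp
qed

text \<open>The operator \<open>F \<mapsto> F \<circ> D\<^sub>G\<close>, for \<open>G\<close> of degree \<open>e\<close>.\<close>

definition coder :: "int \<Rightarrow> ('v list \<Rightarrow> 'v) \<Rightarrow> ('v list \<Rightarrow> 'v) \<Rightarrow> 'v list \<Rightarrow> 'v" where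
  "coder e G F = ins (ps e) F G"

lemma coder_commutator:
  assumes F: "madditive F" and H: "H \<in> sharr d" and G: "G \<in> sharr e"
  shows "coder e G (coder d H F) w - ksgn (d * e) (coder d H (coder e G F) w) =
     coder (d + e) (\<lambda>xs. coder e G H xs - ksgn (d * e) (coder d H G xs)) F w"
proof -
  have "coder (d + e) X F w = ins (\<lambda>x. ps e (ps d x)) F X w" for X
    by (simp add: coder_def pass_sign_pass_sign add.commute)
  then show ?thesis
    unfolding coder_def
    using commutator_is_insertion[OF F, of "ps e" "ps d" H "d * e" G w] parity[OF H] parity[OF G]
    by (simp add: pass_sign_pass_sign add.commute mult.commute)
qed

lemma cuts_in:
  assumes U: "\<And>x y. x \<in> U \<Longrightarrow> y \<in> U \<Longrightarrow> x + y \<in> U"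
  shows "(\<And>u v. u @ v = w \<Longrightarrow> K u v \<in> U) \<Longrightarrow> cuts K w \<in> (U :: 'v set)"
  by (induction w arbitrary: K) (auto intro!: U)

lemma label_ins_in:
  assumes "\<And>w. w \<noteq> [] \<Longrightarrow> homogeneous A w \<Longrightarrow> total_deg w = total_deg al + e \<Longrightarrow> T w \<in> U"
    and U: "0 \<in> U" "\<And>x y. x \<in> U \<Longrightarrow> y \<in> U \<Longrightarrow> x + y \<in> U" "\<And>x. x \<in> U \<Longrightarrow> - x \<in> U"
    and "homogeneous A al" and G: "hdeg e G"
  shows "label_ins e T G al \<in> (U :: 'v set)"
  using assms(1,5)
proof (induction al arbitrary: T)
  case Nil
  show ?case by (simp add: U)
next
  case (Cons p al)
  have "cuts (\<lambda>u v. T ((e + total_deg (p # u), G (map snd (p # u))) # v)) al \<in> U"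
  proof (rule cuts_in)
    fix u v assume uv: "u @ v = al"
    have "homogeneous A (p # u)" "homogeneous A v" using Cons.prems(2) uv by auto
    with G have "G (map snd (p # u)) \<in> grade A (e + total_deg (p # u) + 1)"
      unfolding hdeg_def by (metis add.commute)
    with \<open>homogeneous A v\<close> uv show "T ((e + total_deg (p # u), G (map snd (p # u))) # v) \<in> U"
      by (intro Cons.prems(1)) auto
  qed (rule U)
  moreover have "label_ins e (\<lambda>w. T (p # w)) G al \<in> U"
    by (rule Cons.IH) (use Cons.prems in auto)
  ultimately show ?case by (simp add: U ksgn_def)
qed

lemma ins_eq_label_ins:
  assumes "madditive F" "homogeneous A al"
  shows "ins (ps e) F G (map snd al) = label_ins e (\<lambda>w. F (map snd w)) G al"
  using assms
proof (induction al arbitrary: F)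
  case (Cons p al)
  have "(\<lambda>w. F (ps e (snd p) # w)) = (\<lambda>w. ksgn (e * fst p) (F (snd p # w)))"
    using Cons.prems(2) additive_commutes_ksgn[OF madditive_hd[OF Cons.prems(1)]]
    by (simp add: pass_sign_homogeneous[of "snd p" "fst p" e])
  then have "ins (ps e) (\<lambda>w. F (ps e (snd p) # w)) G (map snd al) =
     ksgn (e * fst p) (ins (ps e) (\<lambda>w. F (snd p # w)) G (map snd al))"
    by (simp only: additive_ins[OF additive_ksgn])
  also have "ins (ps e) (\<lambda>w. F (snd p # w)) G (map snd al) = label_ins e (\<lambda>w. F (map snd (p # w))) G al"
    using Cons.IH[OF madditive_Cons[OF Cons.prems(1)]] Cons.prems(2) by simp
  finally show ?case
    by (simp add: cuts_eq_sum take_map drop_map)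
qed simp

text \<open>Harrison cochains are closed under composition with Harrison coderivations: a derivation of the
  shuffle product maps products of nonempty words to sums of such products, on which \<open>F\<close>
  vanishes.\<close>

lemma coder_sharr:
  assumes F: "F \<in> sharr d" and G: "G \<in> sharr e"
  shows "coder e G F \<in> sharr (d + e)"
  unfolding sharr_def
proof (intro CollectI conjI)
  show "coder e G F [] = 0" by (simp add: coder_def)
  show "mlin (coder e G F)" unfolding coder_def by (rule mlin_ins[OF sharrD(2)[OF F] sharrD(2)[OF G] pass_sign_lin])
  show "hdeg (d + e) (coder e G F)"
    unfolding hdeg_def
  proof (intro allI impI)
    fix al assume al: "homogeneous A al"
    have "label_ins e (\<lambda>w. F (map snd w)) G al \<in> grade A (total_deg al + (d + e) + 1)"
    proof (rule label_ins_in[OF _ grade_0 grade_add grade_neg al sharrD(3)[OF G]])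
      fix w assume "homogeneous A w" "total_deg w = total_deg al + e"
      then show "F (map snd w) \<in> grade A (total_deg al + (d + e) + 1)"
        using sharrD(3)[OF F] unfolding hdeg_def by (metis add.assoc add.commute)
    qed
    then show "coder e G F (map snd al) \<in> grade A (total_deg al + (d + e) + 1)"
      by (simp add: coder_def ins_eq_label_ins[OF sharrD(5)[OF F] al])
  qed
  show "vanishes_on_shuffles A (coder e G F)"
    unfolding vanishes_iff
  proof (intro allI impI)
    fix al bl assume ne: "al \<noteq> []" "bl \<noteq> []" and h: "homogeneous A al" "homogeneous A bl"
    let ?T = "\<lambda>w. F (map snd w)"
    have z: "label_shuffle ?T al' bl' = 0" if "al' \<noteq> []" "bl' \<noteq> []" "homogeneous A al'" "homogeneous A bl'" for al' bl'
      using sharrD(4)[OF F] that unfolding vanishes_iff by blast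
    have "label_shuffle (\<lambda>w. coder e G F (map snd w)) al bl = label_shuffle (label_ins e ?T G) al bl"
    proof (rule label_shuffle_cong)
      fix w assume "w \<in> shuffles al bl"
      then have "homogeneous A w" using h set_shuffles[of w al bl] by (auto simp: homogeneous_def)
      then show "coder e G F (map snd w) = label_ins e ?T G w"
        unfolding coder_def by (rule ins_eq_label_ins[OF sharrD(5)[OF F]])
    qed
    also have "\<dots> = label_ins e (\<lambda>w. label_shuffle ?T w bl) G al + ksgn (e * total_deg al) (label_ins e (label_shuffle ?T al) G bl)"
      by (rule label_shuffle_label_ins[OF sharrD(4)[OF G] ladditive_map_snd[OF sharrD(5)[OF F]] h])
    also have "label_ins e (\<lambda>w. label_shuffle ?T w bl) G al \<in> {0}"
      by (rule label_ins_in[OF _ _ _ _ h(1) sharrD(3)[OF G]]) (use z h ne in auto)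
    then have "label_ins e (\<lambda>w. label_shuffle ?T w bl) G al = 0" by simp
    also have "label_ins e (label_shuffle ?T al) G bl \<in> {0}"
      by (rule label_ins_in[OF _ _ _ _ h(2) sharrD(3)[OF G]]) (use z h ne in auto)
    then have "label_ins e (label_shuffle ?T al) G bl = 0" by simp
    finally show "label_shuffle (\<lambda>w. coder e G F (map snd w)) al bl = 0" by simp
  qed
qed

lemma additive_sc: "additive (sc c)"
  by (simp add: additive_def vs.scale_right_distrib)

lemma sharr_zero: "(\<lambda>xs. 0) \<in> sharr d"
  by (simp add: sharr_def mlin_def lin_zero hdeg_def grade_0 vanishes_iff)

lemma sharr_add: "F \<in> sharr d \<Longrightarrow> F' \<in> sharr d \<Longrightarrow> (\<lambda>xs. F xs + F' xs) \<in> sharr d"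
  by (simp add: sharr_def mlin_def lin_add hdeg_def grade_add vanishes_iff label_shuffle_add)

lemma sharr_sc: "F \<in> sharr d \<Longrightarrow> (\<lambda>xs. sc c (F xs)) \<in> sharr d"
  by (simp add: sharr_def mlin_def lin_sc hdeg_def grade_sc vanishes_iff additive_label_shuffle[OF additive_sc, symmetric])

lemma sharr_uminus: "F \<in> sharr d \<Longrightarrow> (\<lambda>xs. - F xs) \<in> sharr d"
  using sharr_sc[of F d "-1"] by simp

lemma sharr_diff: "F \<in> sharr d \<Longrightarrow> F' \<in> sharr d \<Longrightarrow> (\<lambda>xs. F xs - F' xs) \<in> sharr d"
  using sharr_add[OF _ sharr_uminus] by fastforce

lemma sharr_sum: "(\<And>i. i \<in> I \<Longrightarrow> F i \<in> sharr d) \<Longrightarrow> (\<lambda>xs. \<Sum>i\<in>I. F i xs) \<in> sharr d"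
  by (induction I rule: infinite_finite_induct) (auto intro: sharr_zero sharr_add)

text \<open>Membership is tested in each arity separately. This is how sums that are finite only in each
  arity are seen to stay in the space.\<close>

lemma sharr_by_length:
  assumes "\<And>n. \<exists>F'\<in>sharr d. \<forall>xs. length xs = n \<longrightarrow> F xs = F' xs"
  shows "F \<in> sharr d"
proof -
  from assms obtain F' where F': "\<And>n. F' n \<in> sharr d" and eq: "\<And>xs. F xs = F' (length xs) xs" by metis
  note der = sharrD[OF F']
  show ?thesis
    unfolding sharr_def mlin_def hdeg_def vanishes_iff
  proof (intro CollectI conjI allI impI)
    fix al bl assume h: "al \<noteq> []" "bl \<noteq> []" "homogeneous A al" "homogeneous A bl"
    have "label_shuffle (\<lambda>w. F (map snd w)) al bl = label_shuffle (\<lambda>w. F' (length al + length bl) (map snd w)) al bl"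
      by (rule label_shuffle_cong) (simp add: eq length_shuffles)
    then show "label_shuffle (\<lambda>w. F (map snd w)) al bl = 0"
      using der(4) h unfolding vanishes_iff by auto
  qed (use der in \<open>auto simp: eq mlin_def hdeg_def\<close>)
qed

lemma sharr_restrict_length:
  assumes "F \<in> sharr d"
  shows "(\<lambda>xs. if P (length xs) then F xs else 0) \<in> sharr d"
  by (rule sharr_by_length) (metis assms sharr_zero)

text \<open>The projection of the tensor coalgebra to its cogenerators \<open>sH\<close>.\<close>

definition proj1 :: "'v list \<Rightarrow> 'v" where
  "proj1 xs = (if length xs = 1 then hd xs else 0)"

lemma proj1_sharr: "proj1 \<in> sharr 0"
  unfolding sharr_def mlin_def hdeg_def vanishes_iff
proof (intro CollectI conjI allI impI)
  fix us vs :: "'v list"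
  have id: "lin (\<lambda>x. x)" by (simp add: lin_def additive_def)
  show "lin (\<lambda>x. proj1 (us @ x # vs))"
    by (cases us; cases vs) (simp_all add: proj1_def id lin_zero)
next
  fix al assume "homogeneous A al"
  then show "proj1 (map snd al) \<in> grade A (total_deg al + 0 + 1)"
    by (cases al) (auto simp: proj1_def grade_0)
next
  fix al bl :: "(int \<times> 'v) list" assume "al \<noteq> []" "bl \<noteq> []"
  then have "label_shuffle (\<lambda>w. proj1 (map snd w)) al bl = label_shuffle (\<lambda>w. 0) al bl"
    by (intro label_shuffle_cong) (cases al; cases bl; auto simp: proj1_def length_shuffles dest!: length_shuffles)
  then show "label_shuffle (\<lambda>w. proj1 (map snd w)) al bl = 0" 
    by simp
qed (simp add: proj1_def)

lemma coder_proj1: "G [] = 0 \<Longrightarrow> coder e G proj1 = G"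
proof
  fix w assume G: "G [] = 0"
  show "coder e G proj1 w = G w"
  proof (cases w)
    case (Cons x u)
    have "cuts (\<lambda>u v. proj1 (G (x # u) # v)) u = G (x # u)"
    proof -
      have "cuts (\<lambda>u v. if v = [] then f u else 0) w = f w" for f :: "'v list \<Rightarrow> 'v" and w
        by (induction w arbitrary: f) auto
      then have "cuts (\<lambda>u v. if v = [] then G (x # u) else 0) u = G (x # u)" .
      moreover have "proj1 (G (x # u) # v) = (if v = [] then G (x # u) else 0)" for u v
        by (simp add: proj1_def)
      ultimately show ?thesis by simp
    qed
    moreover have "ins (ps e) (\<lambda>w. proj1 (ps e x # w)) G u = ins (ps e) (\<lambda>w. 0) G u"
      by (rule ins_cong) (auto simp: proj1_def)
    ultimately show ?thesis by (simp add: coder_def Cons)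
  qed (simp add: coder_def G)
qed

end

section \<open>Suspension\<close>

fun susp_args :: "('k, 'v::ab_group_add) graded_algebra \<Rightarrow> 'v list \<Rightarrow> 'v list" where
  "susp_args A [] = []"
| "susp_args A (x # w) = pass_sign A (int (length w)) x # susp_args A w"

lemma length_susp_args [simp]: "length (susp_args A w) = length w"
  by (induction w) simp_all

lemma susp_eq: "susp A f xs = f (susp_args A xs)"
proof -
  have "map (\<lambda>i. pass_sign A (int (length xs - 1 - i)) (xs ! i)) [0..<length xs] = susp_args A xs"
  proof (induction xs)
    case (Cons x w)
    have "map (\<lambda>i. pass_sign A (int (length (x # w) - 1 - i)) ((x # w) ! i)) [0..<length (x # w)] =
      pass_sign A (int (length w)) x # map (\<lambda>i. pass_sign A (int (length w - Suc i)) (w ! i)) [0..<length w]"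
      by (simp add: upt_conv_Cons map_Suc_upt[symmetric] del: upt_Suc)
    with Cons show ?case by simp
  qed simp
  then show ?thesis by (simp add: susp_def)
qed

lemma susp_add: "susp A (f + g) = susp A f + susp A g"
  and susp_diff: "susp A (f - g) = susp A f - susp A g"
  and susp_zero [simp]: "susp A 0 = 0"
  by (auto simp: susp_eq fun_eq_iff)

lemma susp_arity_part: "susp A (arity_part n f) = arity_part n (susp A f)"
  by (auto simp: susp_eq arity_part_def)

definition vanishes_upto :: "nat \<Rightarrow> ('a list \<Rightarrow> 'b::zero) \<Rightarrow> bool" where
  "vanishes_upto q F \<longleftrightarrow> (\<forall>xs. length xs \<le> q \<longrightarrow> F xs = 0)"

lemma vanishes_uptoD: "vanishes_upto q F \<Longrightarrow> length xs \<le> q \<Longrightarrow> F xs = 0"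
  by (simp add: vanishes_upto_def)

lemma vanishes_upto_mono: "vanishes_upto q F \<Longrightarrow> r \<le> q \<Longrightarrow> vanishes_upto r F"
  by (auto simp: vanishes_upto_def)

lemma ins_zero2: "madditive F \<Longrightarrow> ins s F (\<lambda>u. 0) w = 0"
proof (induction w arbitrary: F)
  case (Cons x w)
  have "F (0 # v) = 0" for v using madditive_zero[OF Cons.prems, of "[]"] by simp
  then show ?case using Cons.IH[OF madditive_Cons[OF Cons.prems]] by simp
qed simp

text \<open>Replacing a block of length at least \<open>q + 1\<close> by one letter in a word accepted by a functional of
  arities at least \<open>r + 1\<close> needs at least \<open>q + r + 1\<close> letters. All filtration estimates reduce to
  this count.\<close>

lemma vanishes_upto_ins:
  fixes F :: "'v::ab_group_add list \<Rightarrow> 'b::ab_group_add"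
  assumes "madditive F" "vanishes_upto r F" "vanishes_upto q G"
  shows "vanishes_upto (q + r) (ins s F G)"
  unfolding vanishes_upto_def
proof (intro allI impI)
  fix w :: "'v list" assume "length w \<le> q + r"
  then show "ins s F G w = 0" using assms(1,2)
  proof (induction w arbitrary: F r)
    case (Cons x w)
    have "cuts (\<lambda>u v. F (G (x # u) # v)) w = cuts (\<lambda>u v. 0) w"
    proof (rule cuts_cong)
      fix u v assume uv: "u @ v = w"
      show "F (G (x # u) # v) = 0"
      proof (cases "length (x # u) \<le> q")
        case True
        then show ?thesis using madditive_zero[OF Cons.prems(2), of "[]"] vanishes_uptoD[OF assms(3)] by simp
      next
        case False
        then show ?thesis using Cons.prems(1) uv by (intro vanishes_uptoD[OF Cons.prems(3)]) auto
      qed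
    qed
    moreover have "ins s (\<lambda>w. F (s x # w)) G w = 0"
    proof (cases r)
      case 0
      have "ins s (\<lambda>w. F (s x # w)) G w = ins s (\<lambda>w. F (s x # w)) (\<lambda>u. 0) w"
        by (rule ins_cong) (use Cons.prems(1) 0 in \<open>auto intro: vanishes_uptoD[OF assms(3)]\<close>)
      also have "\<dots> = 0" by (rule ins_zero2[OF madditive_Cons[OF Cons.prems(2)]])
      finally show ?thesis .
    next
      case (Suc r')
      show ?thesis
        by (rule Cons.IH[of r']) (use Cons.prems Suc madditive_Cons in \<open>auto simp: vanishes_upto_def\<close>)
    qed
    ultimately show ?case by simp
  qed simp
qed


lemma ins_add2:
  assumes "madditive F"
  shows "ins s F (\<lambda>w. G w + G' w) w = ins s F G w + ins s F G' w"
  using assms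
proof (induction w arbitrary: F)
  case (Cons x w)
  show ?case
    using Cons.IH[OF madditive_Cons[OF Cons.prems]]
    by (simp add: additive.add[OF madditive_hd[OF Cons.prems]] cuts_add algebra_simps)
qed simp

lemma ins_concentrated:
  assumes "madditive F" "\<And>xs. length xs \<noteq> a \<Longrightarrow> F xs = 0" "\<And>xs. length xs \<noteq> b \<Longrightarrow> G xs = 0"
    "length w + 1 \<noteq> a + b"
  shows "ins s F G w = 0"
  using assms(1,2,4)
proof (induction w arbitrary: F a)
  case (Cons x w)
  have "cuts (\<lambda>u v. F (G (x # u) # v)) w = cuts (\<lambda>u v. 0) w"
  proof (rule cuts_cong)
    fix u v assume uv: "u @ v = w"
    show "F (G (x # u) # v) = 0"
    proof (cases "length (x # u) = b")
      case False
      then show ?thesis using madditive_zero[OF Cons.prems(1), of "[]"] assms(3) by simp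
    next
      case True
      then show ?thesis using Cons.prems(3) uv by (intro Cons.prems(2)) auto
    qed
  qed
  moreover have "ins s (\<lambda>w. F (s x # w)) G w = 0"
  proof (cases a)
    case 0
    then have "(\<lambda>w. F (s x # w)) = (\<lambda>w. 0)" using Cons.prems(2) by auto
    then show ?thesis by simp
  next
    case (Suc a')
    show ?thesis
      by (rule Cons.IH[of _ a']) (use Cons.prems Suc madditive_Cons in auto)
  qed
  ultimately show ?case by simp
qed simp

context fd_graded_comm_algebra
begin

lemma susp_args_susp_args [simp]: "susp_args A (susp_args A w) = w"
  by (induction w) (simp_all add: pass_sign_pass_sign, simp add: pass_sign_def)

lemma susp_susp [simp]: "susp A (susp A f) = f"
  by (simp add: susp_eq fun_eq_iff)

lemma susp_eqI: "susp A f = susp A g \<Longrightarrow> f = g"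
  using susp_susp by metis

lemma vanishes_upto_susp: "vanishes_upto q (susp A f) \<longleftrightarrow> vanishes_upto q f"
  unfolding vanishes_upto_def susp_eq by (metis susp_args_susp_args length_susp_args)

lemma mlin_susp:
  assumes "mlin f" shows "mlin (susp A f)"
  unfolding mlin_def
proof (intro allI)
  fix us vs
  have "\<exists>us'. \<forall>x. susp_args A (us @ x # vs) = us' @ ps (int (length vs)) x # susp_args A vs"
  proof (induction us)
    case Nil
    show ?case by (rule exI[of _ "[]"]) simp
  next
    case (Cons a us)
    then obtain us' where "\<forall>x. susp_args A (us @ x # vs) = us' @ ps (int (length vs)) x # susp_args A vs" ..
    then show ?case
      by (intro exI[of _ "ps (int (length us + Suc (length vs))) a # us'"]) simp
  qed
  then obtain us' where "\<forall>x. susp_args A (us @ x # vs) = us' @ ps (int (length vs)) x # susp_args A vs" ..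
  then show "lin (\<lambda>x. susp A f (us @ x # vs))"
    using lin_comp[OF mlinD[OF assms] pass_sign_lin] by (simp add: susp_eq)
qed

lemma susp_args_labelled:
  "homogeneous A al \<Longrightarrow> \<exists>al'. homogeneous A al' \<and> total_deg al' = total_deg al \<and> map snd al' = susp_args A (map snd al)"
proof (induction al)
  case (Cons p al)
  then obtain al' where "homogeneous A al'" "total_deg al' = total_deg al" "map snd al' = susp_args A (map snd al)" by auto
  moreover have "ps (int (length al)) (snd p) \<in> grade A (fst p + 1)"
    using Cons.prems by (simp add: pass_sign_homogeneous[of "snd p" "fst p"] grade_ksgn)
  ultimately show ?case by (intro exI[of _ "(fst p, ps (int (length al)) (snd p)) # al'"]) simp
qed simp

lemma hdeg_susp: "hdeg d f \<Longrightarrow> hdeg d (susp A f)"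
  unfolding hdeg_def susp_eq using susp_args_labelled by metis

lemma mlin_susp_iff: "mlin (susp A f) \<longleftrightarrow> mlin f"
  using mlin_susp susp_susp by metis

lemma hdeg_susp_iff: "hdeg d (susp A f) \<longleftrightarrow> hdeg d f"
  using hdeg_susp susp_susp by metis

lemma cochains_iff:
  "f \<in> cochains A n j \<longleftrightarrow> (\<forall>xs. length xs \<noteq> n \<longrightarrow> f xs = 0) \<and> mlin f \<and> hdeg (int n + j - 1) f"
proof -
  have mlin: "(\<forall>xs i. length xs = n \<longrightarrow> i < n \<longrightarrow> lin (\<lambda>x. f (xs[i := x]))) \<longleftrightarrow> mlin f"
    if 0: "\<forall>xs. length xs \<noteq> n \<longrightarrow> f xs = 0"
  proof
    assume l: "\<forall>xs i. length xs = n \<longrightarrow> i < n \<longrightarrow> lin (\<lambda>x. f (xs[i := x]))"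
    show "mlin f"
      unfolding mlin_def
    proof (intro allI)
      fix us vs
      show "lin (\<lambda>x. f (us @ x # vs))"
      proof (cases "length us + Suc (length vs) = n")
        case True
        then show ?thesis using l[rule_format, of "us @ 0 # vs" "length us"] by simp
      next
        case False
        then have "(\<lambda>x. f (us @ x # vs)) = (\<lambda>x. 0)" using 0 by auto
        then show ?thesis by (simp add: lin_zero)
      qed
    qed
  next
    assume m: "mlin f"
    show "\<forall>xs i. length xs = n \<longrightarrow> i < n \<longrightarrow> lin (\<lambda>x. f (xs[i := x]))"
      using mlinD[OF m] by (simp add: upd_conv_take_nth_drop)
  qed
  have hdeg: "(\<forall>xs ds. length xs = n \<longrightarrow> list_all2 (\<lambda>x d. x \<in> grade A d) xs ds \<longrightarrow>
        f xs \<in> grade A (sum_list ds + j)) \<longleftrightarrow> hdeg (int n + j - 1) f"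
    if 0: "\<forall>xs. length xs \<noteq> n \<longrightarrow> f xs = 0"
  proof
    assume g: "\<forall>xs ds. length xs = n \<longrightarrow> list_all2 (\<lambda>x d. x \<in> grade A d) xs ds \<longrightarrow>
        f xs \<in> grade A (sum_list ds + j)"
    show "hdeg (int n + j - 1) f"
      unfolding hdeg_def
    proof (intro allI impI)
      fix al assume al: "homogeneous A al"
      have "list_all2 (\<lambda>x d. x \<in> grade A d) (map snd al) (map (\<lambda>p. fst p + 1) al)"
        using al by (induction al) auto
      moreover have "sum_list (map (\<lambda>p. fst p + 1) al) = total_deg al + int (length al)"
        by (induction al) auto
      ultimately show "f (map snd al) \<in> grade A (total_deg al + (int n + j - 1) + 1)"
        using g[rule_format, of "map snd al" "map (\<lambda>p. fst p + 1) al"] 0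
        by (cases "length al = n") (auto simp: grade_0 algebra_simps)
    qed
  next
    assume h: "hdeg (int n + j - 1) f"
    show "\<forall>xs ds. length xs = n \<longrightarrow> list_all2 (\<lambda>x d. x \<in> grade A d) xs ds \<longrightarrow>
        f xs \<in> grade A (sum_list ds + j)"
    proof (intro allI impI)
      fix xs ds assume n: "length xs = n" and "list_all2 (\<lambda>x d. x \<in> grade A d) xs ds"
      from this(2) have "\<exists>al. homogeneous A al \<and> map snd al = xs \<and> sum_list ds = total_deg al + int (length xs)"
      proof (induction rule: list_all2_induct)
        case (Cons x xs d ds)
        then obtain al where "homogeneous A al" "map snd al = xs" "sum_list ds = total_deg al + int (length xs)" by blast
        then show ?case using Cons by (intro exI[of _ "(d - 1, x) # al"]) auto
      qed simp
      then obtain al where "homogeneous A al" "map snd al = xs" "sum_list ds = total_deg al + int (length xs)" by blast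
      then show "f xs \<in> grade A (sum_list ds + j)"
        using h n unfolding hdeg_def by (metis (no_types, opaque_lifting) add.commute add.left_commute diff_add_cancel add_diff_eq)
    qed
  qed
  show ?thesis
    unfolding cochains_def linear_iff_lin using mlin hdeg by blast
qed

text \<open>For \<open>n = 0\<close> the two sides would differ, as members of \<open>sharr\<close> vanish on the empty
  word.\<close>

lemma harr_cochains_iff:
  assumes "n \<ge> 1"
  shows "f \<in> harr_cochains A n j \<longleftrightarrow>
    (\<forall>xs. length xs \<noteq> n \<longrightarrow> f xs = 0) \<and> susp A f \<in> sharr (int n + j - 1)"
proof -
  have "f [] = 0" if "\<forall>xs. length xs \<noteq> n \<longrightarrow> f xs = 0" using that assms by auto
  then show ?thesis
    by (auto simp: harr_cochains_def cochains_iff sharr_def mlin_susp_iff hdeg_susp_iff susp_eq)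
qed

lemma gla_iff: "f \<in> gla A d \<longleftrightarrow> vanishes_upto 1 f \<and> susp A f \<in> sharr d"
proof
  assume "f \<in> gla A d"
  then have l: "\<And>xs. length xs < 2 \<Longrightarrow> f xs = 0" and a: "\<And>n. n \<ge> 2 \<Longrightarrow> arity_part n f \<in> harr_cochains A n (d + 1 - int n)"
    by (auto simp: gla_def)
  have a': "arity_part n (susp A f) \<in> sharr d" if "n \<ge> 2" for n
    using a[OF that] that by (simp add: harr_cochains_iff susp_arity_part)
  have "susp A f \<in> sharr d"
  proof (rule sharr_by_length)
    fix n
    show "\<exists>F'\<in>sharr d. \<forall>xs. length xs = n \<longrightarrow> susp A f xs = F' xs"
    proof (cases "n \<ge> 2")
      case True
      then show ?thesis using a'[OF True] by (intro bexI) (auto simp: arity_part_def)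
    next
      case False
      then show ?thesis using sharr_zero by (intro bexI) (auto simp: susp_eq l)
    qed
  qed
  with l show "vanishes_upto 1 f \<and> susp A f \<in> sharr d" by (auto simp: vanishes_upto_def)
next
  assume r: "vanishes_upto 1 f \<and> susp A f \<in> sharr d"
  have "arity_part n (susp A f) \<in> sharr d" for n
    using sharr_restrict_length[of "susp A f" d "\<lambda>l. l = n"] r by (simp add: arity_part_def)
  then have "arity_part n f \<in> harr_cochains A n (d + 1 - int n)" if "n \<ge> 2" for n
    using that by (simp add: harr_cochains_iff susp_arity_part) (simp add: arity_part_def)
  then show "f \<in> gla A d"
    using r by (auto simp: gla_def vanishes_upto_def)
qed

lemma gla_filt_iff: "q \<ge> 1 \<Longrightarrow> f \<in> gla_filt A q d \<longleftrightarrow> susp A f \<in> sharr d \<and> vanishes_upto q (susp A f)"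
  unfolding vanishes_upto_susp by (auto simp: gla_filt_def gla_iff vanishes_upto_def)

lemma susp_circ:
  assumes "susp A f \<in> sharr d" "susp A g \<in> sharr e'"
  shows "susp A (circ A e f g) = coder e (susp A g) (susp A f)"
  unfolding circ_def susp_susp coder_def
  using insertion_eq_ins[of "susp A f" "susp A g" A e] sharrD[OF assms(1)] sharrD[OF assms(2)] by blast

section \<open>The suspended product\<close>

definition mu :: "'v list \<Rightarrow> 'v" where "mu = susp A (m2 A)"

lemma mu_eq: "mu [x, y] = prd A (shift_sign A x) y" "length xs \<noteq> 2 \<Longrightarrow> mu xs = 0"
  by (simp_all add: mu_def susp_eq m2_def pass_sign_def)

lemma prd_lin: "lin (\<lambda>x. prd A x y)" "lin (\<lambda>y. prd A x y)"
  using prd_linear_left prd_linear_right by (simp_all add: linear_iff_lin)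

lemma prd_ksgn: "prd A (ksgn c x) y = ksgn c (prd A x y)" "prd A x (ksgn c y) = ksgn c (prd A x y)"
  using additive_commutes_ksgn[OF lin_additive[OF prd_lin(1)]] additive_commutes_ksgn[OF lin_additive[OF prd_lin(2)]]
  by simp_all

text \<open>Graded commutativity of the product is precisely the vanishing of its suspension on the shuffle of
  two letters.\<close>

lemma mu_sharr: "mu \<in> sharr 1"
  unfolding sharr_def vanishes_iff
proof (intro CollectI conjI allI impI)
  show "mu [] = 0" by (simp add: mu_eq)
  show "mlin mu"
    unfolding mlin_def
  proof (intro allI)
    fix us vs :: "'v list"
    consider a where "us = []" "vs = [a]" | a where "us = [a]" "vs = []" | "length us + length vs \<noteq> 1"
      by (cases us; cases vs) auto
    then show "lin (\<lambda>x. mu (us @ x # vs))"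
    proof cases
      case 1
      then show ?thesis using lin_comp[OF prd_lin(1) pass_sign_lin[of 1]] by (simp add: mu_eq pass_sign_def)
    next
      case 2
      then show ?thesis using prd_lin(2) by (simp add: mu_eq)
    next
      case 3
      then show ?thesis by (simp add: mu_eq lin_zero)
    qed
  qed
  show "hdeg 1 mu"
    unfolding hdeg_def
  proof (intro allI impI)
    fix al assume al: "homogeneous A al"
    show "mu (map snd al) \<in> grade A (total_deg al + 1 + 1)"
    proof (cases "length al = 2")
      case True
      then obtain p q where [simp]: "al = [p, q]" by (auto simp: length_Suc_conv eval_nat_numeral)
      show ?thesis using al prd_grade[of "snd p" "fst p + 1" "snd q" "fst q + 1"]
        by (simp add: mu_eq shift_sign_homogeneous[of _ "fst p + 1"] prd_ksgn grade_ksgn algebra_simps)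
    qed (simp add: mu_eq grade_0)
  qed
next
  fix al bl assume ne: "al \<noteq> []" "bl \<noteq> []" and h: "homogeneous A al" "homogeneous A bl"
  show "label_shuffle (\<lambda>w. mu (map snd w)) al bl = 0"
  proof (cases "length al = 1 \<and> length bl = 1")
    case True
    then obtain p q where [simp]: "al = [p]" "bl = [q]" by (auto simp: length_Suc_conv)
    from h show ?thesis
      using prd_graded_comm[of "snd p" "fst p + 1" "snd q" "fst q + 1"]
      by (simp add: mu_eq shift_sign_homogeneous[of _ "fst p + 1"] shift_sign_homogeneous[of _ "fst q + 1"] prd_ksgn)
        (auto simp: ksgn_def)
  next
    case False
    have "label_shuffle (\<lambda>w. mu (map snd w)) al bl = label_shuffle (\<lambda>w. 0) al bl"
      by (rule label_shuffle_cong, rule mu_eq(2)) (use ne False in \<open>cases al; cases bl; auto dest!: length_shuffles\<close>)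
    then show ?thesis by simp
  qed
qed

lemma shift_sign_prd: "shift_sign A (prd A x y) = - prd A (shift_sign A x) (shift_sign A y)"
proof -
  let ?F = "\<lambda>xs. shift_sign A (mu xs)"
  have "mu (map (ps 1) [shift_sign A x, y]) = ksgn 1 (ps 1 (mu [shift_sign A x, y]))"
    using parity[OF mu_sharr, of 1 "[shift_sign A x, y]"] by simp
  then show ?thesis by (simp add: mu_eq pass_sign_def ksgn_def)
qed

text \<open>Associativity: the suspended multiplication anticommutes with the parity operator, so the two
  bracketings of three letters enter with opposite signs.\<close>

lemma coder_mu_mu: "coder 1 mu mu = (\<lambda>xs. 0)"
proof
  fix xs
  show "coder 1 mu mu xs = 0"
  proof (cases "length xs = 3")
    case True
    then obtain x y z where xs: "xs = [x, y, z]" by (auto simp: length_Suc_conv eval_nat_numeral)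
    have "prd A (- a) b = - prd A a b" for a b using additive.minus[OF lin_additive[OF prd_lin(1)]] .
    moreover have "prd A 0 y = 0" "prd A x 0 = 0" for x y
      using additive.zero[OF lin_additive[OF prd_lin(1)]] additive.zero[OF lin_additive[OF prd_lin(2)]] by auto
    ultimately show ?thesis
      by (simp add: xs coder_def mu_eq pass_sign_def shift_sign_prd prd_assoc)
  next
    case False
    then show ?thesis unfolding coder_def
      by (intro ins_concentrated[where a = 2 and b = 2]) (auto simp: mu_eq sharrD(5)[OF mu_sharr])
  qed
qed

end

section \<open>Exponentials of coderivations\<close>

lemma ins_swap:
  "ins s (\<lambda>v. ins t (\<lambda>u. K u v) G u) H v = ins t (\<lambda>u. ins s (K u) H v) G u"
proof (induction v arbitrary: K)
  case (Cons x v)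
  show ?case by (simp add: ins_add ins_cuts_gen Cons.IH)
qed simp

context fd_graded_comm_algebra
begin

text \<open>The operator \<open>coder\<close> in degree 0, where no signs occur.\<close>

definition der :: "('v list \<Rightarrow> 'v) \<Rightarrow> ('v list \<Rightarrow> 'v) \<Rightarrow> 'v list \<Rightarrow> 'v" where
  "der P F = ins (\<lambda>x. x) F P"

lemma coder_0: "coder 0 P F = der P F"
proof -
  have "ps 0 = (\<lambda>x. x)" by auto
  then show ?thesis by (simp add: coder_def der_def)
qed

lemma mlin_der: "mlin F \<Longrightarrow> mlin P \<Longrightarrow> mlin (der P F)"
  unfolding der_def by (rule mlin_ins) (auto simp: lin_def additive_def)

lemma mlin_der_pow: "mlin F \<Longrightarrow> mlin P \<Longrightarrow> mlin ((der P ^^ j) F)"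
  by (induction j) (auto intro: mlin_der)

lemma vanishes_upto_der: "mlin F \<Longrightarrow> vanishes_upto r F \<Longrightarrow> vanishes_upto q P \<Longrightarrow> vanishes_upto (q + r) (der P F)"
  unfolding der_def by (rule vanishes_upto_ins[OF mlin_madditive])

lemma der_zero [simp]: "der P (\<lambda>w. 0) = (\<lambda>w. 0)"
  by (rule ext) (simp add: der_def)

lemma der_add: "der P (\<lambda>w. F w + F' w) = (\<lambda>w. der P F w + der P F' w)"
  by (rule ext) (simp add: der_def ins_add)

lemma der_lin: "lin h \<Longrightarrow> der P (\<lambda>w. h (F w)) = (\<lambda>w. h (der P F w))"
  by (rule ext) (simp add: der_def additive_ins[OF lin_additive])

lemma lin_sc_id: "lin (sc c)"
  using lin_sc[of "\<lambda>x. x" c] by (simp add: lin_def additive_def)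

lemma der_comb: "der P (\<lambda>w. \<Sum>i\<in>I. sc (c i) (F i w)) = (\<lambda>w. \<Sum>i\<in>I. sc (c i) (der P (F i) w))"
  by (induction I rule: infinite_finite_induct) (auto simp: der_add der_lin[OF lin_sc_id])

lemma der_pow_zero [simp]: "(der P ^^ j) (\<lambda>w. 0) = (\<lambda>w. 0)"
  by (induction j) auto

lemma der_pow_lin: "lin h \<Longrightarrow> (der P ^^ j) (\<lambda>w. h (F w)) = (\<lambda>w. h ((der P ^^ j) F w))"
  by (induction j) (auto simp: der_lin)

lemma der_pow_comb: "(der P ^^ j) (\<lambda>w. \<Sum>i\<in>I. sc (c i) (F i w)) = (\<lambda>w. \<Sum>i\<in>I. sc (c i) ((der P ^^ j) (F i) w))"
  by (induction j) (auto simp: der_comb)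

lemma der_cong: 
  assumes "\<And>v. v \<noteq> [] \<Longrightarrow> length v \<le> n \<Longrightarrow> F v = F' v" "length w \<le> n"
  shows "der P F w = der P F' w"
  unfolding der_def by (rule ins_cong) (use assms in auto)

lemma der_pow_cong:
  assumes "\<And>v. v \<noteq> [] \<Longrightarrow> length v \<le> n \<Longrightarrow> F v = F' v" "length w \<le> n" "w \<noteq> []"
  shows "(der P ^^ j) F w = (der P ^^ j) F' w"
  using assms(2,3)
proof (induction j arbitrary: w)
  case 0
  then show ?case using assms(1) by simp
next
  case (Suc j)
  then show ?case by (auto intro: der_cong)
qed

lemma der_Nil [simp]: "der P F [] = 0"
  by (simp add: der_def)

lemma der_pow_vanish:
  assumes "mlin F" "mlin P" "vanishes_upto 1 P" "length w < j"
  shows "(der P ^^ j) F w = 0"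
proof -
  have "vanishes_upto j (\<lambda>w. (der P ^^ Suc j) F w)" for j
  proof (induction j)
    case 0
    then show ?case by (simp add: vanishes_upto_def)
  next
    case (Suc j)
    have "vanishes_upto (1 + j) (der P ((der P ^^ Suc j) F))"
      by (rule vanishes_upto_der[OF mlin_der_pow[OF assms(1,2)] _ assms(3)]) (use Suc in simp)
    then show ?case by simp
  qed
  from this[of "j - 1"] assms(4) show ?thesis by (cases j) (auto simp: vanishes_upto_def)
qed

text \<open>\<open>F \<circ> exp D\<^sub>P\<close>. If \<open>P\<close> has no component of arity 1, then \<open>D\<^sub>P\<close> shortens words, so the terms with
  \<open>j > length w\<close> vanish.\<close>

definition expd :: "('v list \<Rightarrow> 'v) \<Rightarrow> ('v list \<Rightarrow> 'v) \<Rightarrow> 'v list \<Rightarrow> 'v" where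
  "expd P F w = (\<Sum>j\<le>length w. sc (1 / fact j) ((der P ^^ j) F w))"

lemma expd_eq:
  assumes "mlin F" "mlin P" "vanishes_upto 1 P" "length w \<le> N"
  shows "expd P F w = (\<Sum>j\<le>N. sc (1 / fact j) ((der P ^^ j) F w))"
  unfolding expd_def
  by (rule sum.mono_neutral_left) (use assms der_pow_vanish[OF assms(1-3)] in auto)

lemma expd_Nil [simp]: "expd P F [] = F []"
  by (simp add: expd_def)

lemma expd_cong:
  assumes "\<And>v. v \<noteq> [] \<Longrightarrow> length v \<le> length w \<Longrightarrow> F v = F' v" "w \<noteq> []"
  shows "expd P F w = expd P F' w"
  unfolding expd_def using der_pow_cong[OF assms(1) order_refl assms(2)] by simp

lemma expd_lin: "lin h \<Longrightarrow> expd P (\<lambda>w. h (F w)) w = h (expd P F w)"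
  by (simp add: expd_def der_pow_lin additive.sum[OF lin_additive] lin_def)

lemma expd_zero [simp]: "expd P (\<lambda>w. 0) = (\<lambda>w. 0)"
  by (rule ext) (simp add: expd_def)

lemma expd_singleton:
  assumes "mlin F" "vanishes_upto 1 P"
  shows "expd P F [x] = F [x]"
  using vanishes_uptoD[OF assms(2), of "[x]"] madditive_zero[OF mlin_madditive[OF assms(1)], of "[]" "[]"]
  by (simp add: expd_def der_def)

lemma mlin_expd:
  assumes "mlin F" "mlin P" shows "mlin (expd P F)"
  unfolding mlin_def
proof (intro allI)
  fix us vs
  show "lin (\<lambda>x. expd P F (us @ x # vs))"
    unfolding expd_def by (simp del: sum.atMost_Suc, intro lin_sum lin_sc mlinD mlin_der_pow assms)
qed

text \<open>The binomial theorem in the form that covers both a sum of commuting operators and the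
  interplay of left multiplication and commutator: \<open>f i j l\<close> stands for \<open>i\<close> and \<open>j\<close> applications of
  the two summands and \<open>l\<close> pending applications of their sum.\<close>

lemma binomial_recurrence:
  fixes f :: "nat \<Rightarrow> nat \<Rightarrow> nat \<Rightarrow> 'v"
  assumes "\<And>i j l. f i j (Suc l) = f (Suc i) j l + f i (Suc j) l"
  shows "f i0 j0 n = (\<Sum>i\<le>n. sc (of_nat (n choose i)) (f (i0 + i) (j0 + (n - i)) 0))"
proof (induction n arbitrary: i0 j0)
  case (Suc n)
  let ?g = "\<lambda>m i. f (i0 + i) (j0 + (m - i)) 0"
  have "f i0 j0 (Suc n) = (\<Sum>i\<le>n. sc (of_nat (n choose i)) (?g (Suc n) (Suc i)))
     + (\<Sum>i\<le>n. sc (of_nat (n choose i)) (?g (Suc n) i))"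
    unfolding assms Suc by (intro arg_cong2[of _ _ _ _ "(+)"] sum.cong) (auto simp: Suc_diff_le)
  also have "(\<Sum>i\<le>n. sc (of_nat (n choose i)) (?g (Suc n) i)) =
      (\<Sum>i\<le>Suc n. sc (of_nat (n choose i)) (?g (Suc n) i))"
    by (simp add: binomial_eq_0)
  also have "\<dots> = ?g (Suc n) 0 + (\<Sum>i\<le>n. sc (of_nat (n choose Suc i)) (?g (Suc n) (Suc i)))"
    by (subst sum.atMost_Suc_shift) simp
  finally have "f i0 j0 (Suc n) = ?g (Suc n) 0 +
      (\<Sum>i\<le>n. sc (of_nat (n choose i)) (?g (Suc n) (Suc i)) + sc (of_nat (n choose Suc i)) (?g (Suc n) (Suc i)))"
    by (simp add: sum.distrib algebra_simps)
  also have "\<dots> = (\<Sum>i\<le>Suc n. sc (of_nat (Suc n choose i)) (?g (Suc n) i))"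
    by (simp add: sum.atMost_Suc_shift vs.scale_left_distrib del: sum.atMost_Suc)
  finally show ?case .
qed simp

text \<open>The functional equation of the exponential series. Dividing the binomial theorem by \<open>n!\<close> turns it
  into a Cauchy product, and the vanishing assumptions make the triangle and the rectangle of indices
  give the same sum.\<close>

lemma exponential_product:
  fixes f :: "nat \<Rightarrow> nat \<Rightarrow> nat \<Rightarrow> 'v"
  assumes rec: "\<And>i j l. f i j (Suc l) = f (Suc i) j l + f i (Suc j) l"
    and i: "\<And>i j. i > a \<Longrightarrow> f i j 0 = 0" and j: "\<And>i j. j > b \<Longrightarrow> f i j 0 = 0" and N: "a + b \<le> N"
  shows "(\<Sum>n\<le>N. sc (1 / fact n) (f 0 0 n)) =
    (\<Sum>i\<le>a. sc (1 / fact i) (\<Sum>j\<le>b. sc (1 / fact j) (f i j 0)))"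
proof -
  let ?h = "\<lambda>i j. sc (1 / fact i) (sc (1 / fact j) (f i j 0))"
  have "sc (1 / fact n) (f 0 0 n) = (\<Sum>i\<le>n. ?h i (n - i))" for n
  proof -
    have "f 0 0 n = (\<Sum>i\<le>n. sc (of_nat (n choose i)) (f i (n - i) 0))"
      using binomial_recurrence[of f, OF rec, of 0 0 n] by simp
    then have "sc (1 / fact n) (f 0 0 n) = (\<Sum>i\<le>n. sc (1 / fact n * of_nat (n choose i)) (f i (n - i) 0))"
      by (simp add: vs.scale_sum_right)
    also have "\<dots> = (\<Sum>i\<le>n. ?h i (n - i))"
      by (intro sum.cong refl) (simp add: binomial_fact)
    finally show ?thesis .
  qed
  then have "(\<Sum>n\<le>N. sc (1 / fact n) (f 0 0 n)) = (\<Sum>n\<le>N. \<Sum>i\<le>n. ?h i (n - i))" by simp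
  also have "\<dots> = (\<Sum>(i, j)\<in>{(i, j). i + j \<le> N}. ?h i j)"
    by (rule sum.triangle_reindex_eq[symmetric])
  also have "\<dots> = (\<Sum>(i, j)\<in>{..a} \<times> {..b}. ?h i j)"
  proof (rule sum.mono_neutral_right)
    have "{(i, j). i + j \<le> N} \<subseteq> {..N} \<times> {..N}" by auto
    then show "finite {(i, j). i + j \<le> N}" by (rule finite_subset) simp
    show "{..a} \<times> {..b} \<subseteq> {(i, j). i + j \<le> N}" using N by auto
    show "\<forall>p\<in>{(i, j). i + j \<le> N} - {..a} \<times> {..b}. (case p of (i, j) \<Rightarrow> ?h i j) = 0"
    proof -
      have "f x y 0 = 0" if "\<not> (x \<le> a \<and> y \<le> b)" for x y
        using that i[of x y] j[of y x] by (auto simp: not_le)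
      then show ?thesis by (auto, blast+)
    qed
  qed
  also have "\<dots> = (\<Sum>i\<le>a. \<Sum>j\<le>b. ?h i j)" by (simp add: sum.cartesian_product)
  finally show ?thesis by (simp add: vs.scale_sum_right)
qed

definition mlin2 :: "('v list \<Rightarrow> 'v list \<Rightarrow> 'v) \<Rightarrow> bool" where
  "mlin2 K \<longleftrightarrow> (\<forall>v. mlin (\<lambda>u. K u v)) \<and> (\<forall>u. mlin (K u))"

lemma der_swap: "der P (\<lambda>v. der P (\<lambda>u. K u v) u) v = der P (\<lambda>u. der P (K u) v) u"
  unfolding der_def by (rule ins_swap)

lemma der_pow_swap: "der P (\<lambda>v. (der P ^^ i) (\<lambda>u. K u v) u) v = (der P ^^ i) (\<lambda>u. der P (K u) v) u"
proof (induction i arbitrary: u)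
  case (Suc i)
  have "der P (\<lambda>v. (der P ^^ Suc i) (\<lambda>u. K u v) u) v = der P (\<lambda>v. der P (\<lambda>u. (der P ^^ i) (\<lambda>u. K u v) u) u) v"
    by simp
  also have "\<dots> = der P (\<lambda>u. der P (\<lambda>v. (der P ^^ i) (\<lambda>u. K u v) u) v) u" by (rule der_swap)
  also have "\<dots> = (der P ^^ Suc i) (\<lambda>u. der P (K u) v) u" by (simp add: Suc)
  finally show ?case .
qed simp

lemma mlin_der_param: "(\<And>v. mlin (\<lambda>u. K u v)) \<Longrightarrow> mlin (\<lambda>u. der P (K u) v)"
  unfolding mlin_def der_def by (auto intro: lin_ins_param)

lemma mlin_der_pow_param: "(\<And>v. mlin (\<lambda>u. K u v)) \<Longrightarrow> mlin (\<lambda>u. (der P ^^ j) (K u) v)"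
proof (induction j arbitrary: v)
  case (Suc j)
  then show ?case using mlin_der_param[of "\<lambda>u. (der P ^^ j) (K u)" P v] by simp
qed simp

text \<open>The exponential of a coderivation is multiplicative for the coproduct,
  \<open>\<Delta> exp D = (exp D \<otimes> exp D) \<Delta>\<close>: the two summands of the co-Leibniz rule commute.\<close>

lemma expd_cuts:
  assumes K: "mlin2 K" and P: "mlin P" "vanishes_upto 1 P"
  shows "expd P (cuts K) w = cuts (\<lambda>u v. expd P (\<lambda>u. expd P (K u) v) u) w"
proof -
  \<comment> \<open>\<open>R i j\<close> is \<open>K\<close> after \<open>i\<close> derivations of the left and \<open>j\<close> of the right tensor factor.\<close>
  define R where "R i j u v = (der P ^^ i) (\<lambda>u. (der P ^^ j) (K u) v) u" for i j u v
  define f where "f i j l = (der P ^^ l) (cuts (R i j)) w" for i j l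
  let ?n = "length w"
  have K1: "mlin (\<lambda>u. K u v)" and K2: "mlin (K u)" for u v using K by (auto simp: mlin2_def)
  have DR: "der P (cuts (R i j)) = (\<lambda>w. cuts (R (Suc i) j) w + cuts (R i (Suc j)) w)" for i j
  proof
    fix w
    have "der P (cuts (R i j)) w = cuts (\<lambda>u v. der P (\<lambda>u. R i j u v) u) w + cuts (\<lambda>u v. der P (R i j u) v) w"
      unfolding der_def ins_cuts by simp
    also have "(\<lambda>u v. der P (\<lambda>u. R i j u v) u) = R (Suc i) j"
      by (simp add: R_def fun_eq_iff)
    also have "(\<lambda>u v. der P (R i j u) v) = R i (Suc j)"
    proof (intro ext)
      fix u v
      have "R i j u = (\<lambda>v. (der P ^^ i) (\<lambda>u. (der P ^^ j) (K u) v) u)" by (simp add: R_def fun_eq_iff)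
      then have "der P (R i j u) v = der P (\<lambda>v. (der P ^^ i) (\<lambda>u. (der P ^^ j) (K u) v) u) v" by simp
      also have "\<dots> = R i (Suc j) u v"
        unfolding der_pow_swap by (simp add: R_def)
      finally show "der P (R i j u) v = R i (Suc j) u v" .
    qed
    finally show "der P (cuts (R i j)) w = cuts (R (Suc i) j) w + cuts (R i (Suc j)) w" .
  qed
  have der_pow_add: "(der P ^^ l) (\<lambda>w. F w + F' w) = (\<lambda>w. (der P ^^ l) F w + (der P ^^ l) F' w)" for l F F'
    by (induction l) (simp_all add: der_add)
  have rec: "f i j (Suc l) = f (Suc i) j l + f i (Suc j) l" for i j l
    by (simp only: f_def funpow_Suc_right o_apply DR der_pow_add)
  have R0: "R i j u v = 0" if "length u < i \<or> length v < j" for i j u v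
  proof (cases "length v < j")
    case True
    then have "(der P ^^ j) (K u) v = 0" for u by (rule der_pow_vanish[OF K2 P])
    then show ?thesis by (simp add: R_def)
  next
    case False
    then show ?thesis unfolding R_def
      by (intro der_pow_vanish[OF mlin_der_pow_param[OF K1] P]) (use that in auto)
  qed
  have f0: "f i j 0 = 0" if "?n < i \<or> ?n < j" for i j
  proof -
    have "cuts (R i j) w = cuts (\<lambda>u v. 0) w"
      by (rule cuts_cong, rule R0) (use that in auto)
    then show ?thesis by (simp add: f_def)
  qed
  have mK: "mlin (cuts K)"
    unfolding mlin_def using K1 K2 by (auto intro!: lin_cuts_arg simp: mlin_def)
  have "expd P (cuts K) w = (\<Sum>n\<le>?n + ?n. sc (1 / fact n) (f 0 0 n))"
    unfolding f_def R_def by (subst expd_eq[OF mK P, of w "?n + ?n"]) simp_all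
  also have "\<dots> = (\<Sum>i\<le>?n. sc (1 / fact i) (\<Sum>j\<le>?n. sc (1 / fact j) (f i j 0)))"
    by (rule exponential_product[of f, OF rec]) (use f0 in auto)
  also have "\<dots> = cuts (\<lambda>u v. \<Sum>i\<le>?n. sc (1 / fact i) (\<Sum>j\<le>?n. sc (1 / fact j) (R i j u v))) w"
    by (simp only: f_def funpow_0 additive_cuts[OF additive_sc] cuts_sum[symmetric])
  also have "\<dots> = cuts (\<lambda>u v. expd P (\<lambda>u. expd P (K u) v) u) w"
  proof (rule cuts_cong)
    fix u v assume uv: "u @ v = w"
    then have "expd P (K u') v = (\<Sum>j\<le>?n. sc (1 / fact j) ((der P ^^ j) (K u') v))" for u'
      by (intro expd_eq[OF K2 P]) auto
    moreover have "mlin (\<lambda>u'. \<Sum>j\<le>?n. sc (1 / fact j) ((der P ^^ j) (K u') v))"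
      using mlin_der_pow_param[OF K1] unfolding mlin_def by (auto intro!: lin_sum lin_sc)
    ultimately have "expd P (\<lambda>u. expd P (K u) v) u =
      (\<Sum>i\<le>?n. sc (1 / fact i) ((der P ^^ i) (\<lambda>u'. \<Sum>j\<le>?n. sc (1 / fact j) ((der P ^^ j) (K u') v)) u))"
      using expd_eq[OF _ P, of _ u ?n] uv by auto
    then show "(\<Sum>i\<le>?n. sc (1 / fact i) (\<Sum>j\<le>?n. sc (1 / fact j) (R i j u v))) = expd P (\<lambda>u. expd P (K u) v) u"
      by (simp add: der_pow_comb R_def)
  qed
  finally show ?thesis .
qed

text \<open>The operator \<open>\<Theta>\<close> is composition with the coalgebra morphism whose corestriction is \<open>\<phi>\<close>, stated by
  splitting off the first block. The recursion determines \<open>\<Theta>\<close> on multilinear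
  functionals.\<close>

definition is_hom :: "('v list \<Rightarrow> 'v) \<Rightarrow> (('v list \<Rightarrow> 'v) \<Rightarrow> 'v list \<Rightarrow> 'v) \<Rightarrow> bool" where
  "is_hom \<phi> \<Theta> \<longleftrightarrow> (\<forall>X. mlin X \<longrightarrow> \<Theta> X [] = X [] \<and>
     (\<forall>x w. \<Theta> X (x # w) = cuts (\<lambda>u v. \<Theta> (\<lambda>v. X (\<phi> (x # u) # v)) v) w))"

lemma is_hom_unique:
  assumes "is_hom \<phi> \<Theta>" "is_hom \<phi> \<Theta>'" "mlin X"
  shows "\<Theta> X w = \<Theta>' X w"
  using assms(3)
proof (induction w arbitrary: X rule: length_induct)
  case (1 w)
  show ?case
  proof (cases w)
    case Nil
    then show ?thesis using assms(1,2) 1 by (simp add: is_hom_def)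
  next
    case (Cons x w')
    have "cuts (\<lambda>u v. \<Theta> (\<lambda>v. X (\<phi> (x # u) # v)) v) w' = cuts (\<lambda>u v. \<Theta>' (\<lambda>v. X (\<phi> (x # u) # v)) v) w'"
      by (rule cuts_cong) (use 1 Cons mlin_Cons in auto)
    then show ?thesis using assms(1,2) 1(2) by (simp add: is_hom_def Cons)
  qed
qed

lemma mlin_proj1: "mlin proj1" by (rule sharrD(2)[OF proj1_sharr])

text \<open>The counit axiom in the form needed to feed a functional into \<open>expd_cuts\<close>: reading the first letter through
  the projection selects the cut after that letter.\<close>

lemma cuts_proj1:
  assumes "mlin X" "w \<noteq> []"
  shows "cuts (\<lambda>u v. X (proj1 u # v)) w = X w"
proof -
  have 0: "X (0 # v) = 0" for v using madditive_zero[OF mlin_madditive[OF assms(1)], of "[]"] by simp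
  obtain x w' where w: "w = x # w'" using assms(2) by (cases w) auto
  have "cuts (\<lambda>u v. X (proj1 (x # u) # v)) w' = cuts (\<lambda>u v. if u = [] then X (x # v) else 0) w'"
    by (rule cuts_cong) (simp add: proj1_def 0)
  also have "\<dots> = X (x # w')" by (cases w') simp_all
  finally show ?thesis by (simp add: w proj1_def 0)
qed

lemma expd_is_hom:
  assumes P: "mlin P" "vanishes_upto 1 P"
  shows "is_hom (expd P proj1) (expd P)"
  unfolding is_hom_def
proof (intro allI impI conjI)
  fix X x w assume X: "mlin X"
  have 0: "X (0 # v) = 0" for v using madditive_zero[OF mlin_madditive[OF X], of "[]"] by simp
  let ?K = "\<lambda>u v. X (proj1 u # v)"
  have K: "mlin2 ?K"
    unfolding mlin2_def
  proof (intro conjI allI)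
    show "mlin (\<lambda>u. X (proj1 u # v))" for v
      unfolding mlin_def using lin_comp[OF mlin_hd[OF X] mlinD[OF mlin_proj1]] by blast
  qed (rule mlin_Cons[OF X])
  have l: "lin (\<lambda>y. expd P (\<lambda>v. X (y # v)) v)" for v
    unfolding expd_def
  proof (intro lin_sum lin_sc)
    fix j
    have "lin (\<lambda>y. (der P ^^ j) (\<lambda>v. X (y # v)) v)" for v
    proof (induction j arbitrary: v)
      case 0
      show ?case using mlin_hd[OF X] by simp
    next
      case (Suc j)
      have "lin (\<lambda>y. der P ((der P ^^ j) (\<lambda>v. X (y # v))) v)"
        unfolding der_def[of P "(der P ^^ j) (\<lambda>v. X (y # v))" for y] by (rule lin_ins_param[OF Suc])
      then show ?case by simp
    qed
    then show "lin (\<lambda>y. (der P ^^ j) (\<lambda>v. X (y # v)) v)" .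
  qed
  have "expd P X (x # w) = expd P (cuts ?K) (x # w)"
    by (rule expd_cong) (simp_all add: cuts_proj1[OF X])
  also have "\<dots> = cuts (\<lambda>u v. expd P (\<lambda>u. expd P (?K u) v) u) (x # w)"
    by (rule expd_cuts[OF K P])
  also have "\<dots> = cuts (\<lambda>u v. expd P (\<lambda>v. X (expd P proj1 u # v)) v) (x # w)"
    by (simp only: expd_lin[OF l])
  also have "\<dots> = cuts (\<lambda>u v. expd P (\<lambda>v. X (expd P proj1 (x # u) # v)) v) w"
    by (simp add: proj1_def 0)
  finally show "expd P X (x # w) = cuts (\<lambda>u v. expd P (\<lambda>v. X (expd P proj1 (x # u) # v)) v) w" .
qed simp

end

section \<open>Logarithms and composition\<close>

lemma blocks_Nil: "blocks [] = {[]}"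
  by (auto simp: blocks_def) (metis concat.simps(1) list.exhaust list.set_intros(1) concat.simps(2) append_is_Nil_conv)

lemma blocks_Cons: "blocks (x # w) = (\<Union>i\<le>length w. (#) (x # take i w) ` blocks (drop i w))"
proof (intro equalityI subsetI)
  fix bs assume "bs \<in> blocks (x # w)"
  then have bs: "concat bs = x # w" "[] \<notin> set bs" by (auto simp: blocks_def)
  then obtain b bs' where b: "bs = b # bs'" by (cases bs) auto
  with bs obtain u where u: "b = x # u" "u @ concat bs' = w" by (cases b) auto
  then have "bs = (x # take (length u) w) # bs'" "bs' \<in> blocks (drop (length u) w)" "length u \<le> length w"
    using b bs by (auto simp: blocks_def)
  then show "bs \<in> (\<Union>i\<le>length w. (#) (x # take i w) ` blocks (drop i w))" by auto
qed (auto simp: blocks_def)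

lemma finite_blocks: "finite (blocks w)"
proof (induction w rule: length_induct)
  case (1 w)
  then show ?case by (cases w) (auto simp: blocks_Nil blocks_Cons)
qed

context fd_graded_comm_algebra
begin

lemma blocks_sum_is_hom: "is_hom \<phi> (\<lambda>X w. \<Sum>bs\<in>blocks w. X (map \<phi> bs))"
  unfolding is_hom_def
proof (intro allI impI conjI)
  fix X :: "'v list \<Rightarrow> 'v" and x w
  show "(\<Sum>bs\<in>blocks []. X (map \<phi> bs)) = X []" by (simp add: blocks_Nil)
  have "(\<Sum>bs\<in>blocks (x # w). X (map \<phi> bs)) =
      (\<Sum>i\<le>length w. \<Sum>bs\<in>(#) (x # take i w) ` blocks (drop i w). X (map \<phi> bs))"
    unfolding blocks_Cons
  proof (rule sum.UNION_disjoint)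
    show "\<forall>i\<in>{..length w}. \<forall>j\<in>{..length w}. i \<noteq> j \<longrightarrow>
       (#) (x # take i w) ` blocks (drop i w) \<inter> (#) (x # take j w) ` blocks (drop j w) = {}"
    proof (intro ballI impI)
      fix i j assume ij: "i \<in> {..length w}" "j \<in> {..length w}" "i \<noteq> j"
      then have "length (take i w) \<noteq> length (take j w)" by simp
      then have "take i w \<noteq> take j w" by metis
      then show "(#) (x # take i w) ` blocks (drop i w) \<inter> (#) (x # take j w) ` blocks (drop j w) = {}"
        by auto
    qed
  qed (auto simp: finite_blocks)
  also have "\<dots> = cuts (\<lambda>u v. \<Sum>bs\<in>blocks v. X (\<phi> (x # u) # map \<phi> bs)) w"
    by (simp add: cuts_eq_sum sum.reindex)
  finally show "(\<Sum>bs\<in>blocks (x # w). X (map \<phi> bs)) =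
     cuts (\<lambda>u v. \<Sum>bs\<in>blocks v. X (\<phi> (x # u) # map \<phi> bs)) w" .
qed

text \<open>Suspensions of the gauge parameters \<open>p \<in> F\<^sup>1 g\<^sup>0\<close>.\<close>

definition gauge_gen :: "('v list \<Rightarrow> 'v) set" where "gauge_gen = {P \<in> sharr 0. vanishes_upto 1 P}"

lemma gauge_genD: "P \<in> gauge_gen \<Longrightarrow> P \<in> sharr 0" "P \<in> gauge_gen \<Longrightarrow> vanishes_upto 1 P" "P \<in> gauge_gen \<Longrightarrow> mlin P" "P \<in> gauge_gen \<Longrightarrow> P [] = 0"
  by (auto simp: gauge_gen_def sharr_def)

lemma der_sharr: "F \<in> sharr d \<Longrightarrow> P \<in> sharr 0 \<Longrightarrow> der P F \<in> sharr d"
  using coder_sharr[of F d P 0] by (simp add: coder_0)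

lemma der_pow_sharr: "F \<in> sharr d \<Longrightarrow> P \<in> sharr 0 \<Longrightarrow> (der P ^^ j) F \<in> sharr d"
  by (induction j) (auto intro: der_sharr)

lemma expd_sharr:
  assumes "F \<in> sharr d" "P \<in> sharr 0"
  shows "expd P F \<in> sharr d"
proof (rule sharr_by_length)
  fix n
  show "\<exists>F'\<in>sharr d. \<forall>xs. length xs = n \<longrightarrow> expd P F xs = F' xs"
    by (rule bexI[of _ "\<lambda>xs. \<Sum>j\<le>n. sc (1 / fact j) ((der P ^^ j) F xs)"])
       (auto simp: expd_def intro!: sharr_sum sharr_sc der_pow_sharr assms)
qed

lemma expd_lin_param:
  assumes "\<And>w. lin (\<lambda>y. K y w)"
  shows "lin (\<lambda>y. expd P (K y) w)"
  unfolding expd_def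
proof (intro lin_sum lin_sc)
  fix j
  have "lin (\<lambda>y. (der P ^^ j) (K y) w)" for w
  proof (induction j arbitrary: w)
    case (Suc j)
    have "lin (\<lambda>y. der P ((der P ^^ j) (K y)) w)"
      unfolding der_def[of P "(der P ^^ j) (K y)" for y] by (rule lin_ins_param[OF Suc])
    then show ?case by simp
  qed (simp add: assms)
  then show "lin (\<lambda>y. (der P ^^ j) (K y) w)" .
qed

lemma expd_comp_is_hom:
  assumes P: "P \<in> gauge_gen" and Q: "Q \<in> gauge_gen"
  shows "is_hom (expd Q (expd P proj1)) (\<lambda>X. expd Q (expd P X))"
  unfolding is_hom_def
proof (intro allI impI conjI)
  fix X x w assume X: "mlin X"
  have 0: "X (0 # v) = 0" for v using madditive_zero[OF mlin_madditive[OF X], of "[]"] by simp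
  let ?K = "\<lambda>u v. expd P (\<lambda>v. X (expd P proj1 u # v)) v"
  have l1: "lin (\<lambda>y. expd P (\<lambda>v. X (y # v)) v)" for v
    by (rule expd_lin_param[OF mlin_hd[OF X]])
  have l2: "lin (\<lambda>y. expd Q (\<lambda>v. expd P (\<lambda>v. X (y # v)) v) v)" for v
    by (rule expd_lin_param[OF l1])
  have mE: "mlin (expd P proj1)" by (rule mlin_expd[OF mlin_proj1 gauge_genD(3)[OF P]])
  have K: "mlin2 ?K"
    unfolding mlin2_def
  proof (intro conjI allI)
    show "mlin (\<lambda>u. ?K u v)" for v
      unfolding mlin_def using lin_comp[OF l1 mlinD[OF mE]] by blast
    show "mlin (?K u)" for u
      by (rule mlin_expd[OF mlin_Cons[OF X] gauge_genD(3)[OF P]])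
  qed
  have "expd Q (expd P X) (x # w) = expd Q (cuts ?K) (x # w)"
  proof (rule expd_cong)
    fix v :: "'v list" assume "v \<noteq> []"
    then obtain y v' where "v = y # v'" by (cases v) auto
    then show "expd P X v = cuts ?K v"
      using expd_is_hom[OF gauge_genD(3,2)[OF P], unfolded is_hom_def] X by (simp add: proj1_def 0)
  qed simp
  also have "\<dots> = cuts (\<lambda>u v. expd Q (\<lambda>u. expd Q (?K u) v) u) (x # w)"
    by (rule expd_cuts[OF K gauge_genD(3,2)[OF Q]])
  also have "\<dots> = cuts (\<lambda>u v. expd Q (\<lambda>v. expd P (\<lambda>v. X (expd Q (expd P proj1) u # v)) v) v) (x # w)"
    by (simp only: expd_lin[OF l2])
  also have "\<dots> = cuts (\<lambda>u v. expd Q (\<lambda>v. expd P (\<lambda>v. X (expd Q (expd P proj1) (x # u) # v)) v) v) w"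
    by (simp add: proj1_def 0)
  finally show "expd Q (expd P X) (x # w) =
    cuts (\<lambda>u v. expd Q (expd P (\<lambda>v. X (expd Q (expd P proj1) (x # u) # v))) v) w" .
qed simp

lemma ins_diff2: "madditive F \<Longrightarrow> ins s F (\<lambda>w. G w - G' w) w = ins s F G w - ins s F G' w"
  using ins_add2[of F s "\<lambda>w. G w - G' w" G' w] by simp

lemma der_diff: "der P (\<lambda>w. F w - F' w) w = der P F w - der P F' w"
  using der_add[of P "\<lambda>w. F w - F' w" F'] by (simp add: fun_eq_iff algebra_simps)

lemma mlin_diff: "mlin F \<Longrightarrow> mlin F' \<Longrightarrow> mlin (\<lambda>w. F w - F' w)"
  using lin_add[OF _ lin_sc[of _ "-1"]] unfolding mlin_def by fastforce

lemma vanishes_upto_proj1: "vanishes_upto 0 proj1" by (simp add: vanishes_upto_def proj1_def)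

lemma vanishes_upto_der_pow_proj1: "P \<in> gauge_gen \<Longrightarrow> vanishes_upto j ((der P ^^ j) proj1)"
proof (induction j)
  case (Suc j)
  then show ?case
    using vanishes_upto_der[OF mlin_der_pow[OF mlin_proj1] _ gauge_genD(2), of P j] gauge_genD(3) by simp
qed (simp add: vanishes_upto_proj1)

text \<open>The corestriction of \<open>exp D\<^sub>P\<close> is the projection plus \<open>P\<close> plus, for \<open>j \<ge> 2\<close>, terms of order \<open>j\<close>. In arity \<open>n + 1\<close>
  the latter involve only components of \<open>P\<close> of arity at most \<open>n\<close>, because each factor has arity at
  least 2. So a change of \<open>P\<close> in arity \<open>n + 1\<close> is seen unaltered.\<close>

lemma expd_proj1_diff:
  assumes P: "P \<in> gauge_gen" and P': "P' \<in> gauge_gen" and eq: "vanishes_upto n (\<lambda>w. P' w - P w)" and w: "length w \<le> Suc n"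
  shows "expd P' proj1 w - expd P proj1 w = P' w - P w"
proof -
  define Y where "Y P j = (der P ^^ j) proj1" for P j
  have mY: "mlin (Y P j)" "mlin (Y P' j)" for j
    unfolding Y_def by (rule mlin_der_pow[OF mlin_proj1 gauge_genD(3)[OF P]], rule mlin_der_pow[OF mlin_proj1 gauge_genD(3)[OF P']])
  \<comment> \<open>Change one factor at a time: the inner one, and the outermost one.\<close>
  have step: "Y P' (Suc j) w - Y P (Suc j) w =
      der P' (\<lambda>w. Y P' j w - Y P j w) w + der (\<lambda>w. P' w - P w) (Y P j) w" for j w
    unfolding der_diff by (simp add: Y_def[of _ "Suc j"]) (simp add: der_def Y_def[symmetric] ins_diff2[OF mlin_madditive[OF mY(1)]])
  have first: "vanishes_upto (Suc n) (der P' (\<lambda>w. Y P' j w - Y P j w))" if "vanishes_upto n (\<lambda>w. Y P' j w - Y P j w)" for j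
    using vanishes_upto_der[OF mlin_diff[OF mY(2,1)] that gauge_genD(2)[OF P']] by simp
  have second: "vanishes_upto (n + j) (der (\<lambda>w. P' w - P w) (Y P j))" for j
    using vanishes_upto_der[OF mY(1) _ eq] vanishes_upto_der_pow_proj1[OF P] by (simp add: Y_def)
  have C: "vanishes_upto n (\<lambda>w. Y P' j w - Y P j w)" for j
  proof (induction j)
    case 0
    show ?case by (simp add: Y_def vanishes_upto_def)
  next
    case (Suc j)
    then show ?case using first[OF Suc] second[of j] unfolding step by (simp add: vanishes_upto_def)
  qed
  have Y2: "Y P' (Suc (Suc j)) w = Y P (Suc (Suc j)) w" for j
    using step[of "Suc j" w] vanishes_uptoD[OF first[OF C] w, of "Suc j"] vanishes_uptoD[OF second[of "Suc j"], of w] w by simp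
  have Y1: "Y P' (Suc 0) w = P' w" "Y P (Suc 0) w = P w"
    using coder_proj1[of P' 0] coder_proj1[of P 0] gauge_genD(4)[OF P] gauge_genD(4)[OF P'] by (simp_all add: Y_def coder_0)
  have diff: "Y P' j w - Y P j w = (if j = 1 then P' w - P w else 0)" for j
  proof (cases j)
    case (Suc i)
    then show ?thesis using Y1 Y2[of "i - 1"] by (cases i) auto
  qed (simp add: Y_def)
  have "expd P' proj1 w - expd P proj1 w = (\<Sum>j\<le>length w. sc (1 / fact j) (Y P' j w - Y P j w))"
    by (simp add: expd_def Y_def sum_subtractf vs.scale_right_diff_distrib)
  also have "\<dots> = (\<Sum>j\<le>length w. if j = 1 then P' w - P w else 0)"
    by (rule sum.cong) (simp_all add: diff)
  also have "\<dots> = P' w - P w"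
    using gauge_genD(4)[OF P] gauge_genD(4)[OF P'] by (cases "w = []") (simp_all add: Suc_le_eq)
  finally show ?thesis .
qed

text \<open>By \<open>expd_proj1_diff\<close> the component of the logarithm in arity \<open>n + 1\<close> has to be the defect of the
  exponential of the components found so far. It is a Harrison cochain automatically, as a difference
  of two of them, so no formula for the logarithm is required.\<close>

lemma exists_log:
  assumes \<phi>: "\<phi> \<in> sharr 0" and id: "\<And>x. \<phi> [x] = x"
  shows "\<exists>P\<in>gauge_gen. expd P proj1 = \<phi>"
proof -
  \<comment> \<open>Successive approximations: the defect in the next arity is added to the exponent.\<close>
  define Pn where "Pn = rec_nat (\<lambda>w. 0)
    (\<lambda>n P w. P w + (if length w = Suc n then \<phi> w - expd P proj1 w else (0 :: 'v)))"
  have Pn0: "Pn 0 = (\<lambda>w. 0)" by (simp add: Pn_def)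
  have PnS: "Pn (Suc n) = (\<lambda>w. Pn n w + (if length w = Suc n then \<phi> w - expd (Pn n) proj1 w else 0))" for n
    unfolding Pn_def by simp
  have E1: "expd P proj1 [x] = x" if "P \<in> gauge_gen" for P x
    using expd_singleton[OF mlin_proj1 gauge_genD(2)[OF that]] by (simp add: proj1_def)
  have inv: "Pn n \<in> gauge_gen \<and> (\<forall>w. length w \<le> n \<longrightarrow> expd (Pn n) proj1 w = \<phi> w)" for n
  proof (induction n)
    case 0
    have "(\<lambda>w. 0) \<in> gauge_gen" by (simp add: gauge_gen_def sharr_zero vanishes_upto_def)
    then show ?case using sharrD(1)[OF \<phi>] by (simp add: Pn0 proj1_def)
  next
    case (Suc n)
    then have gauge_gen: "Pn n \<in> gauge_gen" and eq: "\<And>w. length w \<le> n \<Longrightarrow> expd (Pn n) proj1 w = \<phi> w" by auto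
    have "(\<lambda>w. if length w = Suc n then \<phi> w - expd (Pn n) proj1 w else 0) \<in> sharr 0"
      by (rule sharr_restrict_length[of _ _ "\<lambda>l. l = Suc n"]) (rule sharr_diff[OF \<phi> expd_sharr[OF proj1_sharr gauge_genD(1)[OF gauge_gen]]])
    then have sharr: "Pn (Suc n) \<in> sharr 0"
      unfolding PnS by (rule sharr_add[OF gauge_genD(1)[OF gauge_gen]])
    have "vanishes_upto 1 (Pn (Suc n))"
      unfolding vanishes_upto_def
    proof (intro allI impI)
      fix xs :: "'v list" assume "length xs \<le> 1"
      then consider "xs = []" | x where "xs = [x]" by (cases xs) auto
      then show "Pn (Suc n) xs = 0"
      proof cases
        case 2
        have "Pn (Suc n) [x] = Pn n [x] + (if length [x] = Suc n then 0 else 0)"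
          by (simp only: PnS E1[OF gauge_gen] id diff_self)
        then show ?thesis using vanishes_uptoD[OF gauge_genD(2)[OF gauge_gen], of xs] 2 by simp
      qed (use vanishes_uptoD[OF gauge_genD(2)[OF gauge_gen], of xs] in \<open>simp add: PnS\<close>)
    qed
    with sharr have GP': "Pn (Suc n) \<in> gauge_gen" by (simp add: gauge_gen_def)
    have "expd (Pn (Suc n)) proj1 w = \<phi> w" if "length w \<le> Suc n" for w
    proof -
      have "expd (Pn (Suc n)) proj1 w - expd (Pn n) proj1 w = Pn (Suc n) w - Pn n w"
        by (rule expd_proj1_diff[OF gauge_gen GP' _ that]) (simp add: vanishes_upto_def PnS)
      then show ?thesis using eq[of w] that by (auto simp: PnS algebra_simps split: if_splits)
    qed
    with GP' show ?case by blast
  qed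
  have stable: "Pn (length w + k) w = Pn (length w) w" for w k
    by (induction k) (simp_all add: PnS)
  define P where "P w = Pn (length w) w" for w
  have P: "P \<in> gauge_gen"
    unfolding gauge_gen_def
  proof (intro CollectI conjI)
    show "P \<in> sharr 0"
      by (rule sharr_by_length) (use inv gauge_genD(1) in \<open>auto simp: P_def\<close>)
    show "vanishes_upto 1 P"
      using vanishes_uptoD[OF gauge_genD(2)] inv by (auto simp: vanishes_upto_def P_def)
  qed
  have "expd P proj1 w = \<phi> w" for w
  proof -
    have eq: "P v = Pn (length w) v" if "length v \<le> length w" for v
      using stable[of v "length w - length v"] that by (simp add: P_def)
    have "expd P proj1 w - expd (Pn (length w)) proj1 w = P w - Pn (length w) w"
      by (rule expd_proj1_diff[of _ _ "length w"]) (use inv P eq in \<open>auto simp: vanishes_upto_def\<close>)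
    then show ?thesis using eq[of w] inv[of "length w"] by auto
  qed
  with P show ?thesis by blast
qed

text \<open>The product of two exponentials is a coalgebra morphism with a Harrison corestriction; take the
  logarithm of the latter, and use that a coalgebra morphism is determined by its corestriction.\<close>

lemma expd_comp:
  assumes P: "P \<in> gauge_gen" and Q: "Q \<in> gauge_gen"
  shows "\<exists>R\<in>gauge_gen. \<forall>X. mlin X \<longrightarrow> expd R X = expd Q (expd P X)"
proof -
  have "expd Q (expd P proj1) [x] = x" for x
    using expd_singleton[OF mlin_expd[OF mlin_proj1 gauge_genD(3)[OF P]] gauge_genD(2)[OF Q]] expd_singleton[OF mlin_proj1 gauge_genD(2)[OF P]]
    by (simp add: proj1_def)
  then obtain R where R: "R \<in> gauge_gen" "expd R proj1 = expd Q (expd P proj1)"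
    using exists_log[OF expd_sharr[OF expd_sharr[OF proj1_sharr gauge_genD(1)[OF P]] gauge_genD(1)[OF Q]]] by blast
  have "expd R X w = expd Q (expd P X) w" if "mlin X" for X w
    using is_hom_unique[OF _ expd_comp_is_hom[OF P Q] that] expd_is_hom[OF gauge_genD(3,2)[OF R(1)]] by (simp add: R(2))
  with R(1) show ?thesis by blast
qed

lemma gauge_gen_uminus: "P \<in> gauge_gen \<Longrightarrow> (\<lambda>w. - P w) \<in> gauge_gen"
  by (auto simp: gauge_gen_def vanishes_upto_def intro: sharr_uminus)

text \<open>Here the sum in \<open>exponential_product\<close> is that of \<open>- D\<^sub>P\<close> and \<open>D\<^sub>P\<close>, so only the term of order 0
  survives.\<close>

lemma expd_inverse:
  assumes P: "P \<in> gauge_gen" and F: "mlin F"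
  shows "expd (\<lambda>w. - P w) (expd P F) = F"
proof
  fix w :: "'v list"
  let ?P = "\<lambda>w. - P w" and ?n = "length w"
  note P1 = gauge_genD(3,2)[OF P] and P2 = gauge_genD(3,2)[OF gauge_gen_uminus[OF P]]
  have Dm: "der ?P X = (\<lambda>w. - der P X w)" if "mlin X" for X
  proof
    fix w
    show "der ?P X w = - der P X w"
      using ins_diff2[OF mlin_madditive[OF that], of "\<lambda>x. x" "\<lambda>_. 0" P w]
      by (simp add: der_def ins_zero2[OF mlin_madditive[OF that]])
  qed
  have Dneg: "der P (\<lambda>w. sc c (X w)) = (\<lambda>w. sc c (der P X w))" for c X by (rule der_lin[OF lin_sc_id])
  have Dm_pow: "(der ?P ^^ i) X = (\<lambda>w. sc ((-1) ^ i) ((der P ^^ i) X w))" if X: "mlin X" for X i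
  proof (induction i)
    case (Suc i)
    have "mlin (\<lambda>w. sc ((-1) ^ i) ((der P ^^ i) X w))"
      using mlin_der_pow[OF X P1(1)] lin_sc unfolding mlin_def by blast
    from Dm[OF this] show ?case by (simp add: Suc Dneg)
  qed simp
  \<comment> \<open>The sum of the two operators \<open>- D\<close> and \<open>D\<close> is zero, so pending applications vanish.\<close>
  define f where "f i j l = (if l = 0 then (der ?P ^^ i) ((der P ^^ j) F) w else 0)" for i j l :: nat
  have rec: "f i j (Suc l) = f (Suc i) j l + f i (Suc j) l" for i j l
  proof -
    have "(der P ^^ i) (der P ((der P ^^ j) F)) = der P ((der P ^^ i) ((der P ^^ j) F))"
      by (metis funpow_swap1)
    then show ?thesis
      by (simp add: f_def Dm_pow mlin_der_pow[OF F P1(1)] mlin_der[OF mlin_der_pow[OF F P1(1)] P1(1)] 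
          del: funpow.simps) (simp add: Dm_pow[OF mlin_der_pow[OF F P1(1)]])
  qed
  have i0: "f i j 0 = 0" if "?n < i" for i j
    using der_pow_vanish[OF mlin_der_pow[OF F P1(1)] P2] that by (simp add: f_def)
  have j0: "f i j 0 = 0" if "?n < j" for i j
  proof (cases "w = []")
    case False
    have "(der ?P ^^ i) ((der P ^^ j) F) w = (der ?P ^^ i) (\<lambda>w. 0) w"
      by (rule der_pow_cong[of ?n]) (use False that der_pow_vanish[OF F P1] in auto)
    then show ?thesis by (simp add: f_def)
  next
    case True
    then show ?thesis using that by (cases i; cases j) (simp_all add: f_def)
  qed
  have "F w = (\<Sum>n\<le>?n + ?n. if n = 0 then F w else 0)" by simp
  also have "\<dots> = (\<Sum>n\<le>?n + ?n. sc (1 / fact n) (f 0 0 n))"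
    by (rule sum.cong) (simp_all add: f_def)
  also have "\<dots> = (\<Sum>i\<le>?n. sc (1 / fact i) (\<Sum>j\<le>?n. sc (1 / fact j) (f i j 0)))"
    by (rule exponential_product[of f, OF rec]) (use i0 j0 in auto)
  also have "\<dots> = (\<Sum>i\<le>?n. sc (1 / fact i) ((der ?P ^^ i) (\<lambda>w. \<Sum>j\<le>?n. sc (1 / fact j) ((der P ^^ j) F w)) w))"
    by (simp add: f_def der_pow_comb)
  also have "\<dots> = expd ?P (expd P F) w"
  proof (cases "w = []")
    case False
    show ?thesis unfolding expd_def[of ?P]
      by (intro sum.cong refl arg_cong[of _ _ "sc _"] der_pow_cong[of ?n])
        (use False expd_eq[OF F P1, of _ ?n] in auto)
  qed simp
  finally show "expd ?P (expd P F) w = F w" by simp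
qed

end

section \<open>The gauge action as conjugation\<close>

context fd_graded_comm_algebra
begin

text \<open>The corestriction of the commutator \<open>[D\<^sub>P, D\<^sub>M]\<close>.\<close>

definition ad :: "('v list \<Rightarrow> 'v) \<Rightarrow> ('v list \<Rightarrow> 'v) \<Rightarrow> 'v list \<Rightarrow> 'v" where
  "ad P M = (\<lambda>w. coder 1 M P w - der P M w)"

text \<open>\<open>e\<^bsup>ad P\<^esup> M\<close>; as \<open>ad P\<close> raises the arity, the omitted terms vanish on \<open>w\<close>.\<close>

definition conj_act :: "('v list \<Rightarrow> 'v) \<Rightarrow> ('v list \<Rightarrow> 'v) \<Rightarrow> 'v list \<Rightarrow> 'v" where
  "conj_act P M w = (\<Sum>j\<le>length w. sc (1 / fact j) ((ad P ^^ j) M w))"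

lemma ad_sharr: "P \<in> sharr 0 \<Longrightarrow> M \<in> sharr 1 \<Longrightarrow> ad P M \<in> sharr 1"
  using coder_sharr[of P 0 M 1] by (auto simp: ad_def intro: sharr_diff der_sharr)

lemma ad_pow_sharr: "P \<in> sharr 0 \<Longrightarrow> M \<in> sharr 1 \<Longrightarrow> (ad P ^^ j) M \<in> sharr 1"
  by (induction j) (auto intro: ad_sharr)

lemma vanishes_upto_diff: "vanishes_upto q F \<Longrightarrow> vanishes_upto q G \<Longrightarrow> vanishes_upto q (\<lambda>w. F w - G w :: 'v)"
  by (simp add: vanishes_upto_def)

lemma vanishes_upto_coder: "madditive F \<Longrightarrow> vanishes_upto r F \<Longrightarrow> vanishes_upto q G \<Longrightarrow> vanishes_upto (q + r) (coder e G F)"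
  unfolding coder_def by (rule vanishes_upto_ins)

lemma vanishes_upto_ad:
  assumes "P \<in> sharr 0" "M \<in> sharr 1" "vanishes_upto q P" "vanishes_upto r M"
  shows "vanishes_upto (q + r) (ad P M)"
  unfolding ad_def
  using vanishes_upto_diff[OF vanishes_upto_coder[OF sharrD(5)[OF assms(1)] assms(3,4)] vanishes_upto_der[OF sharrD(2)[OF assms(2)] assms(4,3), unfolded add.commute[of q]]]
  by (simp add: add.commute)

lemma vanishes_upto_ad_pow:
  assumes "P \<in> sharr 0" "M \<in> sharr 1" "vanishes_upto q P" "vanishes_upto r M"
  shows "vanishes_upto (q * j + r) ((ad P ^^ j) M)"
proof (induction j)
  case (Suc j)
  from vanishes_upto_ad[OF assms(1) ad_pow_sharr[OF assms(1,2)] assms(3) Suc] show ?case by (simp add: add.assoc)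
qed (simp add: assms)

lemma conj_act_eq:
  assumes "P \<in> gauge_gen" "M \<in> sharr 1" "length w \<le> N"
  shows "conj_act P M w = (\<Sum>j\<le>N. sc (1 / fact j) ((ad P ^^ j) M w))"
  unfolding conj_act_def
proof (rule sum.mono_neutral_left)
  have "vanishes_upto 0 M" using sharrD(1)[OF assms(2)] by (simp add: vanishes_upto_def)
  from vanishes_upto_ad_pow[OF gauge_genD(1)[OF assms(1)] assms(2) gauge_genD(2)[OF assms(1)] this]
  have "vanishes_upto j ((ad P ^^ j) M)" for j by simp
  then show "\<forall>j\<in>{..N} - {..length w}. sc (1 / fact j) ((ad P ^^ j) M w) = 0"
    by (auto simp: vanishes_upto_def)
qed (use assms in auto)

lemma conj_act_sharr:
  assumes "P \<in> sharr 0" "M \<in> sharr 1"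
  shows "conj_act P M \<in> sharr 1"
proof (rule sharr_by_length)
  fix n
  show "\<exists>F'\<in>sharr 1. \<forall>xs. length xs = n \<longrightarrow> conj_act P M xs = F' xs"
    by (rule bexI[of _ "\<lambda>xs. \<Sum>j\<le>n. sc (1 / fact j) ((ad P ^^ j) M xs)"])
       (auto simp: conj_act_def intro!: sharr_sum sharr_sc ad_pow_sharr assms)
qed

lemma coder_der:
  assumes "mlin X" "P \<in> sharr 0" "F \<in> sharr 1"
  shows "coder 1 F (der P X) w = der P (coder 1 F X) w + coder 1 (ad P F) X w"
  using coder_commutator[OF mlin_madditive[OF assms(1)] assms(2,3), of w]
  by (simp add: coder_0 ad_def algebra_simps)

lemma mlin_coder: "mlin F \<Longrightarrow> mlin G \<Longrightarrow> mlin (coder e G F)"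
  unfolding coder_def by (rule mlin_ins[OF _ _ pass_sign_lin])

lemma coder_comb2:
  assumes "mlin X"
  shows "coder e (\<lambda>w. \<Sum>i\<in>I. sc (c i) (G i w)) X w = (\<Sum>i\<in>I. sc (c i) (coder e (G i) X w))"
  using assms
proof (induction w arbitrary: X)
  case Nil
  show ?case by (simp add: coder_def vs.scale_sum_right)
next
  case (Cons x w)
  have "lin (\<lambda>y. X (y # v))" for v by (rule mlin_hd[OF Cons.prems])
  then have "X ((\<Sum>i\<in>I. sc (c i) (f i)) # v) = (\<Sum>i\<in>I. sc (c i) (X (f i # v)))" for f v
    using additive.sum[of "\<lambda>y. X (y # v)" "\<lambda>i. sc (c i) (f i)" I] by (simp add: lin_def)
  then have "cuts (\<lambda>u v. X ((\<Sum>i\<in>I. sc (c i) (G i (x # u))) # v)) w = (\<Sum>i\<in>I. sc (c i) (cuts (\<lambda>u v. X (G i (x # u) # v)) w))"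
    by (simp add: cuts_sum additive_cuts[OF additive_sc])
  then show ?case using Cons.IH[OF mlin_Cons[OF Cons.prems]]
    by (simp add: coder_def sum.distrib vs.scale_right_distrib)
qed

lemma coder_comb:
  "coder e G (\<lambda>w. \<Sum>i\<in>I. sc (c i) (X i w)) w = (\<Sum>i\<in>I. sc (c i) (coder e G (X i) w))"
proof (induction I rule: infinite_finite_induct)
  case (insert i I)
  then show ?case by (simp add: coder_def ins_add additive_ins[OF additive_sc])
qed (simp_all add: coder_def)

lemma coder_cong:
  assumes "\<And>v. v \<noteq> [] \<Longrightarrow> length v \<le> length w \<Longrightarrow> F v = F' v"
    and "\<And>u. u \<noteq> [] \<Longrightarrow> length u \<le> length w \<Longrightarrow> G u = G' u"
  shows "coder e G F w = coder e G' F' w"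
  unfolding coder_def by (rule ins_cong) (use assms in auto)

text \<open>\<open>D\<^sub>N \<circ> exp D\<^sub>P = exp D\<^sub>P \<circ> D\<^sub>M\<close> with \<open>N = e\<^bsup>ad P\<^esup> M\<close>. The commutation rule \<open>coder_der\<close> moves the
  powers of \<open>D\<^sub>P\<close> past \<open>D\<^sub>M\<close> one at a time, which is the recurrence of \<open>exponential_product\<close>.\<close>

lemma expd_coder_conj_act:
  assumes P: "P \<in> gauge_gen" and M: "M \<in> sharr 1" and X: "mlin X"
  shows "expd P (coder 1 (conj_act P M) X) = coder 1 M (expd P X)"
proof
  fix w :: "'v list"
  let ?n = "length w"
  note P' = gauge_genD(3,2)[OF P]
  note adS = ad_pow_sharr[OF gauge_genD(1)[OF P] M]
  define f where "f i j l = (der P ^^ i) (coder 1 ((ad P ^^ j) M) ((der P ^^ l) X)) w" for i j l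
  have mL: "mlin (coder 1 ((ad P ^^ j) M) X)" for j by (rule mlin_coder[OF X sharrD(2)[OF adS]])
  have rec: "f i j (Suc l) = f (Suc i) j l + f i (Suc j) l" for i j l
  proof -
    have "coder 1 ((ad P ^^ j) M) ((der P ^^ Suc l) X) = (\<lambda>w. der P (coder 1 ((ad P ^^ j) M) ((der P ^^ l) X)) w
       + coder 1 ((ad P ^^ Suc j) M) ((der P ^^ l) X) w)"
      using coder_der[OF mlin_der_pow[OF X P'(1)] gauge_genD(1)[OF P] adS] by (simp add: fun_eq_iff)
    moreover have "(der P ^^ i) (\<lambda>w. F w + F' w) = (\<lambda>w. (der P ^^ i) F w + (der P ^^ i) F' w)" for F F'
      by (induction i) (simp_all add: der_add)
    ultimately show ?thesis by (simp only: f_def) (simp add: funpow_swap1)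
  qed
  have i0: "f i j 0 = 0" if "?n < i" for i j
    using der_pow_vanish[OF mL P' that] by (simp add: f_def)
  have j0: "f i j 0 = 0" if "?n < j" for i j
  proof (cases "w = []")
    case False
    have "vanishes_upto 0 M" using sharrD(1)[OF M] by (simp add: vanishes_upto_def)
    from vanishes_upto_ad_pow[OF gauge_genD(1)[OF P] M P'(2) this]
    have vanishes_upto: "vanishes_upto j ((ad P ^^ j) M)" for j by simp
    have "coder 1 ((ad P ^^ j) M) X v = 0" if "length v \<le> ?n" for v
    proof -
      have "coder 1 ((ad P ^^ j) M) X v = coder 1 (\<lambda>w. 0) X v"
        by (rule coder_cong) (use that \<open>?n < j\<close> vanishes_uptoD[OF vanishes_upto] in auto)
      then show ?thesis by (simp add: coder_def ins_zero2[OF mlin_madditive[OF X]])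
    qed
    then have "(der P ^^ i) (coder 1 ((ad P ^^ j) M) X) w = (der P ^^ i) (\<lambda>w. 0) w"
      by (intro der_pow_cong[of ?n]) (use False in auto)
    then show ?thesis by (simp add: f_def)
  next
    case True
    then show ?thesis by (cases i) (simp_all add: f_def coder_def)
  qed
  have "coder 1 M (expd P X) w = coder 1 M (\<lambda>w. \<Sum>n\<le>?n + ?n. sc (1 / fact n) ((der P ^^ n) X w)) w"
    by (rule coder_cong) (auto intro!: expd_eq[OF X P'])
  also have "\<dots> = (\<Sum>n\<le>?n + ?n. sc (1 / fact n) (f 0 0 n))"
    by (simp add: coder_comb f_def)
  also have "\<dots> = (\<Sum>i\<le>?n. sc (1 / fact i) (\<Sum>j\<le>?n. sc (1 / fact j) (f i j 0)))"
    by (rule exponential_product[of f, OF rec]) (use i0 j0 in auto)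
  also have "\<dots> = (\<Sum>i\<le>?n. sc (1 / fact i)
      ((der P ^^ i) (\<lambda>w. \<Sum>j\<le>?n. sc (1 / fact j) (coder 1 ((ad P ^^ j) M) X w)) w))"
    by (simp add: f_def der_pow_comb)
  also have "\<dots> = expd P (coder 1 (conj_act P M) X) w"
  proof (cases "w = []")
    case False
    have "(\<Sum>j\<le>?n. sc (1 / fact j) (coder 1 ((ad P ^^ j) M) X v)) = coder 1 (conj_act P M) X v" if "length v \<le> ?n" for v
      unfolding coder_comb2[OF X, symmetric]
      by (rule coder_cong) (use that conj_act_eq[OF P M, of _ ?n] in auto)
    then show ?thesis unfolding expd_def
      by (intro sum.cong refl arg_cong[of _ _ "sc _"] der_pow_cong[of ?n]) (use False in auto)
  next
    case True
    then show ?thesis by (simp add: coder_def)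
  qed
  finally show "expd P (coder 1 (conj_act P M) X) w = coder 1 M (expd P X) w" by simp
qed

lemma expd_inj: "P \<in> gauge_gen \<Longrightarrow> mlin F \<Longrightarrow> mlin F' \<Longrightarrow> expd P F = expd P F' \<Longrightarrow> F = F'"
  using expd_inverse by metis

text \<open>Both sides determine \<open>N\<close>, since \<open>exp D\<^sub>P\<close> is invertible and \<open>D\<^sub>N\<close> has corestriction \<open>N\<close>.\<close>

lemma conj_act_unique:
  assumes P: "P \<in> gauge_gen" and M: "M \<in> sharr 1" and N: "N \<in> sharr 1"
    and eq: "expd P (coder 1 N proj1) = coder 1 M (expd P proj1)"
  shows "N = conj_act P M"
proof -
  have A: "conj_act P M \<in> sharr 1" by (rule conj_act_sharr[OF gauge_genD(1)[OF P] M])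
  have "expd P (coder 1 N proj1) = expd P (coder 1 (conj_act P M) proj1)"
    using expd_coder_conj_act[OF P M mlin_proj1] eq by simp
  then have "expd P N = expd P (conj_act P M)" using sharrD(1)[OF N] sharrD(1)[OF A] by (simp add: coder_proj1)
  then show ?thesis by (rule expd_inj[OF P sharrD(2)[OF N] sharrD(2)[OF A]])
qed

lemma conj_act_comp:
  assumes P: "P \<in> gauge_gen" and Q: "Q \<in> gauge_gen"
  shows "\<exists>R\<in>gauge_gen. \<forall>M\<in>sharr 1. conj_act R M = conj_act P (conj_act Q M)"
proof -
  obtain R where R: "R \<in> gauge_gen" and ER: "\<And>X. mlin X \<Longrightarrow> expd R X = expd Q (expd P X)"
    using expd_comp[OF P Q] by blast
  have "conj_act P (conj_act Q M) = conj_act R M" if M: "M \<in> sharr 1" for M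
  proof (rule conj_act_unique[OF R M])
    have QM: "conj_act Q M \<in> sharr 1" by (rule conj_act_sharr[OF gauge_genD(1)[OF Q] M])
    show PQM: "conj_act P (conj_act Q M) \<in> sharr 1" by (rule conj_act_sharr[OF gauge_genD(1)[OF P] QM])
    have "expd R (coder 1 (conj_act P (conj_act Q M)) proj1) = expd Q (expd P (coder 1 (conj_act P (conj_act Q M)) proj1))"
      by (rule ER[OF mlin_coder[OF mlin_proj1 sharrD(2)[OF PQM]]])
    also have "\<dots> = expd Q (coder 1 (conj_act Q M) (expd P proj1))" by (simp add: expd_coder_conj_act[OF P QM mlin_proj1])
    also have "\<dots> = coder 1 M (expd Q (expd P proj1))" by (rule expd_coder_conj_act[OF Q M mlin_expd[OF mlin_proj1 gauge_genD(3)[OF P]]])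
    finally show "expd R (coder 1 (conj_act P (conj_act Q M)) proj1) = coder 1 M (expd R proj1)" by (simp add: ER[OF mlin_proj1])
  qed
  with R show ?thesis by metis
qed

lemma conj_act_inverse:
  assumes P: "P \<in> gauge_gen" and M: "M \<in> sharr 1"
  shows "conj_act (\<lambda>w. - P w) (conj_act P M) = M"
proof (rule conj_act_unique[symmetric])
  let ?P = "\<lambda>w. - P w"
  show P': "?P \<in> gauge_gen" by (rule gauge_gen_uminus[OF P])
  show A: "conj_act P M \<in> sharr 1" by (rule conj_act_sharr[OF gauge_genD(1)[OF P] M])
  show "M \<in> sharr 1" by (rule M)
  let ?X = "expd ?P proj1"
  have X: "mlin ?X" by (rule mlin_expd[OF mlin_proj1 gauge_genD(3)[OF P']])
  have "expd P ?X = proj1" using expd_inverse[OF P' mlin_proj1] by simp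
  then have "expd P (coder 1 (conj_act P M) ?X) = coder 1 M proj1" using expd_coder_conj_act[OF P M X] by simp
  then show "expd ?P (coder 1 M proj1) = coder 1 (conj_act P M) ?X"
    using expd_inverse[OF P mlin_coder[OF X sharrD(2)[OF A], of 1]] by simp
qed

text \<open>The square-zero Harrison coderivations whose corestriction starts with the suspended product; these are
  the suspensions of \<open>m\<^sub>2 + m\<close> for minimal \<open>C\<^sub>\<infinity>\<close>-structures \<open>m\<close>.\<close>

definition mc :: "('v list \<Rightarrow> 'v) set" where
  "mc = {M \<in> sharr 1. vanishes_upto 2 (\<lambda>w. M w - mu w) \<and> coder 1 M M = (\<lambda>w. 0)}"

lemma double_zero: "x + x = 0 \<Longrightarrow> x = (0 :: 'v)"
  using vs.scale_left_distrib[of 1 1 x] vs.scale_eq_0_iff[of 2 x] by simp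

text \<open>The graded commutator of the odd coderivation \<open>D\<^sub>M\<close> with itself is twice its square; divide by 2.\<close>

lemma coder_mc_square:
  assumes M: "M \<in> sharr 1" "coder 1 M M = (\<lambda>w. 0)" and X: "mlin X"
  shows "coder 1 M (coder 1 M X) = (\<lambda>w. 0)"
proof
  fix w
  have "coder 1 M (coder 1 M X) w + coder 1 M (coder 1 M X) w = 0"
    using coder_commutator[OF mlin_madditive[OF X] M(1) M(1), of w, unfolded M(2)]
    by (simp add: ksgn_def) (simp add: coder_def ins_zero2[OF mlin_madditive[OF X]])
  then show "coder 1 M (coder 1 M X) w = 0" by (rule double_zero)
qed

lemma vanishes_upto_mu: "vanishes_upto 1 mu"
  using mu_eq(2) by (auto simp: vanishes_upto_def)

lemma mc_vanishes_upto: "M \<in> mc \<Longrightarrow> vanishes_upto 1 M"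
  using vanishes_upto_mu by (auto simp: mc_def vanishes_upto_def)

lemma mc_sharr: "M \<in> mc \<Longrightarrow> M \<in> sharr 1"
  by (simp add: mc_def)

lemma ad_diff:
  assumes "P \<in> sharr 0"
  shows "ad P (\<lambda>w. M w - M' w) = (\<lambda>w. ad P M w - ad P M' w)"
  by (simp add: ad_def coder_def ins_diff2[OF sharrD(5)[OF assms]] der_diff fun_eq_iff algebra_simps)

lemma ad_pow_diff:
  assumes "P \<in> sharr 0"
  shows "(ad P ^^ j) (\<lambda>w. M w - M' w) = (\<lambda>w. (ad P ^^ j) M w - (ad P ^^ j) M' w)"
  by (induction j) (simp_all add: ad_diff[OF assms])

lemma conj_act_diff:
  assumes "P \<in> sharr 0"
  shows "conj_act P (\<lambda>w. M w - M' w) = (\<lambda>w. conj_act P M w - conj_act P M' w)"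
  by (simp add: conj_act_def ad_pow_diff[OF assms] vs.scale_right_diff_distrib sum_subtractf fun_eq_iff)

text \<open>Locality: if \<open>P\<close> starts above arity \<open>q\<close> and \<open>M\<close> above arity \<open>r\<close>, then all corrections to \<open>M\<close> start
  above arity \<open>q + r\<close>.\<close>

lemma conj_act_vanishes_upto:
  assumes P: "P \<in> sharr 0" "vanishes_upto q P" and M: "M \<in> sharr 1" "vanishes_upto r M" and w: "length w \<le> q + r"
  shows "conj_act P M w = M w"
proof -
  have "sc (1 / fact j) ((ad P ^^ j) M w) = 0" if "j \<noteq> 0" for j
  proof -
    have "q + r \<le> q * j + r" using that by (cases j) auto
    then show ?thesis
      using vanishes_uptoD[OF vanishes_upto_ad_pow[OF P(1) M(1) P(2) M(2)] order_trans[OF w]] by simp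
  qed
  then have "conj_act P M w = (\<Sum>j\<le>length w. if j = 0 then M w else 0)"
    unfolding conj_act_def by (intro sum.cong) auto
  then show ?thesis by simp
qed

lemma ad_pow_comm: "ad P ((ad P ^^ j) M) = (ad P ^^ j) (ad P M)"
  by (simp add: funpow_swap1)

text \<open>As \<open>exp D\<^sub>P\<close> is invertible, \<open>D\<^sub>N \<circ> D\<^sub>N = 0\<close> follows from \<open>D\<^sub>M \<circ> D\<^sub>M = 0\<close>.\<close>

lemma conj_act_mc:
  assumes P: "P \<in> gauge_gen" and M: "M \<in> mc"
  shows "conj_act P M \<in> mc"
proof -
  let ?N = "conj_act P M"
  have MS: "M \<in> sharr 1" "coder 1 M M = (\<lambda>w. 0)" "vanishes_upto 2 (\<lambda>w. M w - mu w)" using M by (auto simp: mc_def)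
  have N: "?N \<in> sharr 1" by (rule conj_act_sharr[OF gauge_genD(1)[OF P] MS(1)])
  have "?N w = M w" if "length w \<le> 2" for w
    using conj_act_vanishes_upto[OF gauge_genD(1)[OF P] gauge_genD(2)[OF P] MS(1) mc_vanishes_upto[OF M]] that by simp
  with MS(3) have vanishes_upto: "vanishes_upto 2 (\<lambda>w. ?N w - mu w)" by (auto simp: vanishes_upto_def)
  have LNX: "mlin (coder 1 ?N X)" if "mlin X" for X by (rule mlin_coder[OF that sharrD(2)[OF N]])
  note Npr = LNX[OF mlin_proj1]
  have "expd P (coder 1 ?N (coder 1 ?N proj1)) = coder 1 M (expd P (coder 1 ?N proj1))"
    by (rule expd_coder_conj_act[OF P MS(1) Npr])
  also have "expd P (coder 1 ?N proj1) = coder 1 M (expd P proj1)" by (rule expd_coder_conj_act[OF P MS(1) mlin_proj1])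
  also have "coder 1 M (coder 1 M (expd P proj1)) = (\<lambda>w. 0)"
    by (rule coder_mc_square[OF MS(1,2) mlin_expd[OF mlin_proj1 gauge_genD(3)[OF P]]])
  also have "\<dots> = expd P (\<lambda>w. 0)" by simp
  finally have "coder 1 ?N (coder 1 ?N proj1) = (\<lambda>w. 0)"
    by (rule expd_inj[OF P LNX[OF Npr] sharrD(2)[OF sharr_zero]])
  then have "coder 1 ?N ?N = (\<lambda>w. 0)" using coder_proj1[of ?N 1] sharrD(1)[OF N] by simp
  with N vanishes_upto show ?thesis by (simp add: mc_def)
qed

section \<open>Gauge action and isotopies on cochains\<close>

lemma susp_apply_zero: "susp A f = (\<lambda>w. 0) \<longleftrightarrow> f = 0"
proof -
  have "susp A f = (\<lambda>w. 0) \<longleftrightarrow> susp A f = susp A 0" unfolding susp_zero by (simp add: zero_fun_def)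
  then show ?thesis using susp_eqI[of f 0] by auto
qed

lemma susp_m2: "susp A (m2 A + m) = (\<lambda>w. mu w + susp A m w)"
  by (simp add: susp_add mu_def fun_eq_iff)

text \<open>Since \<open>[m\<^sub>2, m\<^sub>2] = 0\<close>, the Maurer--Cartan equation of \<open>m\<close> says that \<open>m\<^sub>2 + m\<close> squares to zero.\<close>

lemma minimal_iff: "minimal_cinf A m \<longleftrightarrow> susp A (m2 A + m) \<in> mc"
proof -
  let ?M = "susp A m"
  have 1: "m \<in> gla_filt A 2 1 \<longleftrightarrow> ?M \<in> sharr 1 \<and> vanishes_upto 2 ?M" by (simp add: gla_filt_iff)
  have 2: "(\<lambda>w. mu w + ?M w) \<in> sharr 1 \<longleftrightarrow> ?M \<in> sharr 1"
    using sharr_add[OF mu_sharr, of ?M] sharr_diff[OF _ mu_sharr, of "\<lambda>w. mu w + ?M w"] by auto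
  have 3: "(\<forall>xs. delta A 1 m xs + scal A (1 / 2) (bracket A 1 1 m m xs) = 0) \<longleftrightarrow>
      coder 1 (\<lambda>w. mu w + ?M w) (\<lambda>w. mu w + ?M w) = (\<lambda>w. 0)" if M: "?M \<in> sharr 1"
  proof -
    have c: "susp A (circ A 1 f g) = coder 1 (susp A g) (susp A f)" if "susp A f \<in> sharr 1" "susp A g \<in> sharr 1" for f g
      using susp_circ[of f 1 g 1 1] that by simp
    have BS: "susp A (m2 A) \<in> sharr 1" using mu_sharr by (simp add: mu_def)
    have neg: "f - ksgn 1 g = f + g" for f g :: "'v list \<Rightarrow> 'v" by (simp add: ksgn_def)
    have d: "susp A (delta A 1 m) = coder 1 ?M mu + coder 1 mu ?M"
      unfolding delta_def bracket_def by (simp add: neg susp_add c[OF BS M] c[OF M BS] mu_def)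
    have b: "susp A (bracket A 1 1 m m) = coder 1 ?M ?M + coder 1 ?M ?M"
      unfolding bracket_def by (simp add: neg susp_add c[OF M M])
    have half: "sc (1 / 2) (x + x) = x" for x
      using vs.scale_left_distrib[of 1 1 x] vs.scale_scale[of "1/2" 2 x] by simp
    have "(\<forall>xs. delta A 1 m xs + scal A (1 / 2) (bracket A 1 1 m m xs) = 0) \<longleftrightarrow>
       susp A (\<lambda>xs. delta A 1 m xs + scal A (1 / 2) (bracket A 1 1 m m xs)) = (\<lambda>w. 0)"
      unfolding susp_apply_zero by (simp add: fun_eq_iff)
    also have "susp A (\<lambda>xs. delta A 1 m xs + scal A (1 / 2) (bracket A 1 1 m m xs)) =
       (\<lambda>w. susp A (delta A 1 m) w + sc (1 / 2) (susp A (bracket A 1 1 m m) w))"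
      by (simp add: susp_eq fun_eq_iff)
    also have "\<dots> = coder 1 (\<lambda>w. mu w + ?M w) (\<lambda>w. mu w + ?M w)"
      unfolding d b
      using coder_mu_mu by (simp only: plus_fun_apply half) (simp add: fun_eq_iff coder_def ins_add ins_add2[OF sharrD(5)[OF M]] ins_add2[OF sharrD(5)[OF mu_sharr]] algebra_simps)
    finally show ?thesis .
  qed
  show ?thesis
    unfolding minimal_cinf_def susp_m2 mc_def 1 using 2 3 by auto
qed

lemma susp_bracket:
  assumes "susp A p \<in> sharr 0" "susp A f \<in> sharr 1"
  shows "susp A (bracket A 0 1 p f) = ad (susp A p) (susp A f)"
  using susp_circ[OF assms, of 1] susp_circ[OF assms(2,1), of 0]
  by (simp add: bracket_def susp_diff ad_def coder_0 fun_eq_iff)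

lemma susp_delta:
  assumes "susp A p \<in> sharr 0"
  shows "susp A (delta A 0 p) = (\<lambda>w. - ad (susp A p) mu w)"
proof -
  have BS: "susp A (m2 A) \<in> sharr 1" using mu_sharr by (simp add: mu_def)
  show ?thesis
    using susp_circ[OF assms BS, of 1] susp_circ[OF BS assms, of 0]
    by (simp add: delta_def bracket_def susp_diff ad_def coder_0 fun_eq_iff mu_def)
qed

lemma susp_bracket_pow:
  assumes "susp A p \<in> sharr 0" "susp A f \<in> sharr 1"
  shows "susp A ((bracket A 0 1 p ^^ j) f) = (ad (susp A p) ^^ j) (susp A f)"
proof (induction j)
  case (Suc j)
  show ?case using susp_bracket[OF assms(1), of "(bracket A 0 1 p ^^ j) f"] ad_pow_sharr[OF assms]
    by (simp add: Suc)
qed simp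

text \<open>The term \<open>\<delta> p = - [p, m\<^sub>2]\<close> in the gauge action turns the second series into \<open>e\<^bsup>ad p\<^esup> m\<^sub>2 - m\<^sub>2\<close>; so
  the affine action on \<open>m\<close> is the linear one on \<open>m\<^sub>2 + m\<close>.\<close>

lemma susp_gauge:
  assumes p: "susp A p \<in> gauge_gen" and m: "susp A m \<in> sharr 1"
  shows "susp A (m2 A + gauge A p m) = conj_act (susp A p) (susp A (m2 A + m))"
proof
  fix xs :: "'v list"
  let ?P = "susp A p" and ?n = "length xs"
  have P0: "?P \<in> sharr 0" by (rule gauge_genD(1)[OF p])
  have dS: "susp A (delta A 0 p) \<in> sharr 1"
    unfolding susp_delta[OF P0] by (rule sharr_uminus[OF ad_sharr[OF P0 mu_sharr]])
  have pow: "(bracket A 0 1 p ^^ j) f (susp_args A xs) = (ad ?P ^^ j) (susp A f) xs" if "susp A f \<in> sharr 1" for f j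
    using susp_bracket_pow[OF P0 that, of j] by (simp add: susp_eq fun_eq_iff)
  have neg: "(ad ?P ^^ j) (\<lambda>w. - F w) = (\<lambda>w. - (ad ?P ^^ j) F w)" for j F
    using ad_pow_diff[OF P0, of j "\<lambda>_. 0" F] ad_pow_diff[OF P0, of j F F] by simp
  have "susp A (gauge A p m) xs =
     (\<Sum>j\<le>?n. sc (1 / fact j) ((ad ?P ^^ j) (susp A m) xs)) +
     (\<Sum>j\<le>?n. sc (1 / fact (j + 1)) ((ad ?P ^^ Suc j) mu xs))"
    unfolding susp_eq[of A "gauge A p m"] gauge_def
    by (simp add: pow[OF m] pow[OF dS] susp_delta[OF P0] neg vs.scale_minus_right sum_negf ad_pow_comm[symmetric]
      del: sum.atMost_Suc)
  also have "(\<Sum>j\<le>?n. sc (1 / fact (j + 1)) ((ad ?P ^^ Suc j) mu xs)) = 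
     (\<Sum>j\<le>Suc ?n. sc (1 / fact j) ((ad ?P ^^ j) mu xs)) - mu xs"
    by (subst sum.atMost_Suc_shift) simp
  also have "(\<Sum>j\<le>Suc ?n. sc (1 / fact j) ((ad ?P ^^ j) mu xs)) = conj_act ?P mu xs"
    by (rule conj_act_eq[OF p mu_sharr, symmetric]) simp
  finally have g: "susp A (gauge A p m) xs = conj_act ?P (susp A m) xs + (conj_act ?P mu xs - mu xs)"
    by (simp add: conj_act_def)
  have "susp A m = (\<lambda>w. (mu w + susp A m w) - mu w)" by simp
  then have "conj_act ?P (susp A m) = (\<lambda>w. conj_act ?P (\<lambda>w. mu w + susp A m w) w - conj_act ?P mu w)"
    using conj_act_diff[OF P0] by metis
  then show "susp A (m2 A + gauge A p m) xs = conj_act ?P (susp A (m2 A + m)) xs"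
    using g by (simp add: susp_m2)
qed

end

context fd_graded_comm_algebra
begin

definition gauge_par :: "('v list \<Rightarrow> 'v) set" where "gauge_par = gla_filt A 1 0"

lemma gauge_par_iff: "p \<in> gauge_par \<longleftrightarrow> susp A p \<in> gauge_gen"
  by (simp add: gauge_par_def gla_filt_iff gauge_gen_def)

lemma minimal_sharr: "minimal_cinf A m \<Longrightarrow> susp A m \<in> sharr 1"
  by (simp add: minimal_cinf_def gla_filt_iff)

lemma minimal_mc: "minimal_cinf A m \<Longrightarrow> susp A (m2 A + m) \<in> mc"
  by (simp add: minimal_iff)

lemma susp_gauge_minimal:
  "p \<in> gauge_par \<Longrightarrow> minimal_cinf A m \<Longrightarrow> susp A (m2 A + gauge A p m) = conj_act (susp A p) (susp A (m2 A + m))"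
  by (rule susp_gauge) (simp_all add: gauge_par_iff minimal_sharr)

lemma gauge_minimal: "p \<in> gauge_par \<Longrightarrow> minimal_cinf A m \<Longrightarrow> minimal_cinf A (gauge A p m)"
  unfolding minimal_iff[of "gauge A p m"] by (simp add: susp_gauge_minimal conj_act_mc gauge_par_iff minimal_mc)

lemma m2_add_cancel: "susp A (m2 A + f) = susp A (m2 A + g) \<Longrightarrow> f = g"
  using susp_eqI[of "m2 A + f" "m2 A + g"] by (simp only: add_left_cancel)

lemma gauge_comp:
  assumes "p \<in> gauge_par" "q \<in> gauge_par"
  shows "\<exists>r\<in>gauge_par. \<forall>m. minimal_cinf A m \<longrightarrow> gauge A r m = gauge A p (gauge A q m)"
proof -
  obtain R where R: "R \<in> gauge_gen" "\<And>M. M \<in> sharr 1 \<Longrightarrow> conj_act R M = conj_act (susp A p) (conj_act (susp A q) M)"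
    using conj_act_comp[of "susp A p" "susp A q"] assms gauge_par_iff by blast
  let ?r = "susp A R"
  have r: "?r \<in> gauge_par" using R by (simp add: gauge_par_iff)
  have "gauge A ?r m = gauge A p (gauge A q m)" if m: "minimal_cinf A m" for m
    by (rule m2_add_cancel)
       (simp only: susp_susp R(2)[OF mc_sharr[OF minimal_mc[OF m]]] susp_gauge_minimal[OF r m] susp_gauge_minimal[OF assms(1) gauge_minimal[OF assms(2) m]] susp_gauge_minimal[OF assms(2) m])
  with r show ?thesis by blast
qed

lemma gauge_inverse:
  assumes "p \<in> gauge_par"
  shows "\<exists>q\<in>gauge_par. \<forall>m. minimal_cinf A m \<longrightarrow> gauge A q (gauge A p m) = m"
proof -
  let ?P = "susp A p" let ?q = "susp A (\<lambda>w. - ?P w)"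
  have P: "?P \<in> gauge_gen" using assms by (simp add: gauge_par_iff)
  have q: "?q \<in> gauge_par" unfolding gauge_par_iff susp_susp by (rule gauge_gen_uminus[OF P])
  have "gauge A ?q (gauge A p m) = m" if m: "minimal_cinf A m" for m
    by (rule m2_add_cancel)
       (simp only: susp_gauge_minimal[OF q gauge_minimal[OF assms m]] susp_gauge_minimal[OF assms m]
          susp_susp conj_act_inverse[OF P mc_sharr[OF minimal_mc[OF m]]])
  with q show ?thesis by blast
qed

lemma gauge_local:
  assumes p: "p \<in> gauge_par" and m: "minimal_cinf A m" and n: "minimal_cinf A n" and vanishes_upto: "vanishes_upto q (m - n)"
  shows "vanishes_upto (Suc q) (gauge A p m - gauge A p n - (m - n))"
proof -
  let ?P = "susp A p" and ?M = "susp A (m2 A + m)" and ?N = "susp A (m2 A + n)"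
  have P: "?P \<in> sharr 0" "vanishes_upto 1 ?P" using p gauge_genD by (auto simp: gauge_par_iff)
  have sharr: "(\<lambda>w. ?M w - ?N w) \<in> sharr 1" by (intro sharr_diff mc_sharr minimal_mc m n)
  have d: "(\<lambda>w. ?M w - ?N w) = susp A (m - n)" by (simp add: susp_add susp_diff fun_eq_iff)
  have "conj_act ?P (\<lambda>w. ?M w - ?N w) w = ?M w - ?N w" if "length w \<le> Suc q" for w
    using conj_act_vanishes_upto[OF P sharr, of q w] vanishes_upto that by (simp add: d vanishes_upto_susp)
  then have "vanishes_upto (Suc q) (\<lambda>w. conj_act ?P ?M w - conj_act ?P ?N w - (?M w - ?N w))"
    unfolding conj_act_diff[OF P(1)] by (simp add: vanishes_upto_def)
  also have "(\<lambda>w. conj_act ?P ?M w - conj_act ?P ?N w - (?M w - ?N w)) = susp A (gauge A p m - gauge A p n - (m - n))"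
    unfolding susp_gauge_minimal[OF p m, symmetric] susp_gauge_minimal[OF p n, symmetric]
    by (simp add: susp_add susp_diff fun_eq_iff)
  finally show ?thesis unfolding vanishes_upto_susp .
qed

lemma susp_delta_1:
  assumes "susp A f \<in> sharr 1"
  shows "susp A (delta A 1 f) = coder 1 (susp A f) mu + coder 1 mu (susp A f)"
proof -
  have BS: "susp A (m2 A) \<in> sharr 1" using mu_sharr by (simp add: mu_def)
  have neg: "f - ksgn 1 g = f + g" for f g :: "'v list \<Rightarrow> 'v" by (simp add: ksgn_def)
  show ?thesis
    unfolding delta_def bracket_def mult_1 neg
    using susp_circ[OF assms BS, of 1] susp_circ[OF BS assms, of 1] by (simp add: susp_add mu_def)
qed

lemma harr_cocycles_iff:
  assumes "k \<ge> 1"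
  shows "f \<in> harr_cocycles A k (2 - int k) \<longleftrightarrow> (\<forall>xs. length xs \<noteq> k \<longrightarrow> f xs = 0) \<and>
    susp A f \<in> sharr 1 \<and> (\<forall>w. coder 1 (susp A f) mu w + coder 1 mu (susp A f) w = 0)"
proof -
  have "delta A 1 f = 0 \<longleftrightarrow> (\<forall>w. coder 1 (susp A f) mu w + coder 1 mu (susp A f) w = 0)" if "susp A f \<in> sharr 1"
    using susp_apply_zero[of "delta A 1 f"] susp_delta_1[OF that] by (simp add: fun_eq_iff)
  then show ?thesis
    unfolding harr_cocycles_def using assms by (auto simp: harr_cochains_iff)
qed

lemma coder_concentrated:
  assumes "mlin F" "\<And>xs. length xs \<noteq> a \<Longrightarrow> F xs = 0" "\<And>xs. length xs \<noteq> b \<Longrightarrow> H xs = 0" "length w + 1 \<noteq> a + b"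
  shows "coder e H F w = 0"
  unfolding coder_def by (rule ins_concentrated[OF mlin_madditive[OF assms(1)] assms(2-4)])

lemma coder_diff2: "mlin F \<Longrightarrow> coder e (\<lambda>w. H w - H' w) F w = coder e H F w - coder e H' F w"
  unfolding coder_def by (rule ins_diff2[OF mlin_madditive])

lemma coder_diff1: "coder e H (\<lambda>w. F w - F' w) w = coder e H F w - coder e H F' w"
  unfolding coder_def using ins_add[of "ps e" "\<lambda>w. F w - F' w" F' H w] by simp

text \<open>Write \<open>M\<close>, \<open>N\<close> for the suspended structures and \<open>D = M - N\<close>. Then \<open>0 = M \<circ> M - N \<circ> N = M \<circ> D + D \<circ> N\<close>. In
  arity \<open>k + 1\<close> only the lowest component of \<open>D\<close> together with the product in \<open>M\<close> and \<open>N\<close> contributes,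
  which leaves the differential of that component.\<close>

lemma difference_cocycle:
  assumes m: "minimal_cinf A m" and n: "minimal_cinf A n" and vanishes_upto: "vanishes_upto (k - 1) (m - n)" and k: "k \<ge> 1"
  shows "arity_part k (m - n) \<in> harr_cocycles A k (2 - int k)"
  unfolding harr_cocycles_iff[OF k]
proof (intro conjI allI impI)
  fix xs :: "'v list" assume "length xs \<noteq> k"
  then show "arity_part k (m - n) xs = 0" by (simp add: arity_part_def)
next
  let ?M = "susp A (m2 A + m)" and ?N = "susp A (m2 A + n)"
  let ?der = "\<lambda>w. ?M w - ?N w" and ?Dk = "susp A (arity_part k (m - n))"
  have M: "?M \<in> mc" and N: "?N \<in> mc" by (rule minimal_mc[OF m], rule minimal_mc[OF n])
  have der: "?der \<in> sharr 1" by (intro sharr_diff mc_sharr M N)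
  have der_eq: "susp A (m - n) = ?der" by (simp add: susp_add susp_diff fun_eq_iff)
  then have Dk_eq: "?Dk = (\<lambda>w. if length w = k then ?der w else 0)"
    unfolding susp_arity_part by (simp add: arity_part_def)
  show Dk: "?Dk \<in> sharr 1" unfolding Dk_eq by (rule sharr_restrict_length[OF der, of "\<lambda>l. l = k"])
  have lowDD: "vanishes_upto (k - 1) ?der" using vanishes_upto unfolding der_eq[symmetric] vanishes_upto_susp .
  have lowR: "vanishes_upto k (\<lambda>w. ?der w - ?Dk w)"
    using lowDD k unfolding Dk_eq by (auto simp: vanishes_upto_def)
  have R: "(\<lambda>w. ?der w - ?Dk w) \<in> sharr 1" by (rule sharr_diff[OF der Dk])
  have MB: "vanishes_upto 2 (\<lambda>w. ?M w - mu w)" "(\<lambda>w. ?M w - mu w) \<in> sharr 1" "vanishes_upto 2 (\<lambda>w. ?N w - mu w)" "(\<lambda>w. ?N w - mu w) \<in> sharr 1"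
    using M N sharr_diff[OF _ mu_sharr] by (auto simp: mc_def)
  fix w
  show "coder 1 ?Dk mu w + coder 1 mu ?Dk w = 0"
  proof (cases "length w = k + 1")
    case False
    have "coder 1 ?Dk mu w = 0"
      by (rule coder_concentrated[OF sharrD(2)[OF mu_sharr] mu_eq(2), of 2 k]) (use False in \<open>auto simp: Dk_eq\<close>)
    moreover have "coder 1 mu ?Dk w = 0"
      by (rule coder_concentrated[OF sharrD(2)[OF Dk] _ mu_eq(2), of k]) (use False in \<open>auto simp: Dk_eq\<close>)
    ultimately show ?thesis by simp
  next
    case True
    \<comment> \<open>Terms starting above arity \<open>k + 1\<close> do not contribute to words of this length.\<close>
    have vanish: "coder 1 H F w = 0" if "F \<in> sharr 1" "vanishes_upto r F" "vanishes_upto q H" "k + 1 \<le> q + r" for F H q r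
      using vanishes_uptoD[OF vanishes_upto_coder[OF sharrD(5)[OF that(1)] that(2,3), of 1], of w] that(4) True by simp
    have "0 = coder 1 ?M ?M w - coder 1 ?N ?N w" using M N by (simp add: mc_def)
    also have "\<dots> = coder 1 ?M ?der w + coder 1 ?der ?N w"
      unfolding coder_diff1 coder_diff2[OF sharrD(2)[OF mc_sharr[OF N]]] by simp
    also have "coder 1 ?M ?der w = coder 1 mu ?der w"
      using vanish[OF der lowDD MB(1)] coder_diff2[OF sharrD(2)[OF der], of 1 ?M mu w] k by simp
    also have "\<dots> = coder 1 mu ?Dk w"
      using vanish[OF R lowR vanishes_upto_mu] coder_diff1[of 1 mu ?der ?Dk w] by simp
    also have "coder 1 ?der ?N w = coder 1 ?der mu w"
      using vanish[OF MB(4,3) lowDD] coder_diff1[of 1 ?der ?N mu w] k by simp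
    also have "\<dots> = coder 1 ?Dk mu w"
      using vanish[OF mu_sharr vanishes_upto_mu lowR] coder_diff2[OF sharrD(2)[OF mu_sharr], of 1 ?der ?Dk w] by simp
    finally show ?thesis by (metis add.commute)
  qed
qed

text \<open>For \<open>h\<close> of arity \<open>k - 1\<close> the operator \<open>ad h\<close> raises the arity by \<open>k - 2\<close>. Up to arity \<open>k\<close> this leaves the
  linear term applied to \<open>m\<^sub>2\<close>, which is \<open>- \<delta> h\<close>; the quadratic term starts in arity \<open>2 k - 2 > k\<close>.\<close>

lemma coboundary_gauge:
  assumes h: "h \<in> harr_cochains A (k - 1) (2 - int k)" and k: "k \<ge> 3"
  shows "h \<in> gauge_par" and "minimal_cinf A m \<Longrightarrow> vanishes_upto k (gauge A h m - (m - delta A 0 h))"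
proof -
  let ?H = "susp A h"
  have H: "?H \<in> sharr 0" "\<And>xs. length xs \<noteq> k - 1 \<Longrightarrow> h xs = 0"
    using h k by (auto simp: harr_cochains_iff of_nat_diff)
  have vanishes_upto: "vanishes_upto (k - 2) ?H" unfolding vanishes_upto_susp using H(2) k by (auto simp: vanishes_upto_def)
  then have harr_gp: "?H \<in> gauge_gen" using H(1) vanishes_upto_mono[OF vanishes_upto, of 1] k by (simp add: gauge_gen_def)
  then show hG: "h \<in> gauge_par" by (simp add: gauge_par_iff)
  assume m: "minimal_cinf A m"
  let ?M = "susp A (m2 A + m)"
  have M: "?M \<in> mc" "?M \<in> sharr 1" using minimal_mc[OF m] mc_sharr by auto
  have MB: "vanishes_upto 2 (\<lambda>w. ?M w - mu w)" "(\<lambda>w. ?M w - mu w) \<in> sharr 1"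
    using M sharr_diff[OF _ mu_sharr] by (auto simp: mc_def)
  have "conj_act ?H ?M w = ?M w + ad ?H mu w" if w: "length w \<le> k" for w
  proof -
    have 2: "(ad ?H ^^ j) ?M w = 0" if "2 \<le> j" for j
    proof -
      have "(k - 2) * 2 \<le> (k - 2) * j" using that by simp
      then have "length w \<le> (k - 2) * j + 1" using w k by linarith
      then show ?thesis
        using vanishes_uptoD[OF vanishes_upto_ad_pow[OF H(1) M(2) vanishes_upto mc_vanishes_upto[OF M(1)]]] by blast
    qed
    have 1: "ad ?H ?M w = ad ?H mu w"
      using vanishes_uptoD[OF vanishes_upto_ad[OF H(1) MB(2) vanishes_upto MB(1)], of w] w k unfolding ad_diff[OF H(1)] by simp
    have "conj_act ?H ?M w = (\<Sum>j\<le>Suc (length w). sc (1 / fact j) ((ad ?H ^^ j) ?M w))"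
      by (rule conj_act_eq[OF harr_gp M(2)]) simp
    also have "\<dots> = (\<Sum>j\<in>{0, 1}. sc (1 / fact j) ((ad ?H ^^ j) ?M w))"
      by (rule sum.mono_neutral_right) (auto intro!: 2)
    also have "\<dots> = ?M w + ad ?H mu w" by (simp add: 1)
    finally show ?thesis .
  qed
  then have "vanishes_upto k (\<lambda>w. conj_act ?H ?M w - (?M w + ad ?H mu w))" by (simp add: vanishes_upto_def)
  also have "(\<lambda>w. conj_act ?H ?M w - (?M w + ad ?H mu w)) = susp A (gauge A h m - (m - delta A 0 h))"
    unfolding susp_gauge_minimal[OF hG m, symmetric]
    using susp_delta[OF H(1)] by (simp add: susp_add susp_diff fun_eq_iff)
  finally show "vanishes_upto k (gauge A h m - (m - delta A 0 h))" unfolding vanishes_upto_susp .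
qed

lemma expd_blocks:
  assumes P: "P \<in> gauge_gen" and X: "mlin X"
  shows "(\<Sum>bs\<in>blocks xs. X (map (expd P proj1) bs)) = expd P X xs"
  using is_hom_unique[OF blocks_sum_is_hom expd_is_hom[OF gauge_genD(3,2)[OF P]] X] .

text \<open>The defining equation of an isotopy is \<open>D\<^sub>M\<^sub>' \<circ> \<Phi> = \<Phi> \<circ> D\<^sub>M\<close>, corestricted to \<open>sH\<close>, for \<open>\<Phi> = exp D\<^sub>P\<close>.\<close>

lemma cinf_isotopy_iff:
  assumes P: "P \<in> gauge_gen" and m: "minimal_cinf A m" and m': "minimal_cinf A m'"
  shows "cinf_isotopy A (susp A (expd P proj1)) m m' \<longleftrightarrow> m' = gauge A (susp A P) m"
proof -
  let ?M = "susp A (m2 A + m)" and ?M' = "susp A (m2 A + m')" and ?\<Phi> = "expd P proj1"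
  have M: "?M \<in> sharr 1" and M': "?M' \<in> sharr 1" by (rule mc_sharr[OF minimal_mc[OF m]], rule mc_sharr[OF minimal_mc[OF m']])
  have \<Phi>: "?\<Phi> \<in> sharr 0" by (rule expd_sharr[OF proj1_sharr gauge_genD(1)[OF P]])
  have one: "?\<Phi> [x] = x" for x using expd_singleton[OF mlin_proj1 gauge_genD(2)[OF P]] by (simp add: proj1_def)
  have harr: "arity_part n (susp A ?\<Phi>) \<in> harr_cochains A n (1 - int n)" if "n \<ge> 2" for n
    using that sharr_restrict_length[OF \<Phi>, of "\<lambda>l. l = n"]
    by (simp add: harr_cochains_iff susp_arity_part) (simp add: arity_part_def)
  have lhs: "(\<Sum>bs\<in>blocks xs. ?M' (map ?\<Phi> bs)) = expd P (coder 1 ?M' proj1) xs" for xs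
    using expd_blocks[OF P sharrD(2)[OF M']] coder_proj1[of ?M' 1] sharrD(1)[OF M'] by simp
  have rhs: "insertion A 1 ?\<Phi> ?M xs = coder 1 ?M ?\<Phi> xs" for xs
    unfolding coder_def using insertion_eq_ins[of ?\<Phi> ?M A 1 xs] sharrD(5)[OF \<Phi>] sharrD(1)[OF M] by blast
  have "cinf_isotopy A (susp A ?\<Phi>) m m' \<longleftrightarrow> expd P (coder 1 ?M' proj1) = coder 1 ?M ?\<Phi>"
    unfolding cinf_isotopy_def susp_susp lhs rhs
    using harr sharrD(1)[OF \<Phi>] one by (auto simp: susp_eq[of A ?\<Phi>])
  also have "\<dots> \<longleftrightarrow> ?M' = conj_act P ?M"
    using conj_act_unique[OF P M M'] expd_coder_conj_act[OF P M mlin_proj1] by auto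
  also have "\<dots> \<longleftrightarrow> m' = gauge A (susp A P) m"
    using susp_gauge_minimal[of "susp A P" m] m P m2_add_cancel[of m'] by (auto simp: gauge_par_iff)
  finally show ?thesis .
qed

text \<open>Each isotopy is an exponential, and its target structure is then forced to be the gauge transform.\<close>

lemma isotopic_mod_iff:
  assumes m: "minimal_cinf A m"
  shows "isotopic_mod A k m m' \<longleftrightarrow> (\<exists>p\<in>gauge_par. vanishes_upto k (gauge A p m - m'))"
proof
  assume "isotopic_mod A k m m'"
  then obtain \<phi> m'' where m'': "minimal_cinf A m''" and iso: "cinf_isotopy A \<phi> m m''"
    and eq: "\<And>xs. length xs \<le> k \<Longrightarrow> m'' xs = m' xs"
    by (auto simp: isotopic_mod_def)
  let ?\<Phi> = "susp A \<phi>"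
  have one: "?\<Phi> [x] = x" for x using iso by (simp add: cinf_isotopy_def susp_eq)
  have "?\<Phi> \<in> sharr 0"
  proof (rule sharr_by_length)
    fix n :: nat
    consider "n = 0" | "n = 1" | "n \<ge> 2" by linarith
    then show "\<exists>F'\<in>sharr 0. \<forall>xs. length xs = n \<longrightarrow> ?\<Phi> xs = F' xs"
    proof cases
      case 1
      then show ?thesis using iso sharr_zero by (intro bexI[of _ "\<lambda>_. 0"]) (auto simp: cinf_isotopy_def susp_eq)
    next
      case 2
      then show ?thesis using proj1_sharr one by (intro bexI[of _ proj1]) (auto simp: proj1_def length_Suc_conv)
    next
      case 3
      then have "arity_part n \<phi> \<in> harr_cochains A n (1 - int n)" using iso by (simp add: cinf_isotopy_def)
      then have "arity_part n ?\<Phi> \<in> sharr 0" using 3 by (simp add: harr_cochains_iff susp_arity_part)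
      then show ?thesis by (intro bexI[of _ "arity_part n ?\<Phi>"]) (auto simp: arity_part_def)
    qed
  qed
  then obtain P where P: "P \<in> gauge_gen" "expd P proj1 = ?\<Phi>" using exists_log one by blast
  have "m'' = gauge A (susp A P) m"
    using cinf_isotopy_iff[OF P(1) m m''] iso by (simp add: P(2))
  then show "\<exists>p\<in>gauge_par. vanishes_upto k (gauge A p m - m')"
    using P(1) eq by (intro bexI[of _ "susp A P"]) (auto simp: vanishes_upto_def gauge_par_iff)
next
  assume "\<exists>p\<in>gauge_par. vanishes_upto k (gauge A p m - m')"
  then obtain p where p: "p \<in> gauge_par" and vanishes_upto: "vanishes_upto k (gauge A p m - m')" by blast
  then have P: "susp A p \<in> gauge_gen" by (simp add: gauge_par_iff)
  have "cinf_isotopy A (susp A (expd (susp A p) proj1)) m (gauge A p m)"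
    using cinf_isotopy_iff[OF P m gauge_minimal[OF p m]] by simp
  then show "isotopic_mod A k m m'"
    unfolding isotopic_mod_def using gauge_minimal[OF p m] vanishes_upto
    by (intro exI[of _ "susp A (expd (susp A p) proj1)"] exI[of _ "gauge A p m"]) (auto simp: vanishes_upto_def)
qed

section \<open>Coboundaries\<close>

text \<open>\<open>\<delta>\<^sup>2 = 0\<close>. The coderivation of the product squares to zero, so of each term only the composite
  product, \<open>H\<close>, product survives, with opposite signs.\<close>

lemma ad_coboundary:
  assumes H: "H \<in> sharr 0"
  shows "coder 1 (ad H mu) mu w + coder 1 mu (ad H mu) w = 0"
proof -
  have "coder 1 (ad H mu) mu w = coder 1 mu (der H mu) w"
    using coder_der[OF sharrD(2)[OF mu_sharr] H mu_sharr, of w] by (simp add: coder_mu_mu)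
  moreover have "coder 1 mu (ad H mu) w = coder 1 mu (coder 1 mu H) w - coder 1 mu (der H mu) w"
    unfolding ad_def by (rule coder_diff1)
  moreover have "coder 1 mu (coder 1 mu H) w = 0"
    by (simp add: coder_mc_square[OF mu_sharr coder_mu_mu sharrD(2)[OF H]])
  ultimately show ?thesis by simp
qed

lemma delta_add:
  assumes f: "susp A f \<in> sharr 0" and g: "susp A g \<in> sharr 0"
  shows "delta A 0 (f + g) = delta A 0 f + delta A 0 g"
proof (rule susp_eqI)
  have e: "susp A (f + g) = (\<lambda>xs. susp A f xs + susp A g xs)" by (rule ext) (simp add: susp_add)
  then have fg: "susp A (f + g) \<in> sharr 0" using sharr_add[OF assms] by simp
  have "ad (\<lambda>xs. susp A f xs + susp A g xs) mu w = ad (susp A f) mu w + ad (susp A g) mu w" for w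
    by (simp add: ad_def coder_def der_def ins_add ins_add2[OF sharrD(5)[OF mu_sharr]])
  then show "susp A (delta A 0 (f + g)) = susp A (delta A 0 f + delta A 0 g)"
    unfolding susp_add[of A "delta A 0 f"] susp_delta[OF f] susp_delta[OF g] susp_delta[OF fg]
    by (simp add: e fun_eq_iff)
qed

end

section \<open>Obstruction cochains\<close>

locale obstruction = fd_graded_comm_algebra A
  for A :: "('k::field_char_0, 'v::ab_group_add) graded_algebra" +
  fixes k :: nat
  assumes k: "k \<ge> 4"
begin

abbreviation "cocycles \<equiv> harr_cocycles A k (2 - int k)"
definition primitives :: "('v list \<Rightarrow> 'v) set" where "primitives = harr_cochains A (k - 1) (2 - int k)"
abbreviation "coboundaries \<equiv> harr_coboundaries A k (2 - int k)"
abbreviation "cocycle_gp \<equiv> cocycle_group A k (2 - int k)"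
abbreviation "harr_gp \<equiv> Harr A k (2 - int k)"
abbreviation "cohom_class \<equiv> harr_class A k (2 - int k)"

lemma coboundaries_eq: "coboundaries = delta A 0 ` primitives"
  by (simp add: harr_coboundaries_def primitives_def)

lemma h_susp: "h \<in> primitives \<longleftrightarrow>
  (\<forall>xs. length xs \<noteq> k - 1 \<longrightarrow> h xs = 0) \<and> susp A h \<in> sharr 0"
  using k by (simp add: primitives_def harr_cochains_iff of_nat_diff)

lemma cocycles_iff: "f \<in> cocycles \<longleftrightarrow> (\<forall>xs. length xs \<noteq> k \<longrightarrow> f xs = 0) \<and>
    susp A f \<in> sharr 1 \<and> (\<forall>w. coder 1 (susp A f) mu w + coder 1 mu (susp A f) w = 0)"
  using k by (simp add: harr_cocycles_iff)

lemma coboundaries_subset: "coboundaries \<subseteq> cocycles"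
proof
  fix f assume "f \<in> coboundaries"
  then obtain h where h: "h \<in> primitives" and f: "f = delta A 0 h"
    by (auto simp: coboundaries_eq)
  let ?H = "susp A h"
  have H: "?H \<in> sharr 0" and H0: "\<And>xs. length xs \<noteq> k - 1 \<Longrightarrow> ?H xs = 0"
    using h by (auto simp: h_susp susp_eq)
  have F: "susp A f = (\<lambda>w. - ad ?H mu w)" unfolding f by (rule susp_delta[OF H])
  have "susp A f xs = 0" if "length xs \<noteq> k" for xs
  proof -
    have "coder 1 mu ?H xs = 0"
      by (rule coder_concentrated[OF sharrD(2)[OF H] H0 mu_eq(2)]) (use that k in auto)
    moreover have "coder 0 ?H mu xs = 0"
      by (rule coder_concentrated[OF sharrD(2)[OF mu_sharr] mu_eq(2) H0]) (use that k in auto)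
    ultimately show ?thesis by (simp add: F ad_def coder_0)
  qed
  then have "f xs = 0" if "length xs \<noteq> k" for xs
    using that by (metis susp_eq susp_args_susp_args length_susp_args)
  moreover have "susp A f \<in> sharr 1" unfolding F by (rule sharr_uminus[OF ad_sharr[OF H mu_sharr]])
  moreover have "coder 1 (susp A f) mu w + coder 1 mu (susp A f) w = 0" for w
  proof -
    have "coder 1 (\<lambda>w. 0) mu w = 0" by (simp add: coder_def ins_zero2[OF sharrD(5)[OF mu_sharr]])
    then have "coder 1 (susp A f) mu w = - coder 1 (ad ?H mu) mu w"
      using coder_diff2[OF sharrD(2)[OF mu_sharr], of 1 "\<lambda>_. 0" "ad ?H mu" w] by (simp add: F)
    moreover have "coder 1 mu (susp A f) w = - coder 1 mu (ad ?H mu) w"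
      using coder_diff1[of 1 mu "\<lambda>_. 0" "ad ?H mu" w] by (simp add: F coder_def)
    ultimately show ?thesis
      using ad_coboundary[OF H, of w] by (simp add: neg_eq_iff_add_eq_0 add.commute)
  qed
  ultimately show "f \<in> cocycles" unfolding cocycles_iff by blast
qed

lemma cocycles_add: "f \<in> cocycles \<Longrightarrow> g \<in> cocycles \<Longrightarrow> f + g \<in> cocycles"
  and cocycles_uminus: "f \<in> cocycles \<Longrightarrow> - f \<in> cocycles" and cocycles_zero: "0 \<in> cocycles"
proof -
  have z: "f - g \<in> cocycles" if f: "f \<in> cocycles" and g: "g \<in> cocycles" for f g
  proof -
    have e: "susp A (f - g) = (\<lambda>w. susp A f w - susp A g w)" by (rule ext) (simp add: susp_diff)
    have "susp A (f - g) \<in> sharr 1" unfolding e using f g by (intro sharr_diff) (auto simp: cocycles_iff)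
    moreover have "coder 1 (susp A (f - g)) mu w + coder 1 mu (susp A (f - g)) w = 0" for w
    proof -
      have "coder 1 (susp A (f - g)) mu w + coder 1 mu (susp A (f - g)) w =
        (coder 1 (susp A f) mu w + coder 1 mu (susp A f) w) - (coder 1 (susp A g) mu w + coder 1 mu (susp A g) w)"
        unfolding e coder_diff1 coder_diff2[OF sharrD(2)[OF mu_sharr]] by simp
      then show ?thesis using f g by (simp add: cocycles_iff)
    qed
    ultimately show ?thesis using f g by (simp add: cocycles_iff)
  qed
  show 0: "0 \<in> cocycles" using coboundaries_subset
    by (simp add: cocycles_iff zero_fun_def[symmetric] sharr_zero[unfolded zero_fun_def[symmetric]])
       (simp add: zero_fun_def coder_def ins_zero2[OF sharrD(5)[OF mu_sharr]])
  show "- f \<in> cocycles" if "f \<in> cocycles" for f using z[OF 0 that] by simp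
  then show "f + g \<in> cocycles" if "f \<in> cocycles" "g \<in> cocycles" for f g using z[OF that(1), of "- g"] that(2) by simp
qed

lemma cocycle_gp_simps [simp]: "carrier cocycle_gp = cocycles" "f \<otimes>\<^bsub>cocycle_gp\<^esub> g = f + g" "\<one>\<^bsub>cocycle_gp\<^esub> = 0"
  by (simp_all add: cocycle_group_def)

lemma cocycle_gp_group: "comm_group cocycle_gp"
  by (rule comm_groupI) (auto simp: cocycles_add cocycles_zero algebra_simps intro!: bexI[of _ "- x" for x] cocycles_uminus)

lemma cocycle_gp_inv: "f \<in> cocycles \<Longrightarrow> inv\<^bsub>cocycle_gp\<^esub> f = - f"
  using cocycle_gp_group by (intro group.inv_equality) (auto simp: comm_group_def cocycles_uminus)

lemma subgroup_cocycle_gpI: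
  assumes "obs_cochains \<subseteq> cocycles" "0 \<in> obs_cochains" "\<And>f g. f \<in> obs_cochains \<Longrightarrow> g \<in> obs_cochains \<Longrightarrow> f + g \<in> obs_cochains" "\<And>f. f \<in> obs_cochains \<Longrightarrow> - f \<in> obs_cochains"
  shows "subgroup obs_cochains cocycle_gp"
  by (rule subgroup.intro) (use assms cocycle_gp_inv in auto)

lemma coboundaries_subgroup: "subgroup coboundaries cocycle_gp"
proof (rule subgroup_cocycle_gpI[OF coboundaries_subset])
  have S0: "susp A h \<in> sharr 0" if "h \<in> primitives" for h using that by (simp add: h_susp)
  have zero: "0 \<in> primitives"
    by (simp add: h_susp) (simp add: zero_fun_def sharr_zero)
  have d0: "delta A 0 0 = 0" using delta_add[of 0 0] S0[OF zero] by simp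
  then show "0 \<in> coboundaries" unfolding coboundaries_eq using zero by force
  have add: "h + h' \<in> primitives" and neg: "- h \<in> primitives"
    if "h \<in> primitives" "h' \<in> primitives" for h h'
  proof -
    have "susp A (h + h') = (\<lambda>w. susp A h w + susp A h' w)" "susp A (- h) = (\<lambda>w. - susp A h w)"
      by (simp_all add: susp_eq fun_eq_iff)
    then show "h + h' \<in> primitives" "- h \<in> primitives"
      using that by (simp_all add: h_susp sharr_add sharr_uminus)
  qed
  show "f + g \<in> coboundaries" if "f \<in> coboundaries" "g \<in> coboundaries" for f g
    using that delta_add S0 add unfolding coboundaries_eq by (auto simp: delta_add[symmetric] image_iff) 
  show "- f \<in> coboundaries" if f: "f \<in> coboundaries" for f
  proof -
    obtain h where h: "h \<in> primitives" "f = delta A 0 h" using f by (auto simp: coboundaries_eq)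
    have "delta A 0 (h + - h) = delta A 0 h + delta A 0 (- h)"
      by (rule delta_add) (use h neg S0 in blast)+
    then have "- f = delta A 0 (- h)" by (simp add: d0 h(2) minus_unique)
    then show ?thesis unfolding coboundaries_eq using neg[OF h(1) h(1)] by blast
  qed
qed

lemma coboundaries_normal: "coboundaries \<lhd> cocycle_gp"
  using cocycle_gp_group coboundaries_subgroup by (simp add: comm_group.normal_iff_subgroup)

lemma harr_gp_eq: "harr_gp = cocycle_gp Mod coboundaries" by (simp add: Harr_def)

lemma harr_gp_group: "group harr_gp"
  unfolding harr_gp_eq by (rule normal.factorgroup_is_group[OF coboundaries_normal])

lemma cohom_class_eq: "cohom_class f = coboundaries #>\<^bsub>cocycle_gp\<^esub> f" by (simp add: harr_class_def)

lemma cohom_class_hom: "cohom_class \<in> hom cocycle_gp harr_gp"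
  using normal.r_coset_hom_Mod[OF coboundaries_normal] by (simp add: harr_gp_eq harr_class_def[abs_def])

lemma one_harr_gp: "\<one>\<^bsub>harr_gp\<^esub> = coboundaries" by (simp add: harr_gp_eq FactGroup_def)

lemma cohom_class_eq_one_iff: "f \<in> cocycles \<Longrightarrow> cohom_class f = coboundaries \<longleftrightarrow> f \<in> coboundaries"
  using group.coset_join1[of cocycle_gp coboundaries f] group.coset_join2[of cocycle_gp f coboundaries] cocycle_gp_group coboundaries_subgroup coboundaries_subset
  by (auto simp: cohom_class_eq comm_group_def)

text \<open>The obstruction set before passing to cohomology. The hom-sets of the groupoid are visible already
  at this level.\<close>

definition obs_cochains :: "('v list \<Rightarrow> 'v) \<Rightarrow> ('v list \<Rightarrow> 'v) \<Rightarrow> ('v list \<Rightarrow> 'v) set" where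
  "obs_cochains m m' = {arity_part k (gauge A p m - m') |p. p \<in> gauge_par \<and> vanishes_upto (k - 1) (gauge A p m - m')}"

lemma obs_cochainsI: "p \<in> gauge_par \<Longrightarrow> vanishes_upto (k - 1) (gauge A p m - m') \<Longrightarrow> arity_part k (gauge A p m - m') = a \<Longrightarrow> a \<in> obs_cochains m m'"
  by (auto simp: obs_cochains_def)

lemma gauge_set_eq:
  assumes "minimal_cinf A m" "minimal_cinf A m'"
  shows "gauge_set A (k - 1) m m' = {p \<in> gauge_par. vanishes_upto (k - 1) (gauge A p m - m')}"
proof -
  have "gauge A p m - m' \<in> gla_filt A (k - 1) 1 \<longleftrightarrow> vanishes_upto (k - 1) (gauge A p m - m')" if "p \<in> gauge_par" for p
  proof -
    have "susp A (gauge A p m - m') = (\<lambda>w. susp A (gauge A p m) w - susp A m' w)"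
      by (rule ext) (simp add: susp_diff)
    then have "susp A (gauge A p m - m') \<in> sharr 1"
      using sharr_diff minimal_sharr[OF gauge_minimal[OF that assms(1)]] minimal_sharr[OF assms(2)] by simp
    then show ?thesis using k by (simp add: gla_filt_iff vanishes_upto_susp)
  qed
  then show ?thesis unfolding gauge_set_def gauge_par_def[symmetric] by auto
qed

lemma obs_set_eq:
  assumes "minimal_cinf A m" "minimal_cinf A m'"
  shows "obs_set A k m m' = cohom_class ` obs_cochains m m'"
  unfolding obs_set_def gauge_set_eq[OF assms] obs_cochains_def obs_cochain_def by auto

lemma obs_cochains_cocycles:
  assumes "minimal_cinf A m" "minimal_cinf A m'"
  shows "obs_cochains m m' \<subseteq> cocycles"
  using k by (auto simp: obs_cochains_def intro!: difference_cocycle gauge_minimal assms)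

lemma arity_part_add: "arity_part k (f + g) = arity_part k f + arity_part k g"
  by (auto simp: arity_part_def)

lemma arity_part_vanishes_upto: "vanishes_upto k (f - g) \<Longrightarrow> arity_part k f = arity_part k g"
  by (auto simp: arity_part_def vanishes_upto_def)

lemma vanishes_upto_trans: "vanishes_upto q (f - g) \<Longrightarrow> vanishes_upto q g \<Longrightarrow> vanishes_upto q (f :: 'v list \<Rightarrow> 'v)"
  by (auto simp: vanishes_upto_def)

text \<open>Leading terms are additive along \<open>x \<rightarrow> y \<rightarrow> z\<close>: acting with the second gauge parameter does not alter
  the leading term of the first difference.\<close>

lemma obs_cochains_add:
  assumes x: "minimal_cinf A x" and y: "minimal_cinf A y" and a: "a \<in> obs_cochains x y" and b: "b \<in> obs_cochains y z"
  shows "a + b \<in> obs_cochains x z"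
proof -
  obtain p where p: "p \<in> gauge_par" "vanishes_upto (k - 1) (gauge A p x - y)" "a = arity_part k (gauge A p x - y)"
    using a by (auto simp: obs_cochains_def)
  obtain q where q: "q \<in> gauge_par" "vanishes_upto (k - 1) (gauge A q y - z)" "b = arity_part k (gauge A q y - z)"
    using b by (auto simp: obs_cochains_def)
  obtain r where r: "r \<in> gauge_par" "gauge A r x = gauge A q (gauge A p x)"
    using gauge_comp[OF q(1) p(1)] x by blast
  have l: "vanishes_upto k (gauge A q (gauge A p x) - gauge A q y - (gauge A p x - y))"
    using gauge_local[OF q(1) gauge_minimal[OF p(1) x] y p(2)] k by simp
  \<comment> \<open>Compare via the image of \<open>y\<close> under the second gauge parameter.\<close>
  have split: "gauge A r x - z = (gauge A q (gauge A p x) - gauge A q y) + (gauge A q y - z)"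
    by (simp add: r(2))
  have "vanishes_upto (k - 1) (gauge A q (gauge A p x) - gauge A q y)"
    by (rule vanishes_upto_trans[OF vanishes_upto_mono[OF l] p(2)]) simp
  then have "vanishes_upto (k - 1) (gauge A r x - z)"
    using q(2) unfolding split by (simp add: vanishes_upto_def)
  moreover have "arity_part k (gauge A r x - z) = a + b"
    unfolding split arity_part_add arity_part_vanishes_upto[OF l] p(3) q(3) ..
  ultimately show ?thesis by (rule obs_cochainsI[OF r(1)])
qed

text \<open>Acting with the inverse parameter on the difference exchanges the two structures and keeps the leading term, up to sign.\<close>

lemma obs_cochains_uminus:
  assumes x: "minimal_cinf A x" and y: "minimal_cinf A y" and a: "a \<in> obs_cochains x y"
  shows "- a \<in> obs_cochains y x"
proof -
  obtain p where p: "p \<in> gauge_par" "vanishes_upto (k - 1) (gauge A p x - y)" "a = arity_part k (gauge A p x - y)"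
    using a by (auto simp: obs_cochains_def)
  obtain q where q: "q \<in> gauge_par" "gauge A q (gauge A p x) = x"
    using gauge_inverse[OF p(1)] x by blast
  have p': "vanishes_upto (k - 1) (y - gauge A p x)" using p(2) by (auto simp: vanishes_upto_def)
  have l: "vanishes_upto k (gauge A q y - x - (y - gauge A p x))"
    using gauge_local[OF q(1) y gauge_minimal[OF p(1) x] p'] k by (simp add: q(2))
  have "vanishes_upto (k - 1) (gauge A q y - x)"
    by (rule vanishes_upto_trans[OF vanishes_upto_mono[OF l] p']) simp
  moreover have "arity_part k (gauge A q y - x) = - a"
    unfolding arity_part_vanishes_upto[OF l] p(3) by (auto simp: arity_part_def)
  ultimately show ?thesis by (rule obs_cochainsI[OF q(1)])
qed

lemma obs_cochains_truncation:
  assumes "minimal_cinf A n" "minimal_cinf A n'" "minimal_cinf A m" "minimal_cinf A m'"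
    and l: "vanishes_upto k (n - m)" "vanishes_upto k (n' - m')"
  shows "obs_cochains n n' \<subseteq> obs_cochains m m'"
proof
  fix a assume "a \<in> obs_cochains n n'"
  then obtain p where p: "p \<in> gauge_par" "vanishes_upto (k - 1) (gauge A p n - n')" "a = arity_part k (gauge A p n - n')"
    by (auto simp: obs_cochains_def)
  have "vanishes_upto k (gauge A p n - gauge A p m - (n - m))"
    by (rule vanishes_upto_mono[OF gauge_local[OF p(1) assms(1,3) l(1)]]) simp
  with l have e: "vanishes_upto k ((gauge A p m - m') - (gauge A p n - n'))" by (auto simp: vanishes_upto_def)
  have "vanishes_upto (k - 1) (gauge A p m - m')"
    by (rule vanishes_upto_trans[OF vanishes_upto_mono[OF e] p(2)]) simp
  then show "a \<in> obs_cochains m m'" using arity_part_vanishes_upto[OF e] p(3) by (intro obs_cochainsI[OF p(1)]) simp_all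
qed

text \<open>A primitive \<open>h\<close> of the leading term is used as a further gauge parameter to cancel it.\<close>

lemma isotopic_iff_obs_cochains:
  assumes m: "minimal_cinf A m" and m': "minimal_cinf A m'"
  shows "isotopic_mod A k m m' \<longleftrightarrow> obs_cochains m m' \<inter> coboundaries \<noteq> {}"
proof
  assume "isotopic_mod A k m m'"
  then obtain p where p: "p \<in> gauge_par" "vanishes_upto k (gauge A p m - m')" using isotopic_mod_iff[OF m] by blast
  then have "arity_part k (gauge A p m - m') = 0" by (auto simp: arity_part_def vanishes_upto_def)
  moreover have "vanishes_upto (k - 1) (gauge A p m - m')" by (rule vanishes_upto_mono[OF p(2)]) simp
  ultimately have "0 \<in> obs_cochains m m'" by (intro obs_cochainsI[OF p(1)])
  moreover have "0 \<in> coboundaries" using subgroup.one_closed[OF coboundaries_subgroup] by simp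
  ultimately show "obs_cochains m m' \<inter> coboundaries \<noteq> {}" by blast
next
  assume "obs_cochains m m' \<inter> coboundaries \<noteq> {}"
  then obtain f where f: "f \<in> obs_cochains m m'" "f \<in> coboundaries" by blast
  then obtain p where p: "p \<in> gauge_par" "vanishes_upto (k - 1) (gauge A p m - m')" "f = arity_part k (gauge A p m - m')"
    by (auto simp: obs_cochains_def)
  obtain h where h: "h \<in> primitives" "arity_part k (gauge A p m - m') = delta A 0 h"
    using f(2) unfolding p(3) coboundaries_eq by blast
  have k3: "k \<ge> 3" using k by simp
  obtain r where r: "r \<in> gauge_par" "gauge A r m = gauge A h (gauge A p m)"
    using gauge_comp[OF coboundary_gauge(1)[OF h(1)[unfolded primitives_def] k3] p(1)] m by blast
  have l: "vanishes_upto k (gauge A r m - (gauge A p m - delta A 0 h))"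
    unfolding r(2) by (rule coboundary_gauge(2)[OF h(1)[unfolded primitives_def] k3 gauge_minimal[OF p(1) m]])
  have "vanishes_upto k (gauge A p m - m' - delta A 0 h)"
    unfolding h(2)[symmetric] using p(2) by (auto simp: vanishes_upto_def arity_part_def)
  with l have "vanishes_upto k (gauge A r m - m')" by (simp add: vanishes_upto_def algebra_simps)
  then show "isotopic_mod A k m m'" using isotopic_mod_iff[OF m] r(1) by blast
qed

end

theorem theorem4p17:
  fixes A :: "('k::field_char_0, 'v::ab_group_add) graded_algebra"
    and m m' :: "'v list \<Rightarrow> 'v"
    and k :: nat
  assumes "fd_graded_comm_algebra A"
    and "minimal_cinf A m" and "minimal_cinf A m'"
    and "k \<ge> 4"
    and "isotopic_mod A (k - 1) m m'"
  shows "(\<forall>p \<in> gauge_set A (k - 1) m m'.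
            obs_cochain A k p m m' \<in> harr_cochains A k (2 - int k) \<and>
            obs_cochain A k p m m' \<in> harr_cocycles A k (2 - int k))
       \<and> (\<forall>n n'. minimal_cinf A n \<and> minimal_cinf A n' \<and>
                 n - m \<in> gla_filt A k 1 \<and> n' - m' \<in> gla_filt A k 1 \<longrightarrow>
                 obs_set A k n n' = obs_set A k m m')
       \<and> (\<forall>n n'. minimal_cinf A n \<and> minimal_cinf A n' \<and>
                 (\<forall>xs. length xs \<le> k \<longrightarrow> n xs = m xs \<and> n' xs = m' xs) \<longrightarrow>
                 obs_set A k n n' = obs_set A k m m')
       \<and> (\<one>\<^bsub>Harr A k (2 - int k)\<^esub> \<in> obs_set A k m m' \<longleftrightarrow> isotopic_mod A k m m')
       \<and> obs_set A k m m = obs_set A k m' m'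
       \<and> subgroup (obs_set A k m m) (Harr A k (2 - int k))
       \<and> obs_set A k m m' \<in> rcosets\<^bsub>Harr A k (2 - int k)\<^esub> (obs_set A k m m)"
proof -
  interpret obstruction A k
    using assms(1,4) by (simp add: obstruction_def obstruction_axioms_def)
  note m = assms(2) and m' = assms(3)
  have cocycle: "obs_cochain A k p m m' \<in> cocycles" if "p \<in> gauge_set A (k - 1) m m'" for p
    using that obs_cochains_cocycles[OF m m'] unfolding gauge_set_eq[OF m m'] obs_cochain_def obs_cochains_def by blast
  have cochain: "f \<in> harr_cochains A k (2 - int k)" if "f \<in> cocycles" for f
    using that by (simp add: harr_cocycles_def)
  have truncation: "obs_set A k n n' = obs_set A k m m'"
    if n: "minimal_cinf A n" "minimal_cinf A n'" and l: "vanishes_upto k (n - m)" "vanishes_upto k (n' - m')" for n n'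
  proof -
    have l': "vanishes_upto k (m - n)" "vanishes_upto k (m' - n')" using l by (auto simp: vanishes_upto_def)
    have "obs_cochains n n' = obs_cochains m m'"
      using obs_cochains_truncation[OF n m m' l] obs_cochains_truncation[OF m m' n l'] by blast
    then show ?thesis by (simp add: obs_set_eq n m m')
  qed
  have filt: "vanishes_upto k (n - m)" if "n - m \<in> gla_filt A k 1" for n m
    using that by (auto simp: gla_filt_def vanishes_upto_def)
  have "\<one>\<^bsub>harr_gp\<^esub> \<in> obs_set A k m m' \<longleftrightarrow> obs_cochains m m' \<inter> coboundaries \<noteq> {}"
    using obs_cochains_cocycles[OF m m'] cohom_class_eq_one_iff unfolding one_harr_gp obs_set_eq[OF m m'] image_iff by blast
  then have zero: "\<one>\<^bsub>harr_gp\<^esub> \<in> obs_set A k m m' \<longleftrightarrow> isotopic_mod A k m m'"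
    by (simp add: isotopic_iff_obs_cochains[OF m m'])
  obtain a where a: "a \<in> obs_cochains m m'"
    using assms(5) obs_cochainsI unfolding isotopic_mod_iff[OF m] by blast
  have a': "- a \<in> obs_cochains m' m" by (rule obs_cochains_uminus[OF m m' a])
  have aZ: "a \<in> cocycles" using a obs_cochains_cocycles[OF m m'] by blast
  have "obs_cochains m m \<subseteq> obs_cochains m' m'"
  proof
    fix v assume v: "v \<in> obs_cochains m m"
    have "- a + v + a \<in> obs_cochains m' m'" by (rule obs_cochains_add[OF m' m obs_cochains_add[OF m' m a' v] a])
    then show "v \<in> obs_cochains m' m'" by simp
  qed
  moreover have "obs_cochains m' m' \<subseteq> obs_cochains m m"
  proof
    fix v assume v: "v \<in> obs_cochains m' m'"
    have "a + v + - a \<in> obs_cochains m m" by (rule obs_cochains_add[OF m m' obs_cochains_add[OF m m' a v] a'])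
    then show "v \<in> obs_cochains m m" by simp
  qed
  ultimately have equal: "obs_set A k m m = obs_set A k m' m'"
    by (simp add: obs_set_eq m m')
  have "0 \<in> obs_cochains m m" using obs_cochains_add[OF m m' a a'] by simp
  then have "subgroup (obs_cochains m m) cocycle_gp"
    by (intro subgroup_cocycle_gpI obs_cochains_cocycles obs_cochains_add[OF m m] obs_cochains_uminus m)
  then have sub: "subgroup (obs_set A k m m) harr_gp"
    unfolding obs_set_eq[OF m m]
    using group_hom.subgroup_img_is_subgroup[of cocycle_gp harr_gp cohom_class] cocycle_gp_group harr_gp_group cohom_class_hom
    by (simp add: group_hom_def group_hom_axioms_def comm_group_def)
  have "obs_cochains m m' = (\<lambda>v. v + a) ` obs_cochains m m"
  proof (intro equalityI subsetI)
    fix b assume "b \<in> obs_cochains m m'"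
    then have "b + - a \<in> obs_cochains m m" by (rule obs_cochains_add[OF m m' _ a'])
    then show "b \<in> (\<lambda>v. v + a) ` obs_cochains m m" by (intro image_eqI[of _ _ "b + - a"]) simp_all
  qed (use obs_cochains_add[OF m m _ a] in blast)
  then have "obs_set A k m m' = cohom_class ` (\<lambda>v. v + a) ` obs_cochains m m"
    by (simp add: obs_set_eq m m')
  also have "\<dots> = (\<lambda>v. cohom_class v \<otimes>\<^bsub>harr_gp\<^esub> cohom_class a) ` obs_cochains m m"
    unfolding image_image
    by (rule image_cong[OF refl]) (use hom_mult[OF cohom_class_hom] obs_cochains_cocycles[OF m m] aZ in auto)
  also have "\<dots> = obs_set A k m m #>\<^bsub>harr_gp\<^esub> cohom_class a"
    by (auto simp: obs_set_eq[OF m m] r_coset_def)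
  finally have "obs_set A k m m' \<in> rcosets\<^bsub>harr_gp\<^esub> (obs_set A k m m)"
    using hom_in_carrier[OF cohom_class_hom, of a] aZ by (auto simp: RCOSETS_def)
  then show ?thesis
    using cocycle cochain truncation filt zero equal sub by (auto simp: vanishes_upto_def)
qed

end
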